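(* Let $d\ge2$ and let $\mathcal N$ be a Poisson random set on $\mathbb R^d$ with intensity comparable to Lebesgue measure. Let $N_n$ be the number of self-avoiding paths of length $n$ ($n$ steps) starting at $v(0)$ on the Delaunay triangulation $\mathcal D(\mathcal N)$, and let $\kappa_n=\log N_n$. There exist positive constants $z_3$ and $c_2$ such that for every $n\ge1$ and every $u\ge nz_3$, $$\mathbb P(\kappa_n\ge u)\le e^{-c_2u^{1/3}}.$$ In particular, $\mathbb E(\kappa_n)=O(n)$.
   Context: Comparability of the intensity $\mu$ to Lebesgue measure $\lambda_d$: there is $c_\mu>0$ with $\frac1{c_\mu}\lambda_d(A)\le\mu(A)\le c_\mu\lambda_d(A)$ for every Lebesgue-measurable $A\subset\mathbb R^d$. For $v\in\mathcal N$, the Voronoi tile $C_v$ is the set of points at least as close to $v$ as to any other point of $\mathcal N$; $v(0)$ is the a.s. unique $v\in\mathcal N$ with $0\in C_v$. $\mathcal D(\mathcal N)$ is the graph with vertex set $\mathcal N$ and an edge $\{u,v\}$ whenever $C_u$ and $C_v$ share a $(d-1)$-dimensional face. *)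

theory Defs
  imports "HOL-Probability.Probability" "HOL-Library.Landau_Symbols"
begin

definition comparable_to_lebesgue :: "'a::euclidean_space measure \<Rightarrow> bool" where
  "comparable_to_lebesgue \<mu> \<longleftrightarrow> sets \<mu> = sets lebesgue \<and>
     (\<exists>c>0. \<forall>A\<in>sets lebesgue.
        ennreal (1 / c) * emeasure lebesgue A \<le> emeasure \<mu> A \<and>
        emeasure \<mu> A \<le> ennreal c * emeasure lebesgue A)"

(* The number of points of N in A as an extended number: card would send infinite sets to 0. *)
abbreviation num_points :: "'a set \<Rightarrow> 'a set \<Rightarrow> ennreal" where
  "num_points N A \<equiv> emeasure (count_space UNIV) (N \<inter> A)"

(* A set of infinite intensity contains infinitely many points almost surely.  Independence for
   sequences of disjoint sets includes finite families, which can be padded with {}.  Only Borel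
   sets are tested, so that no completeness of the probability space is needed. *)
definition poisson_random_set ::
    "'w measure \<Rightarrow> 'a::euclidean_space measure \<Rightarrow> ('w \<Rightarrow> 'a set) \<Rightarrow> bool" where
  "poisson_random_set M \<mu> N \<longleftrightarrow>
     (\<forall>A\<in>sets borel.
        (\<lambda>\<omega>. num_points (N \<omega>) A) \<in> borel_measurable M \<and>
        (emeasure \<mu> A < \<infinity> \<longrightarrow>
           (\<forall>k::nat. measure M {\<omega> \<in> space M. num_points (N \<omega>) A = of_nat k} =
                measure \<mu> A ^ k / fact k * exp (- measure \<mu> A))) \<and>
        (emeasure \<mu> A = \<infinity> \<longrightarrow> (AE \<omega> in M. num_points (N \<omega>) A = \<infinity>))) \<and>
     (\<forall>A :: nat \<Rightarrow> 'a set. range A \<subseteq> sets borel \<longrightarrow> disjoint_family A \<longrightarrow>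
        prob_space.indep_vars M (\<lambda>_. borel) (\<lambda>i \<omega>. num_points (N \<omega>) (A i)) UNIV)"

definition voronoi_tile :: "'a::euclidean_space set \<Rightarrow> 'a \<Rightarrow> 'a set" where
  "voronoi_tile N v = {x. \<forall>w\<in>N. dist x v \<le> dist x w}"

(* v(0); it is unspecified on the null event where 0 does not lie in exactly one tile. *)
definition origin_nucleus :: "'a::euclidean_space set \<Rightarrow> 'a" where
  "origin_nucleus N = (THE v. v \<in> N \<and> 0 \<in> voronoi_tile N v)"

definition delaunay_adj :: "'a::euclidean_space set \<Rightarrow> 'a \<Rightarrow> 'a \<Rightarrow> bool" where
  "delaunay_adj N u v \<longleftrightarrow> u \<in> N \<and> v \<in> N \<and> u \<noteq> v \<and>
     (\<exists>F. F face_of voronoi_tile N u \<and> F face_of voronoi_tile N v \<and>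
          aff_dim F = int (DIM('a)) - 1)"

(* A path with n steps is given by its list of n + 1 vertices. *)
definition delaunay_saws :: "'a::euclidean_space set \<Rightarrow> nat \<Rightarrow> 'a list set" where
  "delaunay_saws N n = {xs. length xs = n + 1 \<and> hd xs = origin_nucleus N \<and> set xs \<subseteq> N \<and>
     distinct xs \<and> successively (delaunay_adj N) xs}"

(* ln and card are the meaningful quantities only if there are finitely many, and at least one,
   such paths. *)
definition log_num_saws :: "'a::euclidean_space set \<Rightarrow> nat \<Rightarrow> real" where
  "log_num_saws N n = ln (real (card (delaunay_saws N n)))"

end

(* The space is tiled by cubes of a large side K.  A Delaunay edge of length r forces an empty ball of
   radius at least r/2 touching its endpoints, hence nearby empty cubes of side K * 4^k at every scale up to
   a constant multiple of r.  The cells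
   visited by a self-avoiding path, enlarged at the scale of the holes met, form a connected set A of
   cells.  At scale k such a set is followed by a coarse walk of about |A| / 4^k steps, so the entropy of
   this walk is beaten by the cost of an empty volume |A| / 2^k; this keeps |A| linear in n outside an
   event of stretched exponentially small probability.  Inside A the paths are counted by a Kraft sum
   with weights depending on the scale of each hop; the total weight is controlled by the number of
   points per cell and by the holes through x * t <= ln (x!) + exp t. *)
theory Submission
  imports Defs
begin

text \<open>The obstacle is circular: the length of a hop depends on the holes near its start, while
  the holes to be controlled lie along a path of unknown extent. It is broken by fixing a size
  \<open>m\<close> beforehand and demanding sparsity of holes along every walk from the origin that
  could cover \<open>m\<close> cells. The holes then add at most \<open>m / 2\<close> cells,
  whatever part of a connected set of at most \<open>m\<close> cells the path has visited, and
  \<open>m\<close> of order \<open>n\<close> leaves the other half to the path itself. The exponent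
  1/3 comes from the hole estimate. At scale \<open>k\<close> a violation costs a volume of order at
  least \<open>m / 2 ^ k\<close>, and at least one cube, hence at least \<open>4 ^ k\<close>; the
  sum of the two is at least \<open>m powr (1 / 3)\<close>, and a further \<open>4 ^ k\<close> makes
  the infinitely many scales summable. Point counts fail only with probability
  \<open>exp (- m)\<close>. Since the logarithm of \<open>card\<close> is blind to an infinite or
  empty set of paths, almost sure finiteness and existence are proved separately: finiteness by
  letting \<open>m\<close> grow at fixed \<open>n\<close>, existence from an edge leaving every
  finite set of nuclei.\<close>

section \<open>Cells, their boxes and their coarsening\<close>

definition cell :: "real \<Rightarrow> 'a::euclidean_space \<Rightarrow> 'a \<Rightarrow> int" where
  "cell s x = (\<lambda>b\<in>Basis. \<lfloor>(x \<bullet> b) / s\<rfloor>)"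

text \<open>Lattice points are functions that are extensional on \<open>Basis\<close>, so that
  equality is coordinatewise and the box in the sup norm is a finite product with a known
  cardinality.\<close>

definition nbhd :: "int \<Rightarrow> ('a::euclidean_space \<Rightarrow> int) \<Rightarrow> ('a \<Rightarrow> int) set" where
  "nbhd r z = (\<Pi>\<^sub>E b\<in>Basis. {z b - r..z b + r})"

definition coarsen :: "nat \<Rightarrow> ('a::euclidean_space \<Rightarrow> int) \<Rightarrow> 'a \<Rightarrow> int" where
  "coarsen k z = (\<lambda>b\<in>Basis. z b div 4 ^ k)"

abbreviation cube :: "real \<Rightarrow> ('a::euclidean_space \<Rightarrow> int) \<Rightarrow> 'a set" where
  "cube s z \<equiv> cell s -` {z}"

lemma cell_extensional [simp]: "cell s x \<in> extensional Basis"
  by (simp add: cell_def)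

lemma coarsen_extensional [simp]: "coarsen k z \<in> extensional Basis"
  by (simp add: coarsen_def)

lemma nbhd_extensional: "w \<in> nbhd r z \<Longrightarrow> w \<in> extensional Basis"
  by (auto simp: nbhd_def PiE_def)

lemma finite_nbhd [simp]: "finite (nbhd r z)"
  by (simp add: nbhd_def finite_PiE)

lemma card_nbhd: "card (nbhd r (z :: 'a::euclidean_space \<Rightarrow> int)) = nat (2 * r + 1) ^ DIM('a)"
  by (simp add: nbhd_def card_PiE algebra_simps)

lemma mem_nbhd_iff:
  "w \<in> extensional Basis \<Longrightarrow> w \<in> nbhd r z \<longleftrightarrow> (\<forall>b\<in>Basis. \<bar>w b - z b\<bar> \<le> r)"
  by (auto simp: nbhd_def PiE_iff abs_le_iff)

lemma nbhdD: "w \<in> nbhd r z \<Longrightarrow> b \<in> Basis \<Longrightarrow> \<bar>w b - z b\<bar> \<le> r"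
  by (auto simp: nbhd_def PiE_iff abs_le_iff)

lemma nbhdI: "w \<in> extensional Basis \<Longrightarrow> (\<And>b. b \<in> Basis \<Longrightarrow> \<bar>w b - z b\<bar> \<le> r) \<Longrightarrow> w \<in> nbhd r z"
  by (simp add: mem_nbhd_iff)

lemma nbhd_refl: "z \<in> extensional Basis \<Longrightarrow> r \<ge> 0 \<Longrightarrow> z \<in> nbhd r z"
  by (simp add: mem_nbhd_iff)

lemma nbhd_sym: "w \<in> nbhd r z \<Longrightarrow> z \<in> extensional Basis \<Longrightarrow> z \<in> nbhd r w"
  by (auto intro!: nbhdI dest: nbhdD simp: abs_minus_commute)

lemma nbhd_mono: "r \<le> r' \<Longrightarrow> nbhd r z \<subseteq> nbhd r' z"
  by (auto simp: nbhd_def PiE_iff) (smt (verit))+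

lemma nbhd_trans: "w \<in> nbhd r z \<Longrightarrow> v \<in> nbhd r' w \<Longrightarrow> v \<in> nbhd (r + r') z"
  by (rule nbhdI, erule nbhd_extensional) (smt (verit) nbhdD)

lemma coarsen_cell:
  assumes "K > 0" shows "coarsen k (cell K x) = cell (K * 4 ^ k) x"
proof -
  have "\<lfloor>(x \<bullet> b) / K\<rfloor> div 4 ^ k = \<lfloor>(x \<bullet> b) / (K * 4 ^ k)\<rfloor>" for b
    using floor_divide_real_eq_div[of "4 ^ k" "(x \<bullet> b) / K"] by simp
  then show ?thesis by (auto simp: coarsen_def cell_def restrict_def)
qed

lemma div_diff_le:
  fixes a b n t :: int
  assumes "n > 0" "\<bar>a - b\<bar> \<le> t * n"
  shows "\<bar>a div n - b div n\<bar> \<le> t"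
proof -
  have "a div n \<le> (b + t * n) div n" "b div n \<le> (a + t * n) div n"
    using assms zdiv_mono1[of a "b + t * n" n] zdiv_mono1[of b "a + t * n" n] by linarith+
  then show ?thesis using assms(1) by auto
qed

lemma coarsen_nbhd:
  assumes "w \<in> nbhd (4 ^ k) z" shows "coarsen k w \<in> nbhd 1 (coarsen k z)"
proof (rule nbhdI)
  fix b :: 'a assume "b \<in> Basis"
  with nbhdD[OF assms this] show "\<bar>coarsen k w b - coarsen k z b\<bar> \<le> 1"
    using div_diff_le[of "4 ^ k" "w b" "z b" 1] by (simp add: coarsen_def)
qed simp

lemma nbhd_step:
  assumes w: "w \<in> nbhd (r + 1) z" and r: "r \<ge> 0"
  shows "\<exists>w'\<in>nbhd r z. w \<in> nbhd 1 w'"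
proof
  let ?w = "\<lambda>b\<in>Basis. w b - sgn (w b - z b)"
  show "?w \<in> nbhd r z"
  proof (rule nbhdI)
    fix b :: 'a assume "b \<in> Basis"
    with nbhdD[OF w this] r show "\<bar>?w b - z b\<bar> \<le> r" by (auto simp: sgn_if)
  qed simp
  show "w \<in> nbhd 1 ?w"
    by (rule nbhdI) (use w in \<open>auto simp: sgn_if nbhd_extensional\<close>)
qed

section \<open>Lattice walks and connected sets of cells\<close>

definition step_in :: "('a::euclidean_space \<Rightarrow> int) set \<Rightarrow> (('a \<Rightarrow> int) \<times> ('a \<Rightarrow> int)) set" where
  "step_in A = {(x, y). x \<in> A \<and> y \<in> A \<and> y \<in> nbhd 1 x}"

definition linked :: "('a::euclidean_space \<Rightarrow> int) \<Rightarrow> ('a \<Rightarrow> int) set \<Rightarrow> bool" where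
  "linked z A \<longleftrightarrow> z \<in> A \<and> A \<subseteq> extensional Basis \<and> (\<forall>w\<in>A. (z, w) \<in> (step_in A)\<^sup>*)"

definition walks :: "('a::euclidean_space \<Rightarrow> int) \<Rightarrow> nat \<Rightarrow> ('a \<Rightarrow> int) list set" where
  "walks z l = {V. length V = Suc l \<and> hd V = z \<and> successively (\<lambda>x y. y \<in> nbhd 1 x) V}"

lemma step_in_mono: "A \<subseteq> B \<Longrightarrow> (step_in A)\<^sup>* \<subseteq> (step_in B)\<^sup>*"
  by (rule rtrancl_mono) (auto simp: step_in_def)

lemma linked_nbhd_path:
  assumes z: "z \<in> extensional Basis" and r: "r \<ge> 0"
  shows "w \<in> nbhd r z \<Longrightarrow> (z, w) \<in> (step_in (nbhd r z))\<^sup>*"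
  using r
proof (induction r arbitrary: w rule: int_ge_induct)
  case base
  then have "w = z" using z nbhd_extensional
    by (intro extensionalityI[of w Basis z]) (auto dest: nbhdD)
  then show ?case by simp
next
  case (step r)
  then obtain w' where w': "w' \<in> nbhd r z" "w \<in> nbhd 1 w'" using nbhd_step by blast
  have sub: "nbhd r z \<subseteq> nbhd (r + 1) z" by (rule nbhd_mono) simp
  then have "(z, w') \<in> (step_in (nbhd (r + 1) z))\<^sup>*"
    using step.IH[OF w'(1)] step_in_mono by blast
  moreover have "(w', w) \<in> step_in (nbhd (r + 1) z)"
    using w' sub step.prems by (auto simp: step_in_def)
  ultimately show ?case by (rule rtrancl_into_rtrancl)
qed

lemma linked_singleton: "z \<in> extensional Basis \<Longrightarrow> linked z {z}"
  by (simp add: linked_def)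

lemma linked_Un_nbhds:
  assumes A: "linked z A" and w: "w \<in> A" and R: "\<And>r. r \<in> R \<Longrightarrow> r \<ge> 0"
  shows "linked z (A \<union> (\<Union>r\<in>R. nbhd r w))" (is "linked z ?B")
proof -
  have ew: "w \<in> extensional Basis" using A w by (auto simp: linked_def)
  have "(z, v) \<in> (step_in ?B)\<^sup>*" if v: "v \<in> ?B" for v
  proof (cases "v \<in> A")
    case True
    then show ?thesis using A step_in_mono[of A ?B] by (auto simp: linked_def)
  next
    case False
    then obtain r where r: "r \<in> R" "v \<in> nbhd r w" using v by auto
    have "(w, v) \<in> (step_in (nbhd r w))\<^sup>*" using linked_nbhd_path[OF ew R[OF r(1)] r(2)] .
    moreover have "(z, w) \<in> (step_in A)\<^sup>*" using A w by (auto simp: linked_def)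
    moreover have "nbhd r w \<subseteq> ?B" "A \<subseteq> ?B" using r by auto
    ultimately show ?thesis using step_in_mono by (meson rtrancl_trans subsetD)
  qed
  moreover have "?B \<subseteq> extensional Basis"
    using A by (auto simp: linked_def dest: nbhd_extensional)
  moreover have "z \<in> ?B" using A by (simp add: linked_def)
  ultimately show ?thesis unfolding linked_def by blast
qed

lemma walks_extensional:
  assumes "z \<in> extensional Basis" "V \<in> walks z l" "w \<in> set V"
  shows "w \<in> extensional Basis"
proof -
  have "successively (\<lambda>x y. y \<in> nbhd 1 x) V \<Longrightarrow> hd V \<in> extensional Basis \<Longrightarrow> w \<in> set V \<Longrightarrow>
      w \<in> extensional Basis" for V :: "('a \<Rightarrow> int) list"
    by (induction V rule: induct_list012) (auto dest: nbhd_extensional)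
  then show ?thesis using assms by (auto simp: walks_def)
qed

lemma card_walks:
  fixes z :: "'a::euclidean_space \<Rightarrow> int"
  shows "finite (walks z l) \<and> card (walks z l) \<le> (3 ^ DIM('a)) ^ l"
proof (induction l)
  case 0
  have "walks z 0 = {[z]}" by (auto simp: walks_def length_Suc_conv)
  then show ?case by simp
next
  case (Suc l)
  let ?S = "SIGMA V:walks z l. nbhd 1 (last V)"
  have sub: "walks z (Suc l) \<subseteq> (\<lambda>(V, w). V @ [w]) ` ?S"
  proof
    fix V assume V: "V \<in> walks z (Suc l)"
    then obtain U w where U: "V = U @ [w]" "U \<noteq> []"
      by (cases V rule: rev_cases) (force simp: walks_def)+
    then have "(U, w) \<in> ?S" using V by (auto simp: walks_def successively_append_iff)
    then show "V \<in> (\<lambda>(V, w). V @ [w]) ` ?S" using U by force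
  qed
  have fin: "finite ?S" using Suc by auto
  have "card (walks z (Suc l)) \<le> card ?S"
    using card_mono[OF finite_imageI[OF fin] sub] card_image_le[OF fin] le_trans by blast
  also have "\<dots> = (\<Sum>V\<in>walks z l. card (nbhd 1 (last V)))"
    using Suc by (intro card_SigmaI) auto
  also have "\<dots> = card (walks z l) * 3 ^ DIM('a)" by (simp add: card_nbhd)
  also have "\<dots> \<le> (3 ^ DIM('a)) ^ Suc l" using Suc by simp
  finally show ?case using finite_subset[OF sub finite_imageI[OF fin]] by simp
qed

text \<open>\<open>nbhd 1 x\<close> contains \<open>x\<close>, so a walk may pause. Hence all walks
  can be given one common length, and union bounds need only one family.\<close>

lemma walk_extend:
  assumes z: "z \<in> extensional Basis" and V: "V \<in> walks z l" and l: "l \<le> l'"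
  shows "\<exists>V'\<in>walks z l'. set V' = set V"
  using l
proof (induction l' rule: dec_induct)
  case base show ?case using V by blast
next
  case (step n)
  then obtain V' where V': "V' \<in> walks z n" "set V' = set V" by blast
  then have ne: "V' \<noteq> []" by (auto simp: walks_def)
  then have "last V' \<in> extensional Basis" using walks_extensional[OF z V'(1)] by simp
  then have "V' @ [last V'] \<in> walks z (Suc n)"
    using V' ne by (auto simp: walks_def successively_append_iff intro: nbhd_refl)
  moreover have "set (V' @ [last V']) = set V" using last_in_set[OF ne] by (simp add: insert_absorb V'(2))
  ultimately show ?case by blast
qed

text \<open>Inserting a detour of two steps adds one cell to the range of a walk.\<close>

lemma covering_walk:
  assumes fin: "finite A" and A: "linked z A" and m: "card A \<le> m"
  shows "\<exists>V\<in>walks z (2 * m). set V = A"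
proof -
  have ext: "A \<subseteq> extensional Basis" "z \<in> A" using A by (auto simp: linked_def)
  have "\<exists>V\<in>walks z (2 * j). set V \<subseteq> A \<and> card (set V) = Suc j" if "Suc j \<le> card A" for j
    using that
  proof (induction j)
    case 0
    have "[z] \<in> walks z 0" by (simp add: walks_def)
    then show ?case using ext by (intro bexI[of _ "[z]"]) auto
  next
    case (Suc j)
    then obtain V where V: "V \<in> walks z (2 * j)" "set V \<subseteq> A" "card (set V) = Suc j" by auto
    have "\<exists>a b. a \<in> A - set V \<and> b \<in> set V \<and> a \<in> nbhd 1 b"
    proof (rule ccontr)
      assume no: "\<not> ?thesis"
      have "w \<in> set V" if "(z, w) \<in> (step_in A)\<^sup>*" for w
        using that
      proof (induction rule: rtrancl_induct)
        case base show ?case using V(1) by (cases V) (auto simp: walks_def)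
      next
        case (step y w) then show ?case using no by (auto simp: step_in_def)
      qed
      then have "A \<subseteq> set V" using A by (auto simp: linked_def)
      then have "card A \<le> Suc j" using V card_mono[of "set V" A] by simp
      then show False using Suc.prems by simp
    qed
    then obtain a b where ab: "a \<in> A" "a \<notin> set V" "b \<in> set V" "a \<in> nbhd 1 b" by blast
    then obtain V1 V2 where V12: "V = V1 @ b # V2" by (meson split_list)
    have "b \<in> nbhd 1 a" using ab ext V nbhd_sym by blast
    then have "V1 @ b # a # b # V2 \<in> walks z (2 * Suc j)"
      using V(1) ab by (cases "V1 = []") (auto simp: walks_def V12 successively_append_iff successively_Cons hd_append)
    moreover have "set (V1 @ b # a # b # V2) = insert a (set V)" using V12 by auto
    ultimately show ?case using V ab
      by (intro bexI[of _ "V1 @ b # a # b # V2"]) (auto simp: card_insert_if)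
  qed
  moreover have "Suc (card A - 1) = card A" using fin ext(2) card_gt_0_iff[of A] by auto
  ultimately obtain V
    where V: "V \<in> walks z (2 * (card A - 1))" "set V \<subseteq> A" "card (set V) = card A"
    by (metis le_refl)
  then have "set V = A" using fin card_subset_eq by blast
  moreover have "2 * (card A - 1) \<le> 2 * m" using m by simp
  ultimately show ?thesis using walk_extend[OF _ V(1)] ext by blast
qed

lemma walk_displacement:
  assumes V: "V \<in> walks z l" and z: "z \<in> extensional Basis" and "i + j \<le> l"
  shows "V ! (i + j) \<in> nbhd (int j) (V ! i)"
  using assms(3)
proof (induction j)
  case 0
  have "V ! i \<in> set V" using V 0 by (auto simp: walks_def)
  then have "V ! i \<in> nbhd 0 (V ! i)" using walks_extensional[OF z V] by (intro nbhd_refl) auto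
  then show ?case by simp
next
  case (Suc j)
  have "V ! Suc (i + j) \<in> nbhd 1 (V ! (i + j))"
    using V Suc.prems by (auto simp: walks_def successively_conv_nth)
  then show ?case using nbhd_trans[OF Suc.IH] Suc.prems by (simp add: add.commute)
qed

text \<open>Sampling every \<open>4 ^ k\<close>-th vertex suffices: in between, each coordinate
  moves by at most \<open>4 ^ k\<close>, which is at most one coarse cell. This division of the
  length by \<open>4 ^ k\<close> is what makes the entropy at scale \<open>k\<close> small.\<close>

lemma walk_coarsen:
  assumes V: "V \<in> walks z l" and z: "z \<in> extensional Basis"
  shows "\<exists>V'\<in>walks (coarsen k z) (l div 4 ^ k). \<forall>w\<in>set V. \<exists>v\<in>set V'. coarsen k w \<in> nbhd 1 v"
proof
  let ?n = "l div 4 ^ k"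
  define V' where "V' = map (\<lambda>i. coarsen k (V ! (i * 4 ^ k))) [0..<Suc ?n]"
  have len: "length V' = Suc ?n" by (simp add: V'_def)
  have nth: "V' ! i = coarsen k (V ! (i * 4 ^ k))" if "i \<le> ?n" for i
    using that unfolding V'_def by (subst nth_map) (auto simp del: upt_Suc)
  have hd: "hd V' = coarsen k z"
    using V hd_conv_nth[of V'] hd_conv_nth[of V] nth[of 0] len by (fastforce simp: walks_def)
  have bd: "i * 4 ^ k \<le> l" if "i \<le> ?n" for i
    using that by (meson div_times_less_eq_dividend le_trans mult_le_mono1)
  have "V' ! Suc i \<in> nbhd 1 (V' ! i)" if "Suc i \<le> ?n" for i
  proof -
    have "V ! (i * 4 ^ k + 4 ^ k) \<in> nbhd (int (4 ^ k)) (V ! (i * 4 ^ k))"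
      using bd[OF that] by (intro walk_displacement[OF V z]) (simp add: add.commute)
    then show ?thesis using nth that coarsen_nbhd by (simp add: add.commute)
  qed
  then show "V' \<in> walks (coarsen k z) ?n"
    using len hd by (simp add: walks_def successively_conv_nth)
  show "\<forall>w\<in>set V. \<exists>v\<in>set V'. coarsen k w \<in> nbhd 1 v"
  proof
    fix w assume "w \<in> set V"
    then obtain t where "t < length V" "V ! t = w" by (auto simp: in_set_conv_nth)
    then have t: "t \<le> l" "w = V ! t" using V by (auto simp: walks_def)
    let ?i = "t div 4 ^ k"
    have i: "?i \<le> ?n" using t div_le_mono by blast
    have "t = ?i * 4 ^ k + t mod 4 ^ k" by (simp only: div_mult_mod_eq)
    then have "V ! t \<in> nbhd (int (t mod 4 ^ k)) (V ! (?i * 4 ^ k))"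
      using walk_displacement[OF V z] t(1) by metis
    moreover have "int (t mod 4 ^ k) \<le> 4 ^ k"
      by (metis less_imp_le mod_less_divisor of_nat_le_iff of_nat_numeral of_nat_power zero_less_numeral zero_less_power)
    ultimately have "w \<in> nbhd (4 ^ k) (V ! (?i * 4 ^ k))" using nbhd_mono t by blast
    then have "coarsen k w \<in> nbhd 1 (V' ! ?i)" using coarsen_nbhd nth[OF i] by metis
    moreover have "V' ! ?i \<in> set V'" using i len by simp
    ultimately show "\<exists>v\<in>set V'. coarsen k w \<in> nbhd 1 v" by blast
  qed
qed

section \<open>Empty balls and empty cubes\<close>

text \<open>The point \<open>x\<close> need neither be a nucleus nor lie on the sphere: the first
  hop starts at the origin, which is the centre of its own empty ball.\<close>

definition hole :: "'a::euclidean_space set \<Rightarrow> real \<Rightarrow> 'a \<Rightarrow> bool" where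
  "hole N R x \<longleftrightarrow> (\<exists>p. dist p x \<le> R \<and> ball p R \<inter> N = {})"

text \<open>A relaxation of Delaunay adjacency that keeps all the upper bound on the number of paths
  uses. The hole is attached to the starting point only, so the length of a hop can be read off near
  the cell it leaves.\<close>

definition hop :: "'a::euclidean_space set \<Rightarrow> 'a \<Rightarrow> 'a \<Rightarrow> bool" where
  "hop N x y \<longleftrightarrow> (\<exists>R\<ge>0. hole N R x \<and> dist x y \<le> 2 * R)"

text \<open>A point \<open>p\<close> of the common face is equidistant from \<open>u\<close> and
  \<open>v\<close>, and no nucleus is nearer, so the open ball about \<open>p\<close> through both
  is empty.\<close>

lemma delaunay_adj_imp_hop:
  fixes N :: "'a::euclidean_space set"
  assumes "DIM('a) \<ge> 2" "delaunay_adj N u v"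
  shows "hop N u v"
proof -
  obtain F where F: "F face_of voronoi_tile N u" "F face_of voronoi_tile N v"
    "aff_dim F = int (DIM('a)) - 1" using assms by (auto simp: delaunay_adj_def)
  then have "F \<noteq> {}" using assms(1) by auto
  then obtain p where p: "p \<in> voronoi_tile N u" "p \<in> voronoi_tile N v"
    using F face_of_imp_subset by blast
  have uv: "u \<in> N" "v \<in> N" using assms by (auto simp: delaunay_adj_def)
  then have "dist p v = dist p u" using p by (intro antisym) (auto simp: voronoi_tile_def)
  moreover have "ball p (dist p u) \<inter> N = {}" using p(1) by (auto simp: voronoi_tile_def not_less)
  ultimately have "hole N (dist p u) u" "dist u v \<le> 2 * dist p u"
    using dist_triangle[of u v p] by (auto simp: hole_def dist_commute)
  then show ?thesis unfolding hop_def by (intro exI[of _ "dist p u"]) simp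
qed

lemma floor_diff_le:
  fixes a b :: real
  assumes "\<bar>a - b\<bar> \<le> of_int t" shows "\<bar>\<lfloor>a\<rfloor> - \<lfloor>b\<rfloor>\<bar> \<le> t"
  using assms by linarith

lemma cell_dist:
  assumes "s > 0" "dist x y \<le> of_int t * s"
  shows "cell s y \<in> nbhd t (cell s x)"
proof (rule nbhdI)
  fix b :: 'a assume b: "b \<in> Basis"
  have "\<bar>(y - x) \<bullet> b\<bar> \<le> of_int t * s"
    using Basis_le_norm[OF b, of "y - x"] assms(2) by (simp add: dist_norm norm_minus_commute)
  then have "\<bar>(y \<bullet> b) / s - (x \<bullet> b) / s\<bar> \<le> of_int t"
    using assms(1) by (simp add: inner_diff_left flip: diff_divide_distrib) (simp add: field_simps)
  then show "\<bar>cell s y b - cell s x b\<bar> \<le> t" using b by (simp add: cell_def floor_diff_le)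
qed simp

lemma cube_diameter:
  fixes x y :: "'a::euclidean_space"
  assumes "s > 0" "cell s x = cell s y" shows "dist x y < real DIM('a) * s"
proof -
  have "\<bar>(x - y) \<bullet> b\<bar> < s" if b: "b \<in> Basis" for b
  proof -
    have "\<lfloor>(x \<bullet> b) / s\<rfloor> = \<lfloor>(y \<bullet> b) / s\<rfloor>" using fun_cong[OF assms(2), of b] b by (simp add: cell_def)
    then have "\<bar>(x \<bullet> b) / s - (y \<bullet> b) / s\<bar> < 1" by linarith
    then show ?thesis using assms(1)
      by (simp add: inner_diff_left field_simps flip: diff_divide_distrib)
  qed
  then have "(\<Sum>b\<in>Basis. \<bar>(x - y) \<bullet> b\<bar>) < (\<Sum>b\<in>(Basis::'a set). s)"
    by (intro sum_strict_mono) auto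
  then show ?thesis using norm_le_l1[of "x - y"] by (simp add: dist_norm)
qed

text \<open>The centre \<open>p\<close> is pulled towards \<open>x\<close> until its distance from
  \<open>x\<close> is at most \<open>d * s\<close>, where \<open>d\<close> is the dimension. The
  ball of radius \<open>d * s\<close> about the new centre stays inside the hole and contains the
  cube of side \<open>s\<close> around that centre. So a hole yields an empty cube near
  \<open>x\<close> at every scale that it accommodates.\<close>

lemma hole_empty_cube:
  fixes N :: "'a::euclidean_space set"
  assumes "hole N R x" "s > 0" "real DIM('a) * s \<le> R"
  shows "\<exists>q\<in>nbhd (int DIM('a)) (cell s x). cube s q \<inter> N = {}"
proof -
  obtain p where p: "dist p x \<le> R" "ball p R \<inter> N = {}" using assms(1) by (auto simp: hole_def)
  let ?t = "real DIM('a) * s"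
  have t: "?t > 0" using assms(2) by simp
  then have R: "R > 0" using assms(3) by linarith
  define p' where "p' = x + (?t / R) *\<^sub>R (p - x)"
  have "dist x p' = (?t / R) * dist p x" using t R by (simp add: p'_def dist_norm)
  also have "\<dots> \<le> (?t / R) * R" using p t R by (intro mult_left_mono) auto
  finally have xp: "dist x p' \<le> ?t" using R by simp
  have "p - p' = (1 - ?t / R) *\<^sub>R (p - x)" by (simp add: p'_def algebra_simps)
  then have "dist p p' = (1 - ?t / R) * dist p x" using t R assms(3) by (simp add: dist_norm)
  also have "\<dots> \<le> (1 - ?t / R) * R" using p R assms(3) by (intro mult_left_mono) auto
  finally have pp: "dist p p' \<le> R - ?t" using R by (simp add: algebra_simps)
  have "cube s (cell s p') \<subseteq> ball p R"
  proof
    fix y assume "y \<in> cube s (cell s p')"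
    then have "dist p' y < ?t" using cube_diameter[of s p' y] assms(2) by simp
    then show "y \<in> ball p R" using pp dist_triangle[of p y p'] by simp
  qed
  moreover have "cell s p' \<in> nbhd (int DIM('a)) (cell s x)" using xp assms(2) by (intro cell_dist) auto
  ultimately show ?thesis using p(2) by blast
qed

definition bad_near :: "'a::euclidean_space set \<Rightarrow> real \<Rightarrow> nat \<Rightarrow> ('a \<Rightarrow> int) \<Rightarrow> bool" where
  "bad_near N K k z \<longleftrightarrow> (\<exists>q\<in>nbhd (int DIM('a)) (coarsen k z). cube (K * 4 ^ k) q \<inter> N = {})"

text \<open>Counted in cells of side \<open>K\<close>. A hop handled at scale \<open>k\<close> has
  \<open>R < d * K * 4 ^ (k + 1)\<close>, hence length at most \<open>2 * R\<close>, which is below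
  \<open>8 * d * 4 ^ k\<close> sides.\<close>

definition rad :: "'a::euclidean_space itself \<Rightarrow> nat \<Rightarrow> int" where
  "rad _ k = 8 * int DIM('a) * 4 ^ k"

text \<open>Scale 0 is always present: a short hop, with \<open>R < d * K\<close>, need not produce
  any empty cube.\<close>

definition scales :: "'a::euclidean_space set \<Rightarrow> real \<Rightarrow> ('a \<Rightarrow> int) \<Rightarrow> nat set" where
  "scales N K z = insert 0 {k. bad_near N K k z}"

definition reach :: "'a::euclidean_space set \<Rightarrow> real \<Rightarrow> ('a \<Rightarrow> int) \<Rightarrow> ('a \<Rightarrow> int) set" where
  "reach N K z = (\<Union>k\<in>scales N K z. nbhd (rad TYPE('a) k) z)"

text \<open>Take the least \<open>j\<close> with \<open>R < d * K * 4 ^ j\<close>. If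
  \<open>j = Suc k\<close>, minimality gives room for an empty cube at scale \<open>k\<close>, and
  the choice of \<open>j\<close> bounds the hop by \<open>rad\<close> at the same scale.\<close>

lemma hop_reach:
  fixes N :: "'a::euclidean_space set"
  assumes K: "K > 0" and "hop N x y"
  shows "cell K y \<in> reach N K (cell K x)"
proof -
  let ?d = "real DIM('a)"
  obtain R where R: "R \<ge> 0" "hole N R x" "dist x y \<le> 2 * R" using assms by (auto simp: hop_def)
  have dK: "?d * K > 0" using K by simp
  have "\<exists>j. R < ?d * K * 4 ^ j"
    using real_arch_pow[of 4 "R / (?d * K)"] dK by (auto simp: field_simps)
  then obtain j where j: "R < ?d * K * 4 ^ j" "\<And>i. i < j \<Longrightarrow> R \<ge> ?d * K * 4 ^ i"
    using exists_least_iff[of "\<lambda>j. R < ?d * K * 4 ^ j"] by (auto simp: not_less)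
  show ?thesis
  proof (cases j)
    case 0
    then have "dist x y \<le> of_int (rad TYPE('a) 0) * K" using R j dK by (simp add: rad_def)
    then show ?thesis using cell_dist[OF K] by (auto simp: reach_def scales_def)
  next
    case (Suc k)
    then have "?d * (K * 4 ^ k) \<le> R" using j(2)[of k] by (simp add: mult.assoc)
    from hole_empty_cube[OF R(2) _ this] K have "bad_near N K k (cell K x)"
      by (simp add: bad_near_def coarsen_cell)
    moreover have "dist x y \<le> of_int (rad TYPE('a) k) * K"
      using R(3) j(1) Suc by (simp add: rad_def algebra_simps)
    then have "cell K y \<in> nbhd (rad TYPE('a) k) (cell K x)" by (rule cell_dist[OF K])
    ultimately show ?thesis by (auto simp: reach_def scales_def)
  qed
qed

section \<open>The cells visited by a path\<close>

definition origin_cell :: "'a::euclidean_space \<Rightarrow> int" where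
  "origin_cell = (\<lambda>b\<in>Basis. 0)"

lemma cell_zero: "cell s 0 = origin_cell"
  by (simp add: cell_def origin_cell_def)

lemma coarsen_origin_cell: "coarsen k origin_cell = origin_cell"
  by (auto simp: coarsen_def origin_cell_def)

lemma origin_cell_extensional [simp]: "origin_cell \<in> extensional Basis"
  by (simp add: origin_cell_def)

text \<open>A box of radius \<open>(9 * d + 1) * 4 ^ k\<close> has at most
  \<open>(18 * d + 3) * 4 ^ k\<close> cells along each axis; this is the resulting volume factor in
  front of \<open>4 ^ (k * d)\<close>.\<close>

definition fill_const :: "'a::euclidean_space itself \<Rightarrow> nat" where
  "fill_const _ = (18 * DIM('a) + 3) ^ DIM('a)"

text \<open>The threshold decays like \<open>m / 2 ^ k\<close> in volume, slower than the number of steps of the walk, so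
  that the cost of exceeding it beats the entropy of the walk.\<close>

definition sparse_holes :: "'a::euclidean_space set \<Rightarrow> real \<Rightarrow> nat \<Rightarrow> bool" where
  "sparse_holes N K m \<longleftrightarrow> (\<forall>k. \<forall>V\<in>walks origin_cell (2 * m div 4 ^ k). \<forall>T.
     T \<subseteq> (\<Union>v\<in>set V. nbhd (int DIM('a) + 1) v) \<and> (\<forall>q\<in>T. cube (K * 4 ^ k) q \<inter> N = {}) \<longrightarrow>
     4 * fill_const TYPE('a) * 2 ^ k * 4 ^ (k * DIM('a)) * card T \<le> m)"

lemma half_geometric_sum_le: "(\<Sum>k<n. (1 / 2) ^ k) \<le> (2::real)"
proof -
  have "(\<Sum>k<n. (1 / 2::real) ^ k) = ((1 / 2) ^ n - 1) / (1 / 2 - 1)" by (rule geometric_sum) simp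
  then show ?thesis by simp
qed

definition blob :: "'a::euclidean_space set \<Rightarrow> real \<Rightarrow> ('a \<Rightarrow> int) set \<Rightarrow> nat \<Rightarrow> ('a \<Rightarrow> int) set" where
  "blob N K A k = (\<Union>z\<in>{z\<in>A. bad_near N K k z}. nbhd (rad TYPE('a) k) z)"

text \<open>A walk of \<open>2 * m\<close> steps covers \<open>A\<close>; coarsened, it becomes one
  of the walks in \<open>sparse_holes\<close>. The empty cubes responsible for the blob lie within
  distance \<open>d + 1\<close> of that walk, so their number is bounded, and each of them accounts
  for only one box of cells.\<close>

lemma card_blob:
  fixes N :: "'a::euclidean_space set"
  assumes sp: "sparse_holes N K m" and A: "finite A" "linked origin_cell A" "card A \<le> m"
  shows "finite (blob N K A k) \<and> 4 * 2 ^ k * card (blob N K A k) \<le> m"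
proof -
  let ?d = "int DIM('a)"
  obtain V where V: "V \<in> walks origin_cell (2 * m)" "set V = A" using covering_walk[OF A] by blast
  obtain V' where V': "V' \<in> walks origin_cell (2 * m div 4 ^ k)"
    "\<forall>w\<in>A. \<exists>v\<in>set V'. coarsen k w \<in> nbhd 1 v"
    using walk_coarsen[OF V(1), of k] V(2) by (auto simp: coarsen_origin_cell)
  define T where "T = {q. cube (K * 4 ^ k) q \<inter> N = {} \<and> (\<exists>z\<in>A. q \<in> nbhd ?d (coarsen k z))}"
  have T: "T \<subseteq> (\<Union>v\<in>set V'. nbhd (?d + 1) v)"
  proof
    fix q assume "q \<in> T"
    then obtain z where "z \<in> A" "q \<in> nbhd ?d (coarsen k z)" by (auto simp: T_def)
    moreover from V' this obtain v where "v \<in> set V'" "coarsen k z \<in> nbhd 1 v" by blast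
    ultimately show "q \<in> (\<Union>v\<in>set V'. nbhd (?d + 1) v)"
      using nbhd_trans[of "coarsen k z" 1 v q ?d] by (auto simp: add.commute)
  qed
  have finT: "finite T" by (rule finite_subset[OF T]) simp
  have cT: "4 * fill_const TYPE('a) * 2 ^ k * 4 ^ (k * DIM('a)) * card T \<le> m"
    using sp V'(1) T unfolding sparse_holes_def by (auto simp: T_def)
  \<comment> \<open>The radius adds \<open>8 * d\<close> from \<open>rad\<close>, \<open>d\<close>
    for the distance between the coarse cell of \<open>z\<close> and the empty cube
    \<open>q\<close>, and 1 for the remainder of \<open>z\<close> modulo
    \<open>4 ^ k\<close>.\<close>
  define box where "box q = nbhd ((9 * ?d + 1) * 4 ^ k) (\<lambda>b. 4 ^ k * q b)" for q :: "'a \<Rightarrow> int"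
  have sub: "blob N K A k \<subseteq> (\<Union>q\<in>T. box q)"
  proof
    fix w assume "w \<in> blob N K A k"
    then obtain z q where z: "z \<in> A" "w \<in> nbhd (rad TYPE('a) k) z" "q \<in> nbhd ?d (coarsen k z)"
        "cube (K * 4 ^ k) q \<inter> N = {}" by (auto simp: blob_def bad_near_def)
    have "w \<in> box q" unfolding box_def
    proof (rule nbhdI)
      show "w \<in> extensional Basis" using z nbhd_extensional by blast
      fix b :: 'a assume b: "b \<in> Basis"
      have 1: "\<bar>w b - z b\<bar> \<le> 8 * ?d * 4 ^ k" using nbhdD[OF z(2) b] by (simp add: rad_def)
      have 2: "\<bar>q b - z b div 4 ^ k\<bar> \<le> ?d" using nbhdD[OF z(3) b] b by (simp add: coarsen_def)
      have "\<bar>4 ^ k * (q b - z b div 4 ^ k)\<bar> \<le> 4 ^ k * ?d"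
        unfolding abs_mult using 2 by (intro mult_mono) auto
      moreover have "4 ^ k * (z b div 4 ^ k) + z b mod 4 ^ k = z b" by simp
      moreover have "0 \<le> z b mod 4 ^ k" "z b mod 4 ^ k < 4 ^ k" by simp_all
      ultimately have "\<bar>z b - 4 ^ k * q b\<bar> \<le> 4 ^ k * ?d + 4 ^ k"
        unfolding right_diff_distrib by linarith
      then have "\<bar>w b - 4 ^ k * q b\<bar> \<le> 8 * ?d * 4 ^ k + (4 ^ k * ?d + 4 ^ k)" using 1 by linarith
      then show "\<bar>w b - 4 ^ k * q b\<bar> \<le> (9 * ?d + 1) * 4 ^ k" by (simp add: algebra_simps)
    qed
    moreover have "q \<in> T" using z by (auto simp: T_def)
    ultimately show "w \<in> (\<Union>q\<in>T. box q)" by blast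
  qed
  have fin: "finite (\<Union>q\<in>T. box q)" using finT by (auto simp: box_def)
  have cbox: "card (box q) \<le> fill_const TYPE('a) * 4 ^ (k * DIM('a))" for q
  proof -
    have "(2 * (9 * ?d + 1) * 4 ^ k + 1) \<le> (18 * ?d + 3) * (4::int) ^ k"
      by (simp add: algebra_simps)
    then have "nat (2 * ((9 * ?d + 1) * 4 ^ k) + 1) \<le> (18 * DIM('a) + 3) * 4 ^ k"
      by (simp add: nat_le_iff algebra_simps)
    from power_mono[OF this, of "DIM('a)"] show ?thesis
      by (simp add: box_def card_nbhd fill_const_def power_mult_distrib power_mult)
  qed
  have "card (blob N K A k) \<le> card (\<Union>q\<in>T. box q)" by (rule card_mono[OF fin sub])
  also have "\<dots> \<le> (\<Sum>q\<in>T. card (box q))" by (rule card_UN_le[OF finT])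
  also have "\<dots> \<le> card T * (fill_const TYPE('a) * 4 ^ (k * DIM('a)))"
    using sum_bounded_above[of T "\<lambda>q. card (box q)"] cbox by simp
  finally have "4 * 2 ^ k * card (blob N K A k) \<le> 4 * 2 ^ k * (card T * (fill_const TYPE('a) * 4 ^ (k * DIM('a))))"
    by (intro mult_left_mono) auto
  also have "\<dots> \<le> m" using cT by (simp add: ac_simps)
  finally show ?thesis using finite_subset[OF sub fin] by simp
qed

text \<open>A nonempty blob would force \<open>2 ^ k \<le> m\<close>, impossible for
  \<open>k \<ge> m\<close>. Thus only scales below \<open>m\<close> occur, which justifies
  truncating later sums over scales at \<open>m\<close>.\<close>

lemma blob_empty:
  assumes sp: "sparse_holes N K m" and A: "finite A" "linked origin_cell A" "card A \<le> m"
    and "k \<ge> m" shows "blob N K A k = {}"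
proof (rule ccontr)
  assume "blob N K A k \<noteq> {}"
  then have "1 \<le> card (blob N K A k)" using card_blob[OF sp A] by (simp add: Suc_le_eq card_gt_0_iff)
  then have "(2::nat) ^ k * 1 \<le> 2 ^ k * (4 * card (blob N K A k))" by (intro mult_left_mono) auto
  then have "2 ^ k \<le> m" using card_blob[OF sp A, of k] by linarith
  moreover have "k < 2 ^ k" by (rule less_exp)
  ultimately show False using \<open>k \<ge> m\<close> by simp
qed

text \<open>Scale 0 costs one box of side \<open>16 * d + 1\<close> per visited cell. All other
  scales together cost at most \<open>m / 4\<close> times a geometric series, a bound taken over the
  whole of \<open>A\<close> and therefore independent of \<open>Z\<close>. This independence is what
  lets the induction along the path close.\<close>

lemma card_reach:
  fixes N :: "'a::euclidean_space set"
  assumes sp: "sparse_holes N K m" and A: "finite A" "linked origin_cell A" "card A \<le> m"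
    and Z: "Z \<subseteq> A"
  shows "finite (\<Union>z\<in>Z. reach N K z)"
    and "card (\<Union>z\<in>Z. reach N K z) \<le> card Z * (16 * DIM('a) + 1) ^ DIM('a) + m / 2"
proof -
  let ?n = "\<lambda>z. nbhd (rad TYPE('a) 0) z"
  have sub: "(\<Union>z\<in>Z. reach N K z) \<subseteq> (\<Union>z\<in>Z. ?n z) \<union> (\<Union>k<m. blob N K A k)"
  proof
    fix w assume "w \<in> (\<Union>z\<in>Z. reach N K z)"
    then obtain z k where z: "z \<in> Z" "k \<in> scales N K z" "w \<in> nbhd (rad TYPE('a) k) z"
      by (auto simp: reach_def)
    show "w \<in> (\<Union>z\<in>Z. ?n z) \<union> (\<Union>k<m. blob N K A k)"
    proof (cases "k = 0")
      case False
      then have "w \<in> blob N K A k" using z Z by (auto simp: blob_def scales_def)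
      moreover from this have "k < m" using blob_empty[OF sp A, of k] by (cases "k < m") auto
      ultimately show ?thesis by blast
    qed (use z in auto)
  qed
  have finZ: "finite Z" using Z A finite_subset by blast
  have fin1: "finite (\<Union>z\<in>Z. ?n z)" using finZ by simp
  have fin2: "finite (\<Union>k<m. blob N K A k)" using card_blob[OF sp A] by simp
  show "finite (\<Union>z\<in>Z. reach N K z)" using finite_subset[OF sub] fin1 fin2 by simp
  have "card (\<Union>z\<in>Z. ?n z) \<le> (\<Sum>z\<in>Z. card (?n z))" by (rule card_UN_le[OF finZ])
  also have "\<dots> = card Z * (16 * DIM('a) + 1) ^ DIM('a)"
    by (simp add: card_nbhd rad_def nat_add_distrib nat_mult_distrib)
  finally have c1: "card (\<Union>z\<in>Z. ?n z) \<le> card Z * (16 * DIM('a) + 1) ^ DIM('a)" .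
  have "real (card (\<Union>k<m. blob N K A k)) \<le> (\<Sum>k<m. real (card (blob N K A k)))"
    using card_UN_le[of "{..<m}" "blob N K A"] by (simp flip: of_nat_sum)
  also have "\<dots> \<le> (\<Sum>k<m. (m / 4) * (1 / 2) ^ k)"
  proof (rule sum_mono)
    fix k
    have "real (4 * 2 ^ k * card (blob N K A k)) \<le> m" using card_blob[OF sp A, of k] by linarith
    then show "real (card (blob N K A k)) \<le> (m / 4) * (1 / 2) ^ k"
      by (simp add: field_simps power_divide)
  qed
  also have "\<dots> = (m / 4) * (\<Sum>k<m. (1 / 2) ^ k)" by (simp add: sum_distrib_left)
  also have "\<dots> \<le> (m / 4) * 2"
    by (intro mult_left_mono half_geometric_sum_le) auto
  finally have c2: "real (card (\<Union>k<m. blob N K A k)) \<le> m / 2" by simp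
  have "card (\<Union>z\<in>Z. reach N K z) \<le> card (\<Union>z\<in>Z. ?n z) + card (\<Union>k<m. blob N K A k)"
    using card_mono[OF _ sub] card_Un_le fin1 fin2 by (meson finite_UnI le_trans)
  then show "card (\<Union>z\<in>Z. reach N K z) \<le> card Z * (16 * DIM('a) + 1) ^ DIM('a) + m / 2"
    using c1 c2 by linarith
qed

lemma linked_reach:
  fixes w :: "'a::euclidean_space \<Rightarrow> int"
  assumes "linked z A" "w \<in> A" shows "linked z (A \<union> reach N K w)"
proof -
  have "reach N K w = (\<Union>r\<in>rad TYPE('a) ` scales N K w. nbhd r w)" by (simp add: reach_def)
  moreover have "linked z (A \<union> (\<Union>r\<in>rad TYPE('a) ` scales N K w. nbhd r w))"
    by (rule linked_Un_nbhds[OF assms]) (auto simp: rad_def)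
  ultimately show ?thesis by simp
qed

lemma reach_refl: "z \<in> extensional Basis \<Longrightarrow> z \<in> reach N K z"
  by (auto simp: reach_def scales_def rad_def intro: nbhd_refl)

text \<open>The empty cubes responsible for the next hop lie near a cell that is already in the animal, so
  the bound on the animal can be propagated one step at a time.\<close>

lemma path_animal:
  fixes N :: "'a::euclidean_space set"
  assumes sp: "sparse_holes N K m"
  shows "zs \<noteq> [] \<Longrightarrow> hd zs = origin_cell \<Longrightarrow> successively (\<lambda>z w. w \<in> reach N K z) zs \<Longrightarrow>
    2 * (16 * DIM('a) + 1) ^ DIM('a) * length zs \<le> m \<Longrightarrow>
    linked origin_cell (\<Union>z\<in>set zs. reach N K z) \<and> finite (\<Union>z\<in>set zs. reach N K z) \<and>
    card (\<Union>z\<in>set zs. reach N K z) \<le> m \<and> set zs \<subseteq> (\<Union>z\<in>set zs. reach N K z)"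
proof (induction zs rule: rev_nonempty_induct)
  case (single z)
  have z: "z = origin_cell" using single by simp
  \<comment> \<open>\<open>card_reach\<close> presupposes a connected set that is already small; the
    singleton of the origin cell provides the first one.\<close>
  have A: "linked origin_cell {origin_cell}" by (intro linked_singleton) simp
  have z': "origin_cell \<in> reach N K origin_cell" by (intro reach_refl) simp
  have m1: "card {origin_cell :: 'a \<Rightarrow> int} \<le> m"
  proof -
    have "1 \<le> (16 * DIM('a) + 1) ^ DIM('a)" by (rule one_le_power) simp
    moreover have "2 * (16 * DIM('a) + 1) ^ DIM('a) \<le> m" using single.prems(3) by simp
    ultimately have "1 \<le> m" by linarith
    then show ?thesis by simp
  qed
  have "linked origin_cell (\<Union>z\<in>set [z]. reach N K z)"
    using linked_reach[OF A, of origin_cell N K] z z' by (simp add: insert_absorb)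
  moreover have "real (card (\<Union>z\<in>set [z]. reach N K z)) \<le> (16 * DIM('a) + 1) ^ DIM('a) + m / 2"
    using card_reach(2)[OF sp _ A m1, of "{origin_cell}"] z by simp
  moreover have "real (2 * (16 * DIM('a) + 1) ^ DIM('a)) \<le> m" using single.prems by (simp only: of_nat_le_iff) simp
  ultimately show ?case using card_reach(1)[OF sp _ A m1, of "{origin_cell}"] z z' by simp
next
  case (snoc w zs)
  let ?A = "\<Union>z\<in>set zs. reach N K z" and ?c = "(16 * DIM('a) + 1) ^ DIM('a)"
  have suc: "successively (\<lambda>z w. w \<in> reach N K z) zs" "w \<in> reach N K (last zs)"
    using snoc by (auto simp: successively_append_iff)
  have "hd zs = origin_cell" "2 * ?c * length zs \<le> m" using snoc by (auto simp: algebra_simps)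
  then have IH: "linked origin_cell ?A" "finite ?A" "card ?A \<le> m" "set zs \<subseteq> ?A"
    using snoc.IH suc by auto
  have w: "w \<in> ?A" using suc snoc by (auto intro: last_in_set)
  then have Z: "set (zs @ [w]) \<subseteq> ?A" using IH by simp
  have eq: "(\<Union>z\<in>set (zs @ [w]). reach N K z) = ?A \<union> reach N K w" by auto
  have "real (card (set (zs @ [w]))) \<le> real (length (zs @ [w]))" by (metis card_length of_nat_le_iff)
  then have "real (card (set (zs @ [w]))) * ?c \<le> real (length (zs @ [w])) * ?c"
    by (intro mult_right_mono) auto
  moreover have "real (2 * ?c * length (zs @ [w])) \<le> m" using snoc.prems by (simp only: of_nat_le_iff)
  ultimately have "real (card (\<Union>z\<in>set (zs @ [w]). reach N K z)) \<le> m"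
    using card_reach(2)[OF sp IH(2,1,3) Z] by (simp add: algebra_simps)
  then have "card (\<Union>z\<in>set (zs @ [w]). reach N K z) \<le> m" by simp
  moreover have "linked origin_cell (\<Union>z\<in>set (zs @ [w]). reach N K z)"
    unfolding eq by (rule linked_reach[OF IH(1) w])
  moreover have "finite (\<Union>z\<in>set (zs @ [w]). reach N K z)" by (rule card_reach(1)[OF sp IH(2,1,3) Z])
  moreover have "set (zs @ [w]) \<subseteq> (\<Union>z\<in>set (zs @ [w]). reach N K z)" using Z unfolding eq by blast
  ultimately show ?case by blast
qed

section \<open>Counting the paths\<close>

text \<open>\<open>w\<close> is a substochastic kernel on \<open>P\<close>, and the sum is the total
  mass of its trajectories with \<open>n\<close> steps from \<open>v\<close>.\<close>

lemma kraft_sum: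
  fixes w :: "'b \<Rightarrow> 'b \<Rightarrow> real" and v :: 'b
  assumes fin: "finite P" and nonneg: "\<And>x y. w x y \<ge> 0"
    and sum: "\<And>x. x \<in> P \<Longrightarrow> (\<Sum>y\<in>P. w x y) \<le> 1"
  defines "L \<equiv> \<lambda>n. {xs. length xs = Suc n \<and> hd xs = v \<and> set xs \<subseteq> P}"
  shows "finite (L n) \<and> (\<Sum>xs\<in>L n. \<Prod>i<n. w (xs ! i) (xs ! Suc i)) \<le> 1"
proof (induction n)
  case 0
  have "L 0 \<subseteq> {[v]}" by (auto simp: L_def length_Suc_conv)
  then consider "L 0 = {}" | "L 0 = {[v]}" by blast
  then show ?case by cases auto
next
  case (Suc n)
  have eq: "L (Suc n) = (\<lambda>(xs, y). xs @ [y]) ` (L n \<times> P)"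
  proof (intro equalityI subsetI)
    fix zs assume zs: "zs \<in> L (Suc n)"
    then obtain xs y where xs: "zs = xs @ [y]" by (cases zs rule: rev_cases) (auto simp: L_def)
    with zs have "xs \<noteq> []" by (auto simp: L_def)
    with zs xs have "(xs, y) \<in> L n \<times> P" by (auto simp: L_def)
    then show "zs \<in> (\<lambda>(xs, y). xs @ [y]) ` (L n \<times> P)" using xs by force
  qed (auto simp: L_def hd_append)
  have inj: "inj_on (\<lambda>(xs, y). xs @ [y]) (L n \<times> P)" by (auto simp: inj_on_def)
  have "(\<Sum>xs\<in>L (Suc n). \<Prod>i<Suc n. w (xs ! i) (xs ! Suc i)) =
      (\<Sum>(xs, y)\<in>L n \<times> P. \<Prod>i<Suc n. w ((xs @ [y]) ! i) ((xs @ [y]) ! Suc i))"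
    unfolding eq by (subst sum.reindex[OF inj]) (simp add: case_prod_beta)
  also have "\<dots> = (\<Sum>(xs, y)\<in>L n \<times> P. (\<Prod>i<n. w (xs ! i) (xs ! Suc i)) * w (xs ! n) y)"
  proof (rule sum.cong[OF refl], safe)
    fix xs y assume xs: "xs \<in> L n"
    then have len: "length xs = Suc n" by (simp add: L_def)
    have "(\<Prod>i<n. w ((xs @ [y]) ! i) ((xs @ [y]) ! Suc i)) = (\<Prod>i<n. w (xs ! i) (xs ! Suc i))"
      by (rule prod.cong) (auto simp: nth_append len)
    then show "(\<Prod>i<Suc n. w ((xs @ [y]) ! i) ((xs @ [y]) ! Suc i)) =
        (\<Prod>i<n. w (xs ! i) (xs ! Suc i)) * w (xs ! n) y"
      by (simp add: nth_append len)
  qed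
  also have "\<dots> = (\<Sum>xs\<in>L n. (\<Prod>i<n. w (xs ! i) (xs ! Suc i)) * (\<Sum>y\<in>P. w (xs ! n) y))"
    by (simp add: sum.cartesian_product[symmetric] sum_distrib_left)
  also have "\<dots> \<le> (\<Sum>xs\<in>L n. (\<Prod>i<n. w (xs ! i) (xs ! Suc i)) * 1)"
  proof (intro sum_mono mult_left_mono sum prod_nonneg)
    fix xs assume "xs \<in> L n"
    then have "n < length xs" "set xs \<subseteq> P" by (simp_all add: L_def)
    then show "xs ! n \<in> P" using nth_mem by blast
  qed (auto simp: nonneg)
  also have "\<dots> \<le> 1" using Suc by simp
  finally show ?case using Suc fin eq by simp
qed

text \<open>Every element of \<open>S\<close> carries mass at least \<open>exp (- l)\<close> out of
  a total of at most 1.\<close>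

lemma kraft_card:
  fixes w :: "'b \<Rightarrow> 'b \<Rightarrow> real"
  assumes "finite P" and nonneg: "\<And>x y. w x y \<ge> 0"
    and "\<And>x. x \<in> P \<Longrightarrow> (\<Sum>y\<in>P. w x y) \<le> 1"
    and S: "\<And>xs. xs \<in> S \<Longrightarrow> length xs = Suc n \<and> hd xs = x0 \<and> set xs \<subseteq> P"
    and l: "\<And>xs. xs \<in> S \<Longrightarrow> exp (- l) \<le> (\<Prod>i<n. w (xs ! i) (xs ! Suc i))"
  shows "finite S" "real (card S) \<le> exp l"
proof -
  let ?L = "{xs. length xs = Suc n \<and> hd xs = x0 \<and> set xs \<subseteq> P}"
  have L: "finite ?L" "(\<Sum>xs\<in>?L. \<Prod>i<n. w (xs ! i) (xs ! Suc i)) \<le> 1"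
    using kraft_sum[where P = P and w = w and n = n and v = x0] assms(1-3) by auto
  have sub: "S \<subseteq> ?L" using S by blast
  show "finite S" using finite_subset[OF sub L(1)] .
  have "real (card S) * exp (- l) \<le> (\<Sum>xs\<in>S. \<Prod>i<n. w (xs ! i) (xs ! Suc i))"
    using sum_mono[of S "\<lambda>_. exp (- l)"] l by simp
  also have "\<dots> \<le> (\<Sum>xs\<in>?L. \<Prod>i<n. w (xs ! i) (xs ! Suc i))"
    by (rule sum_mono2[OF L(1) sub]) (auto intro: prod_nonneg nonneg)
  also note L(2)
  finally show "real (card S) \<le> exp l" by (simp add: exp_minus field_simps)
qed

text \<open>The series of \<open>exp (exp t)\<close> contains the term \<open>exp (k * t) / fact k\<close>.\<close>

lemma mult_le_ln_fact_add_exp: "real k * t \<le> ln (fact k) + exp t"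
proof -
  have "(exp t) ^ k / fact k \<le> exp (exp t)"
  proof -
    have "(\<Sum>i\<in>{k}. (exp t) ^ i / fact i) \<le> (\<Sum>i. (exp t) ^ i / fact i)"
      using summable_exp_generic[of "exp t"]
      by (intro sum_le_suminf) (auto simp: divide_inverse mult.commute)
    then show ?thesis by (simp add: exp_def divide_inverse mult.commute)
  qed
  then have "exp (real k * t) \<le> exp (ln (fact k) + exp t)"
    by (simp add: exp_add exp_of_nat_mult[symmetric] field_simps)
  then show ?thesis by simp
qed

text \<open>A mixture: scale \<open>k\<close> with probability \<open>(1 / 2) ^ Suc k\<close>, then
  a uniform cell of the box of that scale around \<open>z\<close>.\<close>

definition step_weight :: "nat \<Rightarrow> ('a::euclidean_space \<Rightarrow> int) \<Rightarrow> ('a \<Rightarrow> int) \<Rightarrow> real" where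
  "step_weight m z w = (\<Sum>k\<le>m. (1 / 2) ^ Suc k *
     (if w \<in> nbhd (rad TYPE('a) k) z then 1 / card (nbhd (rad TYPE('a) k) z) else 0))"

lemma step_weight_nonneg: "step_weight m z w \<ge> 0"
  unfolding step_weight_def by (intro sum_nonneg) auto

lemma sum_step_weight_le:
  fixes z :: "'a::euclidean_space \<Rightarrow> int"
  assumes "finite A" shows "(\<Sum>w\<in>A. step_weight m z w) \<le> 1"
proof -
  let ?n = "\<lambda>k. nbhd (rad TYPE('a) k) z"
  have "(\<Sum>w\<in>A. step_weight m z w) =
      (\<Sum>k\<le>m. (1 / 2) ^ Suc k * (\<Sum>w\<in>A. if w \<in> ?n k then 1 / card (?n k) else 0))"
    unfolding step_weight_def by (subst sum.swap) (simp add: sum_distrib_left)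
  also have "\<dots> \<le> (\<Sum>k\<le>m. (1 / 2) ^ Suc k * 1)"
  proof (intro sum_mono mult_left_mono)
    fix k
    have "(\<Sum>w\<in>A. if w \<in> ?n k then 1 / real (card (?n k)) else 0) = card (A \<inter> ?n k) / card (?n k)"
      using assms by (simp add: sum.If_cases)
    also have "card (A \<inter> ?n k) \<le> card (?n k)" by (intro card_mono) auto
    then have "card (A \<inter> ?n k) / card (?n k) \<le> 1"
      by (cases "card (?n k) = 0") (auto simp: divide_le_eq_1)
    finally show "(\<Sum>w\<in>A. if w \<in> ?n k then 1 / real (card (?n k)) else 0) \<le> 1" .
  qed auto
  also have "\<dots> = (1 / 2) * (\<Sum>k<Suc m. (1 / 2) ^ k)"
    by (simp add: sum_distrib_left lessThan_Suc_atMost)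
  also have "\<dots> \<le> 1" using half_geometric_sum_le[of "Suc m"] by simp
  finally show ?thesis .
qed

text \<open>The box at scale \<open>k\<close> has at most \<open>(17 * d * 4 ^ k) ^ d\<close> cells
  and the scale itself costs \<open>(1 / 2) ^ Suc k\<close>, so the negative logarithm of the weight
  grows only linearly in \<open>k\<close>.\<close>

lemma step_weight_ge:
  fixes z :: "'a::euclidean_space \<Rightarrow> int"
  assumes "k \<le> m" "w \<in> nbhd (rad TYPE('a) k) z"
  shows "exp (- (DIM('a) * ln (17 * DIM('a)) + ln 2 + k * (DIM('a) * ln 4 + ln 2))) \<le> step_weight m z w"
proof -
  let ?d = "DIM('a)"
  have c: "card (nbhd (rad TYPE('a) k) z) = (16 * ?d * 4 ^ k + 1) ^ ?d"
    by (simp add: card_nbhd rad_def nat_add_distrib nat_mult_distrib nat_power_eq mult.assoc)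
  have "16 * ?d * 4 ^ k + 1 \<le> 17 * ?d * 4 ^ k" by (simp add: Suc_le_eq)
  then have "real (16 * ?d * 4 ^ k + 1) ^ ?d \<le> real (17 * ?d * 4 ^ k) ^ ?d"
    by (intro power_mono) (simp_all only: of_nat_le_iff of_nat_0_le_iff)
  then have c': "real (card (nbhd (rad TYPE('a) k) z)) \<le> (17 * real ?d * 4 ^ k) ^ ?d"
    unfolding c by simp
  have "exp (?d * ln (17 * ?d) + ln 2 + k * (?d * ln 4 + ln 2)) = (17 * ?d) ^ ?d * 2 * (4 ^ ?d * 2) ^ k"
    by (simp add: exp_add exp_of_nat_mult)
  also have "\<dots> = 2 ^ Suc k * (17 * real ?d * 4 ^ k) ^ ?d"
    by (simp add: power_mult_distrib power_mult[symmetric] mult.commute)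
  finally have e: "exp (- (?d * ln (17 * ?d) + ln 2 + k * (?d * ln 4 + ln 2))) =
      (1 / 2) ^ Suc k * (1 / (17 * real ?d * 4 ^ k) ^ ?d)"
    by (simp only: exp_minus) (simp add: field_simps)
  have "card (nbhd (rad TYPE('a) k) z) > 0" unfolding c by simp
  then have "(1 / 2) ^ Suc k * (1 / (17 * real ?d * 4 ^ k) ^ ?d) \<le>
      (1 / 2) ^ Suc k * (1 / real (card (nbhd (rad TYPE('a) k) z)))"
    using c' by (intro mult_left_mono divide_left_mono) auto
  also have "\<dots> = (\<Sum>j\<in>{k}. (1 / 2) ^ Suc j *
      (if w \<in> nbhd (rad TYPE('a) j) z then 1 / card (nbhd (rad TYPE('a) j) z) else 0))"
    using assms(2) by simp
  also have "\<dots> \<le> step_weight m z w"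
    unfolding step_weight_def by (rule sum_mono2) (use assms(1) in auto)
  finally show ?thesis using e by simp
qed

text \<open>Walks of \<open>2 * m\<close> steps are used because every connected set of at most
  \<open>m\<close> cells containing the origin cell is the range of one of them. The logarithm of
  the factorial is the quantity produced by \<open>mult_le_ln_fact_add_exp\<close>.\<close>

definition few_points :: "'a::euclidean_space set \<Rightarrow> real \<Rightarrow> real \<Rightarrow> nat \<Rightarrow> bool" where
  "few_points N K H m \<longleftrightarrow> (\<forall>z. finite (N \<inter> cube K z)) \<and>
     (\<forall>V\<in>walks origin_cell (2 * m). (\<Sum>z\<in>set V. ln (fact (card (N \<inter> cube K z)))) \<le> H * m)"

text \<open>The three summands are, per unit of \<open>m\<close>, the fixed cost of a hop, the cost
  of its scale, and the cost of selecting the nucleus within its cell.\<close>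

definition count_const :: "'a::euclidean_space itself \<Rightarrow> real \<Rightarrow> real" where
  "count_const _ H = (DIM('a) * ln (17 * DIM('a)) + ln 2) +
     (DIM('a) * ln 4 + ln 2) / ln (3 / 2) * (H + 2) + (2 * H + 3)"

text \<open>The kernel chooses the next cell by \<open>step_weight\<close> and then a nucleus of
  that cell uniformly. The negative logarithm of the weight of a path is a sum over its hops; since
  the vertices are distinct, it becomes a sum over cells with multiplicity at most the number of
  nuclei in the cell, and the convexity inequality separates these numbers from the holes.\<close>

lemma card_hop_paths:
  fixes N :: "'a::euclidean_space set"
  assumes K: "K > 0" and H: "H \<ge> 0"
    and sp: "sparse_holes N K m" and few: "few_points N K H m"
    and m: "2 * (16 * DIM('a) + 1) ^ DIM('a) * (n + 2) \<le> m"
    and x0: "hop N 0 x0"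
    and S: "\<And>xs. xs \<in> S \<Longrightarrow> length xs = Suc n \<and> hd xs = x0 \<and> set xs \<subseteq> N \<and> distinct xs \<and>
      successively (hop N) xs"
  shows "finite S" "real (card S) \<le> exp (count_const TYPE('a) H * m)"
proof -
  define X where "X z = card (N \<inter> cube K z)" for z
  have finX: "finite (N \<inter> cube K z)" for z using few by (simp add: few_points_def)
  \<comment> \<open>The Kraft sum needs a finite set of candidates. A walk of \<open>2 * m\<close>
    steps from the origin stays in this box, and it covers every cell of the path.\<close>
  define P where "P = {x \<in> N. cell K x \<in> nbhd (int (2 * m)) origin_cell}"
  have "finite (\<Union>z\<in>nbhd (int (2 * m)) origin_cell. N \<inter> cube K z)"
    by (intro finite_UN_I finX) simp
  then have finP: "finite P" by (rule rev_finite_subset) (auto simp: P_def)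
  \<comment> \<open>For a cell without nuclei the division yields 0, which does no harm to the bound
    on the row sums.\<close>
  define w where "w x y = step_weight m (cell K x) (cell K y) / X (cell K y)" for x y
  have w0: "w x y \<ge> 0" for x y by (simp add: w_def step_weight_nonneg)
  have wsum: "(\<Sum>y\<in>P. w x y) \<le> 1" for x
  proof -
    have "(\<Sum>y\<in>P. w x y) = (\<Sum>z\<in>cell K ` P. \<Sum>y\<in>{y\<in>P. cell K y = z}. w x y)"
      by (rule sum.image_gen[OF finP])
    also have "\<dots> \<le> (\<Sum>z\<in>cell K ` P. step_weight m (cell K x) z)"
    proof (rule sum_mono)
      fix z
      have "(\<Sum>y\<in>{y\<in>P. cell K y = z}. w x y) =
          card {y\<in>P. cell K y = z} * (step_weight m (cell K x) z / X z)" by (simp add: w_def)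
      also have "\<dots> \<le> X z * (step_weight m (cell K x) z / X z)"
        unfolding X_def using finX
        by (intro mult_right_mono) (auto simp: step_weight_nonneg P_def intro!: card_mono)
      also have "\<dots> \<le> step_weight m (cell K x) z" by (simp add: step_weight_nonneg)
      finally show "(\<Sum>y\<in>{y\<in>P. cell K y = z}. w x y) \<le> step_weight m (cell K x) z" .
    qed
    also have "\<dots> \<le> 1" using finP by (intro sum_step_weight_le) simp
    finally show ?thesis .
  qed
  define a where "a = DIM('a) * ln (17 * DIM('a)) + ln 2"
  define c where "c = DIM('a) * ln 4 + ln 2"
  define q where "q = ln (3 / 2 :: real)"
  have q: "q > 0" by (simp add: q_def)
  have c: "c > 0" by (simp add: c_def add_nonneg_pos)
  have "real DIM('a) \<ge> 1" using DIM_positive[where 'a='a] by (simp add: Suc_le_eq)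
  then have "ln (17 * real DIM('a)) \<ge> 0" by (intro ln_ge_zero) linarith
  then have a: "a \<ge> 0" by (simp add: a_def)
  have main: "set xs \<subseteq> P \<and> exp (- (count_const TYPE('a) H * m)) \<le> (\<Prod>i<n. w (xs ! i) (xs ! Suc i))"
    if xs: "xs \<in> S" for xs
  proof -
    note xS = S[OF xs]
    \<comment> \<open>The origin cell is put in front because the nucleus \<open>x0\<close> is
      itself reached by a hop from 0; hence the \<open>n + 2\<close> in the hypothesis on
      \<open>m\<close>.\<close>
    define zs where "zs = origin_cell # map (cell K) xs"
    have suc: "successively (\<lambda>z w. w \<in> reach N K z) (map (cell K) xs)"
      using xS hop_reach[OF K] by (auto simp: successively_map intro: successively_mono)
    have ne: "xs \<noteq> []" using xS by auto
    have "cell K x0 \<in> reach N K origin_cell" using hop_reach[OF K x0] by (simp add: cell_zero)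
    then have zsuc: "successively (\<lambda>z w. w \<in> reach N K z) zs"
      using suc ne xS by (cases xs) (auto simp: zs_def)
    define A where "A = (\<Union>z\<in>set zs. reach N K z)"
    have A: "linked origin_cell A" "finite A" "card A \<le> m" "set zs \<subseteq> A"
      unfolding A_def using path_animal[OF sp _ _ zsuc] m xS by (auto simp: zs_def)
    have bl: "finite (blob N K A k) \<and> 4 * 2 ^ k * card (blob N K A k) \<le> m" for k
      using card_blob[OF sp A(2,1,3)] .
    obtain V where V: "V \<in> walks origin_cell (2 * m)" "set V = A"
      using covering_walk[OF A(2,1,3)] by blast
    have lnX: "(\<Sum>z\<in>A. ln (fact (X z))) \<le> H * m"
      using few V by (auto simp: few_points_def X_def)
    have AP: "A \<subseteq> nbhd (int (2 * m)) origin_cell"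
    proof
      fix z assume "z \<in> A"
      then obtain i where i: "i < length V" "V ! i = z" using V(2) by (metis in_set_conv_nth)
      have hd: "V ! 0 = origin_cell" using V(1) hd_conv_nth[of V] by (cases V) (auto simp: walks_def)
      have il: "i \<le> 2 * m" using i(1) V(1) by (simp add: walks_def)
      have "z \<in> nbhd (int i) origin_cell"
        using walk_displacement[OF V(1), of 0 i] il hd i(2) by simp
      then show "z \<in> nbhd (int (2 * m)) origin_cell" using nbhd_mono il by (meson of_nat_le_iff subsetD)
    qed
    have cellA: "x \<in> set xs \<Longrightarrow> cell K x \<in> A" for x using A(4) by (auto simp: zs_def)
    then have xsP: "set xs \<subseteq> P" using xS AP by (auto simp: P_def)
    \<comment> \<open>The base 3/2 must exceed 1, so that \<open>ln (h z)\<close> dominates the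
      scale of every hop leaving \<open>z\<close>, and must be less than 2, so that its powers are
      summable against the decay \<open>m / (4 * 2 ^ k)\<close> of the number of bad cells.\<close>
    define h where "h z = 1 + (\<Sum>k\<in>{k. k \<le> m \<and> bad_near N K k z}. (3 / 2 :: real) ^ k)" for z
    have h1: "h z \<ge> 1" for z by (simp add: h_def sum_nonneg)
    have step: "exp (- (a + c / q * ln (h (cell K (xs ! i))) + ln (X (cell K (xs ! Suc i)))))
        \<le> w (xs ! i) (xs ! Suc i)" if i: "i < n" for i
    proof -
      let ?z = "cell K (xs ! i)" and ?w = "cell K (xs ! Suc i)"
      have mem: "xs ! i \<in> set xs" "xs ! Suc i \<in> set xs" using i xS by auto
      have "hop N (xs ! i) (xs ! Suc i)" using xS i by (auto simp: successively_conv_nth)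
      then have "?w \<in> reach N K ?z" by (rule hop_reach[OF K])
      then obtain k where k: "k \<in> scales N K ?z" "?w \<in> nbhd (rad TYPE('a) k) ?z"
        by (auto simp: reach_def)
      have kh: "k \<le> m \<and> (3 / 2) ^ k \<le> h ?z"
      proof (cases "k = 0")
        case True then show ?thesis using h1 by simp
      next
        case False
        then have b: "bad_near N K k ?z" using k by (simp add: scales_def)
        then have "?w \<in> blob N K A k" using k cellA[OF mem(1)] by (auto simp: blob_def)
        then have km: "k < m" using blob_empty[OF sp A(2,1,3), of k] by (cases "k < m") auto
        then have "(\<Sum>j\<in>{k}. (3 / 2 :: real) ^ j) \<le> (\<Sum>k\<in>{k. k \<le> m \<and> bad_near N K k ?z}. (3 / 2) ^ k)"
          using b by (intro sum_mono2) auto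
        then show ?thesis using km by (simp add: h_def)
      qed
      have "k * q = ln ((3 / 2) ^ k)" by (simp add: q_def ln_realpow)
      also have "\<dots> \<le> ln (h ?z)" using kh h1[of ?z] by (subst ln_le_cancel_iff) auto
      finally have "k * c \<le> c / q * ln (h ?z)" using q c by (simp add: field_simps)
      then have "exp (- (a + c / q * ln (h ?z))) \<le> exp (- (a + k * c))" by simp
      also have "\<dots> \<le> step_weight m ?z ?w"
        unfolding a_def c_def using step_weight_ge[OF _ k(2)] kh by simp
      finally have 1: "exp (- (a + c / q * ln (h ?z))) \<le> step_weight m ?z ?w" .
      have "xs ! Suc i \<in> N \<inter> cube K ?w" using mem xS by auto
      then have X1: "X ?w > 0" unfolding X_def using finX by (auto simp: card_gt_0_iff)
      have "exp (- (a + c / q * ln (h ?z) + ln (X ?w))) = exp (- (a + c / q * ln (h ?z))) / X ?w"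
        using X1 by (simp add: exp_add exp_minus exp_diff field_simps)
      also have "\<dots> \<le> w (xs ! i) (xs ! Suc i)" unfolding w_def using 1 by (intro divide_right_mono) auto
      finally show ?thesis .
    qed
    \<comment> \<open>Self-avoidance enters here: a cell is visited at most \<open>X z\<close>
      times. The offset \<open>e\<close> is 0 for the starting points of the hops and 1 for their
      endpoints.\<close>
    have sumA: "(\<Sum>i<n. f (cell K (xs ! (i + e)))) \<le> (\<Sum>z\<in>A. X z * f z)"
      if f: "\<And>z. f z \<ge> 0" and e: "e \<le> 1" for f :: "('a \<Rightarrow> int) \<Rightarrow> real" and e
    proof -
      have inj: "inj_on (\<lambda>i. xs ! (i + e)) {..<n}"
        using xS e by (auto simp: inj_on_def nth_eq_iff_index_eq)
      have "(\<Sum>i<n. f (cell K (xs ! (i + e)))) = (\<Sum>x\<in>(\<lambda>i. xs ! (i + e)) ` {..<n}. f (cell K x))"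
        by (subst sum.reindex[OF inj]) simp
      also have "\<dots> \<le> (\<Sum>x\<in>set xs. f (cell K x))"
        using xS e by (intro sum_mono2) (auto simp: f)
      also have "\<dots> = (\<Sum>z\<in>cell K ` set xs. \<Sum>x\<in>{x\<in>set xs. cell K x = z}. f (cell K x))"
        by (rule sum.image_gen) simp
      also have "\<dots> \<le> (\<Sum>z\<in>cell K ` set xs. X z * f z)"
      proof (rule sum_mono)
        fix z
        have "(\<Sum>x\<in>{x\<in>set xs. cell K x = z}. f (cell K x)) = card {x\<in>set xs. cell K x = z} * f z"
          by simp
        also have "\<dots> \<le> X z * f z"
          unfolding X_def using finX[of z] xS
          by (intro mult_right_mono f) (auto intro!: card_mono)
        finally show "(\<Sum>x\<in>{x\<in>set xs. cell K x = z}. f (cell K x)) \<le> X z * f z" .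
      qed
      also have "\<dots> \<le> (\<Sum>z\<in>A. X z * f z)"
        using cellA A(2) by (intro sum_mono2) (auto simp: f)
      finally show ?thesis .
    qed
    have cA: "real (card A) \<le> m" using A(3) by simp
    have hsum: "(\<Sum>z\<in>A. h z) \<le> 2 * m"
    proof -
      have "(\<Sum>z\<in>A. \<Sum>k\<in>{k. k \<le> m \<and> bad_near N K k z}. (3 / 2 :: real) ^ k) =
          (\<Sum>k\<le>m. \<Sum>z\<in>{z\<in>A. bad_near N K k z}. (3 / 2) ^ k)"
        using A(2) sum.swap_restrict[of A "{..m}" "\<lambda>z k. (3 / 2 :: real) ^ k" "\<lambda>z k. bad_near N K k z"]
        by simp
      also have "\<dots> \<le> (\<Sum>k\<le>m. m / 4 * (3 / 4) ^ k)"
      proof (rule sum_mono)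
        fix k
        have "{z\<in>A. bad_near N K k z} \<subseteq> blob N K A k"
          using A(1) by (fastforce simp: blob_def rad_def linked_def intro: nbhd_refl)
        then have "card {z\<in>A. bad_near N K k z} \<le> card (blob N K A k)"
          using bl by (intro card_mono) auto
        then have "4 * 2 ^ k * card {z\<in>A. bad_near N K k z} \<le> 4 * 2 ^ k * card (blob N K A k)"
          by (intro mult_left_mono) auto
        also note conjunct2[OF bl[of k]]
        finally have "real (4 * 2 ^ k * card {z\<in>A. bad_near N K k z}) \<le> real m"
          by (simp only: of_nat_le_iff)
        then have "card {z\<in>A. bad_near N K k z} \<le> m / (4 * 2 ^ k)" by (simp add: field_simps)
        then have "card {z\<in>A. bad_near N K k z} * (3 / 2) ^ k \<le> m / (4 * 2 ^ k) * (3 / 2 :: real) ^ k"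
          by (intro mult_right_mono) auto
        also have "\<dots> = m / 4 * (3 / 4) ^ k" by (simp add: power_divide flip: power_mult_distrib)
        finally show "(\<Sum>z\<in>{z\<in>A. bad_near N K k z}. (3 / 2 :: real) ^ k) \<le> m / 4 * (3 / 4) ^ k" by simp
      qed
      also have "\<dots> = m / 4 * (\<Sum>k<Suc m. (3 / 4) ^ k)"
        by (simp add: sum_distrib_left lessThan_Suc_atMost)
      also have "(\<Sum>k<Suc m. (3 / 4 :: real) ^ k) = ((3 / 4) ^ Suc m - 1) / (3 / 4 - 1)"
        by (rule geometric_sum) simp
      also have "m / 4 * (((3 / 4) ^ Suc m - 1) / (3 / 4 - 1)) \<le> m / 4 * (4 :: real)"
        by (intro mult_left_mono) auto
      finally show ?thesis using cA by (simp add: h_def sum.distrib)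
    qed
    \<comment> \<open>The inequality is applied with \<open>t = ln (h z)\<close>, which turns the
      exponential into \<open>h z\<close> itself, whose sum over \<open>A\<close> is already known
      to be linear in \<open>m\<close>.\<close>
    have Xh: "(\<Sum>z\<in>A. X z * ln (h z)) \<le> H * m + 2 * m"
    proof -
      have "(\<Sum>z\<in>A. X z * ln (h z)) \<le> (\<Sum>z\<in>A. ln (fact (X z)) + h z)"
      proof (rule sum_mono)
        fix z have "exp (ln (h z)) = h z" using h1[of z] by (intro exp_ln) linarith
        then show "X z * ln (h z) \<le> ln (fact (X z)) + h z"
          using mult_le_ln_fact_add_exp[of "X z" "ln (h z)"] by simp
      qed
      then show ?thesis using lnX hsum by (simp add: sum.distrib)
    qed
    \<comment> \<open>The inequality is used twice, with \<open>t = ln (X z)\<close> and with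
      \<open>t = 1\<close>; the second use bounds the term \<open>X z\<close> left over by the
      first.\<close>
    have XX: "(\<Sum>z\<in>A. X z * ln (X z)) \<le> 2 * H * m + 3 * m"
    proof -
      have "(\<Sum>z\<in>A. X z * ln (X z)) \<le> (\<Sum>z\<in>A. 2 * ln (fact (X z)) + exp 1)"
      proof (rule sum_mono)
        fix z
        have "X z * ln (X z) \<le> ln (fact (X z)) + X z"
          using mult_le_ln_fact_add_exp[of "X z" "ln (X z)"] by (cases "X z = 0") auto
        moreover have "real (X z) * 1 \<le> ln (fact (X z)) + exp 1" by (rule mult_le_ln_fact_add_exp)
        ultimately show "X z * ln (X z) \<le> 2 * ln (fact (X z)) + exp 1" by simp
      qed
      also have "\<dots> = 2 * (\<Sum>z\<in>A. ln (fact (X z))) + exp 1 * card A"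
        by (simp add: sum.distrib sum_distrib_left)
      also have "\<dots> \<le> 2 * (H * m) + exp 1 * m"
        using lnX cA by (intro add_mono mult_left_mono) auto
      also have "\<dots> = 2 * H * m + exp 1 * m" by simp
      also have "\<dots> \<le> 2 * H * m + 3 * m"
        using mult_right_mono[OF exp_le, of "real m"] by simp
      finally show ?thesis .
    qed
    have nm: "n \<le> m"
    proof -
      have "1 \<le> (16 * DIM('a) + 1) ^ DIM('a)" by (rule one_le_power) simp
      then have "1 * n \<le> (2 * (16 * DIM('a) + 1) ^ DIM('a)) * (n + 2)" by (intro mult_mono) auto
      then show ?thesis using m by simp
    qed
    have "(\<Sum>i<n. a + c / q * ln (h (cell K (xs ! i))) + ln (X (cell K (xs ! Suc i)))) =
        n * a + c / q * (\<Sum>i<n. ln (h (cell K (xs ! (i + 0))))) + (\<Sum>i<n. ln (X (cell K (xs ! (i + 1)))))"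
      by (simp add: sum.distrib sum_distrib_left)
    also have "\<dots> \<le> m * a + c / q * (H * m + 2 * m) + (2 * H * m + 3 * m)"
    proof (intro add_mono mult_left_mono mult_right_mono)
      show "(\<Sum>i<n. ln (h (cell K (xs ! (i + 0))))) \<le> H * m + 2 * m"
        using sumA[of "\<lambda>z. ln (h z)" 0] h1 Xh by (smt (verit) ln_ge_zero zero_le_one)
      have "ln (real (X z)) \<ge> 0" for z by (cases "X z") auto
      then show "(\<Sum>i<n. ln (X (cell K (xs ! (i + 1))))) \<le> 2 * H * m + 3 * m"
        using sumA[of "\<lambda>z. ln (X z)" 1] XX by simp
    qed (use nm a q c in auto)
    also have "\<dots> = count_const TYPE('a) H * m"
      by (simp add: count_const_def a_def c_def q_def algebra_simps)
    finally have "exp (- (count_const TYPE('a) H * m)) \<le>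
        exp (- (\<Sum>i<n. a + c / q * ln (h (cell K (xs ! i))) + ln (X (cell K (xs ! Suc i)))))" by simp
    also have "\<dots> = (\<Prod>i<n. exp (- (a + c / q * ln (h (cell K (xs ! i))) + ln (X (cell K (xs ! Suc i))))))"
      by (simp add: sum_negf[symmetric] exp_sum)
    also have "\<dots> \<le> (\<Prod>i<n. w (xs ! i) (xs ! Suc i))"
      by (intro prod_mono) (use step in auto)
    finally show ?thesis using xsP by blast
  qed
  show "finite S" "real (card S) \<le> exp (count_const TYPE('a) H * m)"
    by (rule kraft_card[of P w S n x0 "count_const TYPE('a) H * m"];
        use finP w0 wsum S main in blast)+
qed

section \<open>Poisson estimates\<close>

lemma num_points_eq: "num_points N A = (if finite (N \<inter> A) then of_nat (card (N \<inter> A)) else \<infinity>)"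
  by (simp add: emeasure_count_space)

lemma num_points_eq_0_iff: "num_points N A = 0 \<longleftrightarrow> N \<inter> A = {}"
  by (auto simp: num_points_eq)

lemma cube_eq:
  assumes "s > 0" "z \<in> extensional Basis"
  shows "cube s z = {x. \<forall>b\<in>Basis. s * z b \<le> x \<bullet> b \<and> x \<bullet> b < s * (z b + 1)}"
proof -
  have "cell s x = z \<longleftrightarrow> (\<forall>b\<in>Basis. \<lfloor>(x \<bullet> b) / s\<rfloor> = z b)" for x
    using assms(2) by (auto simp: cell_def intro!: extensionalityI[of _ Basis])
  then show ?thesis using assms(1) by (auto simp: floor_eq_iff field_simps)
qed

lemma cube_borel [measurable]:
  fixes z :: "'a::euclidean_space \<Rightarrow> int"
  assumes "s > 0" shows "cube s z \<in> sets borel"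
proof (cases "z \<in> extensional Basis")
  case True
  show ?thesis unfolding cube_eq[OF assms True] by measurable
next
  case False
  then have "cube s z = {}" using cell_extensional by blast
  then show ?thesis by simp
qed

lemma emeasure_cube:
  fixes z :: "'a::euclidean_space \<Rightarrow> int"
  assumes "s > 0" "z \<in> extensional Basis"
  shows "emeasure lborel (cube s z) = ennreal (s ^ DIM('a))"
proof -
  define l where "l = (\<Sum>b\<in>Basis. (s * z b) *\<^sub>R b :: 'a)"
  define u where "u = (\<Sum>b\<in>Basis. (s * (z b + 1)) *\<^sub>R b :: 'a)"
  have lu: "l \<bullet> b = s * z b" "u \<bullet> b = s * (z b + 1)" if "b \<in> Basis" for b
    using that by (simp_all add: l_def u_def)
  have le: "l \<bullet> b \<le> u \<bullet> b" if "b \<in> Basis" for b using that assms lu by simp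
  have prod: "(\<Prod>b\<in>Basis. (u - l) \<bullet> b) = s ^ DIM('a)"
    by (simp add: inner_diff_left lu algebra_simps)
  have "box l u \<subseteq> cube s z" "cube s z \<subseteq> cbox l u"
    unfolding cube_eq[OF assms] by (auto simp: mem_box lu less_imp_le)
  then have "emeasure lborel (box l u) \<le> emeasure lborel (cube s z)"
    "emeasure lborel (cube s z) \<le> emeasure lborel (cbox l u)"
    using assms(1) by (auto intro!: emeasure_mono)
  then show ?thesis using le prod by (simp add: emeasure_lborel_cbox_eq)
qed

lemma emeasure_Union_cubes:
  fixes T :: "('a::euclidean_space \<Rightarrow> int) set"
  assumes s: "s > 0" and "finite T" "T \<subseteq> extensional Basis"
  shows "emeasure lborel (\<Union>q\<in>T. cube s q) = ennreal (real (card T) * s ^ DIM('a))"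
proof -
  have "emeasure lborel (\<Union>q\<in>T. cube s q) = (\<Sum>q\<in>T. emeasure lborel (cube s q))"
    using assms by (intro sum_emeasure[symmetric]) (auto simp: disjoint_family_on_def)
  also have "\<dots> = (\<Sum>q\<in>T. ennreal (s ^ DIM('a)))"
    using assms by (intro sum.cong) (auto simp: emeasure_cube)
  finally show ?thesis using s by (simp add: ennreal_mult ennreal_of_nat_eq_real_of_nat)
qed

text \<open>The square root is taken because the factorial of a Poisson variable has infinite mean
  once its parameter is at least 1, whereas the series with \<open>sqrt (fact k)\<close> in the
  denominator converges for every parameter. At infinity the value is 1 by the conventions of
  \<open>enn2real\<close>; on sets of finite intensity this value of the count has probability
  0.\<close>

definition root_fact :: "ennreal \<Rightarrow> ennreal" where
  "root_fact x = ennreal (sqrt (fact (nat \<lfloor>enn2real x\<rfloor>)))"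

lemma root_fact_of_nat: "root_fact (of_nat k) = ennreal (sqrt (fact k))"
  by (simp add: root_fact_def flip: ennreal_of_nat_eq_real_of_nat)

lemma root_fact_measurable [measurable]: "root_fact \<in> borel_measurable borel"
  unfolding root_fact_def[abs_def] by measurable

lemma summable_pow_div_root_fact:
  assumes "r \<ge> (0::real)" shows "summable (\<lambda>k. r ^ k / sqrt (fact k))"
proof (rule summable_ratio_test[of "1 / 2" "nat \<lceil>4 * r\<^sup>2\<rceil>"])
  fix n assume "nat \<lceil>4 * r\<^sup>2\<rceil> \<le> n"
  then have "4 * r\<^sup>2 \<le> real n" by linarith
  then have "(2 * r)\<^sup>2 \<le> real (Suc n)" by (simp add: power2_eq_square)
  then have 1: "2 * r \<le> sqrt (real (Suc n))" by (rule real_le_rsqrt)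
  have "norm (r ^ Suc n / sqrt (fact (Suc n))) = (r / sqrt (Suc n)) * (r ^ n / sqrt (fact n))"
    using assms by (simp add: real_sqrt_mult)
  also have "\<dots> \<le> (1 / 2) * (r ^ n / sqrt (fact n))"
    using assms 1 by (intro mult_right_mono) (auto simp: divide_le_eq simp del: of_nat_Suc)
  finally show "norm (r ^ Suc n / sqrt (fact (Suc n))) \<le> 1 / 2 * norm (r ^ n / sqrt (fact n))"
    using assms by simp
qed simp

locale poisson_nuclei = prob_space M for M :: "'w measure" +
  fixes \<mu> :: "'a::euclidean_space measure" and N :: "'w \<Rightarrow> 'a set" and c :: real
  assumes poisson: "poisson_random_set M \<mu> N" and c_pos: "c > 0"

    and mu_ge: "\<And>A. A \<in> sets lebesgue \<Longrightarrow> ennreal (1 / c) * emeasure lebesgue A \<le> emeasure \<mu> A"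
    and mu_le: "\<And>A. A \<in> sets lebesgue \<Longrightarrow> emeasure \<mu> A \<le> ennreal c * emeasure lebesgue A"
begin

lemma num_points_measurable:
  "A \<in> sets borel \<Longrightarrow> (\<lambda>\<omega>. num_points (N \<omega>) A) \<in> borel_measurable M"
  using poisson by (auto simp: poisson_random_set_def)

lemma prob_num_points:
  "A \<in> sets borel \<Longrightarrow> emeasure \<mu> A < \<infinity> \<Longrightarrow>
    prob {\<omega> \<in> space M. num_points (N \<omega>) A = of_nat k} = measure \<mu> A ^ k / fact k * exp (- measure \<mu> A)"
  using poisson by (auto simp: poisson_random_set_def)

lemma num_points_event:
  assumes "A \<in> sets borel" shows "{\<omega> \<in> space M. num_points (N \<omega>) A = x} \<in> events"
  using measurable_sets[OF num_points_measurable[OF assms], of "{x}"]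
  by (simp add: vimage_def Int_def conj_commute)

lemma mu_bounds:
  assumes A: "A \<in> sets borel" and e: "emeasure lborel A = ennreal r" and r: "r \<ge> 0"
  shows "emeasure \<mu> A < \<infinity>" "r / c \<le> measure \<mu> A" "measure \<mu> A \<le> c * r"
proof -
  have "A \<in> sets lebesgue" using A by (simp add: sets_completionI_sets)
  moreover have "emeasure lebesgue A = ennreal r" using e A by simp
  ultimately have b: "ennreal (r / c) \<le> emeasure \<mu> A" "emeasure \<mu> A \<le> ennreal (c * r)"
    using mu_ge[of A] mu_le[of A] r c_pos by (simp_all flip: ennreal_mult)
  show fin: "emeasure \<mu> A < \<infinity>" using b(2) by (simp add: le_less_trans)
  have "emeasure \<mu> A = ennreal (measure \<mu> A)" using fin by (simp add: emeasure_eq_ennreal_measure)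
  then show "r / c \<le> measure \<mu> A" "measure \<mu> A \<le> c * r"
    using b r c_pos by (simp_all add: ennreal_le_iff)
qed

lemma empty_cubes_event:
  assumes "s > 0" "finite T"
  shows "{\<omega> \<in> space M. \<forall>q\<in>T. cube s q \<inter> N \<omega> = {}} \<in> events"
proof -
  have "{\<omega> \<in> space M. \<forall>q\<in>T. cube s q \<inter> N \<omega> = {}} =
      {\<omega> \<in> space M. num_points (N \<omega>) (\<Union>q\<in>T. cube s q) = 0}"
    unfolding num_points_eq_0_iff by auto
  then show ?thesis using assms by (simp add: num_points_event sets.finite_UN)
qed

lemma prob_empty_cubes:
  assumes "s > 0" "finite T" "T \<subseteq> extensional Basis"
  shows "prob {\<omega> \<in> space M. \<forall>q\<in>T. cube s q \<inter> N \<omega> = {}} \<le> exp (- (real (card T) * s ^ DIM('a) / c))"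
proof -
  let ?U = "\<Union>q\<in>T. cube s q"
  have U: "?U \<in> sets borel" using assms by (auto intro!: sets.finite_UN)
  note b = mu_bounds[OF U emeasure_Union_cubes[OF assms]]
  have "{\<omega> \<in> space M. \<forall>q\<in>T. cube s q \<inter> N \<omega> = {}} = {\<omega> \<in> space M. num_points (N \<omega>) ?U = of_nat 0}"
    unfolding of_nat_0 num_points_eq_0_iff by auto
  then have "prob {\<omega> \<in> space M. \<forall>q\<in>T. cube s q \<inter> N \<omega> = {}} = exp (- measure \<mu> ?U)"
    using prob_num_points[OF U, of 0] b assms by simp
  then show ?thesis using b assms by simp
qed

text \<open>The prescribed probabilities of the finite counts already add up to 1.\<close>

lemma AE_num_points_nat:
  assumes A: "A \<in> sets borel" and fin: "emeasure \<mu> A < \<infinity>"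
  shows "AE \<omega> in M. num_points (N \<omega>) A \<in> range of_nat"
proof -
  let ?E = "\<lambda>k::nat. {\<omega> \<in> space M. num_points (N \<omega>) A = of_nat k}"
  let ?m = "measure \<mu> A"
  have 1: "(\<lambda>k. prob (?E k)) sums prob (\<Union>k. ?E k)"
    using num_points_event[OF A] by (intro finite_measure_UNION) (auto simp: disjoint_family_on_def)
  have 2: "(\<lambda>k. prob (?E k)) = (\<lambda>k. ?m ^ k /\<^sub>R fact k * exp (- ?m))"
    using prob_num_points[OF A fin] by (simp add: divide_inverse mult.commute)
  have 3: "(\<lambda>k. ?m ^ k /\<^sub>R fact k * exp (- ?m)) sums (exp ?m * exp (- ?m))"
    by (intro sums_mult2 exp_converges)
  have "prob (\<Union>k. ?E k) = exp ?m * exp (- ?m)" by (rule sums_unique2[OF 1 3[folded 2]])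
  then have "prob (\<Union>k. ?E k) = 1" by (simp flip: exp_add)
  moreover have "(\<Union>k. ?E k) \<in> events" using num_points_event[OF A] by auto
  ultimately have "AE \<omega> in M. \<omega> \<in> (\<Union>k. ?E k)" by (simp add: prob_eq_1)
  then show ?thesis by eventually_elim auto
qed

text \<open>The factor \<open>exp (- measure \<mu> A)\<close> is dropped, so that the bound is
  monotone in the intensity and one number \<open>r\<close> serves all cubes of the same
  side.\<close>

lemma nn_integral_root_fact_le:
  assumes A: "A \<in> sets borel" and fin: "emeasure \<mu> A < \<infinity>" and r: "measure \<mu> A \<le> r"
  shows "(\<integral>\<^sup>+\<omega>. root_fact (num_points (N \<omega>) A) \<partial>M) \<le> ennreal (\<Sum>k. r ^ k / sqrt (fact k))"
proof -
  let ?E = "\<lambda>k::nat. {\<omega> \<in> space M. num_points (N \<omega>) A = of_nat k}"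
  have r0: "r \<ge> 0" using r measure_nonneg[of \<mu> A] by linarith
  have "AE \<omega> in M. root_fact (num_points (N \<omega>) A) = (\<Sum>k. ennreal (sqrt (fact k)) * indicator (?E k) \<omega>)"
    using AE_num_points_nat[OF A fin] AE_space
  proof eventually_elim
    case (elim \<omega>)
    then obtain n where n: "num_points (N \<omega>) A = of_nat n" by auto
    have "(\<Sum>k. ennreal (sqrt (fact k)) * indicator (?E k) \<omega>) =
        (\<Sum>k\<in>{n}. ennreal (sqrt (fact k)) * indicator (?E k) \<omega>)"
      using n by (intro suminf_finite) (auto simp: indicator_def)
    then show ?case using n elim by (simp add: root_fact_of_nat)
  qed
  then have "(\<integral>\<^sup>+\<omega>. root_fact (num_points (N \<omega>) A) \<partial>M) =
      (\<integral>\<^sup>+\<omega>. (\<Sum>k. ennreal (sqrt (fact k)) * indicator (?E k) \<omega>) \<partial>M)" by (rule nn_integral_cong_AE)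
  also have "\<dots> = (\<Sum>k. ennreal (sqrt (fact k)) * emeasure M (?E k))"
    using num_points_event[OF A] by (subst nn_integral_suminf) (auto simp: nn_integral_cmult_indicator)
  also have "\<dots> \<le> (\<Sum>k. ennreal (r ^ k / sqrt (fact k)))"
  proof (intro suminf_le summableI)
    fix k
    have "prob (?E k) \<le> r ^ k / fact k * 1"
      unfolding prob_num_points[OF A fin] using r r0
      by (intro mult_mono divide_right_mono power_mono) auto
    then have "sqrt (fact k) * prob (?E k) \<le> sqrt (fact k) * (r ^ k / fact k)"
      by (intro mult_left_mono) auto
    also have "\<dots> = r ^ k / sqrt (fact k)" by (simp add: real_div_sqrt field_simps)
    finally show "ennreal (sqrt (fact k)) * emeasure M (?E k) \<le> ennreal (r ^ k / sqrt (fact k))"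
      by (simp add: emeasure_eq_measure ennreal_leI flip: ennreal_mult)
  qed
  also have "\<dots> = ennreal (\<Sum>k. r ^ k / sqrt (fact k))"
    using r0 by (intro suminf_ennreal2 summable_pow_div_root_fact) auto
  finally show ?thesis .
qed

lemma nn_integral_prod_root_fact_le:
  assumes K: "K > 0" and Z: "finite Z" "Z \<subseteq> extensional Basis"
  shows "(\<integral>\<^sup>+\<omega>. (\<Prod>z\<in>Z. root_fact (num_points (N \<omega>) (cube K z))) \<partial>M)
    \<le> ennreal (\<Sum>k. (c * K ^ DIM('a)) ^ k / sqrt (fact k)) ^ card Z"
proof -
  obtain zs where zs: "set zs = Z" "distinct zs" using finite_distinct_list[OF Z(1)] by blast
  \<comment> \<open>Independence is given for sequences of disjoint sets, so the finite list of
    cubes is padded with empty sets.\<close>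
  define A where "A i = (if i < length zs then cube K (zs ! i) else {})" for i
  have "disjoint_family A"
    using zs(2) by (auto simp: disjoint_family_on_def A_def nth_eq_iff_index_eq)
  moreover have Ab: "range A \<subseteq> sets borel" using K by (auto simp: A_def)
  ultimately have "indep_vars (\<lambda>_. borel) (\<lambda>i \<omega>. num_points (N \<omega>) (A i)) UNIV"
    using poisson by (auto simp: poisson_random_set_def)
  then have "indep_vars (\<lambda>_. borel) (\<lambda>i \<omega>. num_points (N \<omega>) (A i)) {..<length zs}"
    by (rule indep_vars_subset) simp
  then have ind: "indep_vars (\<lambda>_. borel) (\<lambda>i \<omega>. root_fact (num_points (N \<omega>) (A i))) {..<length zs}"
    by (rule indep_vars_compose2) measurable
  have bij: "bij_betw ((!) zs) {..<length zs} Z"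
    using zs bij_betw_nth[of zs "{..<length zs}" Z] by auto
  have "(\<integral>\<^sup>+\<omega>. (\<Prod>z\<in>Z. root_fact (num_points (N \<omega>) (cube K z))) \<partial>M) =
      (\<integral>\<^sup>+\<omega>. (\<Prod>i<length zs. root_fact (num_points (N \<omega>) (A i))) \<partial>M)"
    by (intro nn_integral_cong, subst prod.reindex_bij_betw[OF bij, symmetric]) (simp add: A_def)
  also have "\<dots> = (\<Prod>i<length zs. \<integral>\<^sup>+\<omega>. root_fact (num_points (N \<omega>) (A i)) \<partial>M)"
    using ind by (intro indep_vars_nn_integral) auto
  also have "\<dots> \<le> (\<Prod>i<length zs. ennreal (\<Sum>k. (c * K ^ DIM('a)) ^ k / sqrt (fact k)))"
  proof (intro prod_mono_ennreal nn_integral_root_fact_le)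
    fix i assume "i \<in> {..<length zs}"
    then have Ai: "A i = cube K (zs ! i)" and z: "zs ! i \<in> extensional Basis"
      using Z zs by (auto simp: A_def)
    have b: "cube K (zs ! i) \<in> sets borel" using K by (rule cube_borel)
    note m = mu_bounds[OF b emeasure_cube[OF K z]]
    show "A i \<in> sets borel" using Ai b by simp
    show "emeasure \<mu> (A i) < \<infinity>" "measure \<mu> (A i) \<le> c * K ^ DIM('a)"
      using m K unfolding Ai by auto
  qed
  also have "\<dots> = ennreal (\<Sum>k. (c * K ^ DIM('a)) ^ k / sqrt (fact k)) ^ card Z"
    using zs distinct_card by fastforce
  finally show ?thesis .
qed

end

text \<open>With \<open>y\<close> for the cube root of \<open>m\<close> and
  \<open>x = 2 ^ k\<close>: if \<open>y \<le> x\<close> the second term is at least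
  \<open>x\<close>, otherwise the first is \<open>y * y * y / x\<close>, hence at least
  \<open>y\<close>. It combines the two lower bounds on the empty volume at scale
  \<open>k\<close>.\<close>

lemma cube_root_le:
  assumes m: "m \<ge> (1::nat)"
  shows "real m powr (1 / 3) \<le> m / 2 ^ k + 4 ^ k"
proof -
  let ?y = "real m powr (1 / 3)" and ?x = "(2::real) ^ k"
  have y1: "?y \<ge> 1" using m by (intro ge_one_powr_ge_zero) auto
  have "?y ^ 3 = m" using m by (simp add: powr_power)
  then have y3: "real m = ?y * (?y * ?y)" by (simp add: power3_eq_cube)
  have x1: "?x \<ge> 1" by simp
  have x4: "(4::real) ^ k = ?x * ?x" by (simp flip: power_mult_distrib)
  show ?thesis
  proof (cases "?y \<le> ?x")
    case True
    have "?x * 1 \<le> ?x * ?x" using x1 by (intro mult_left_mono) auto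
    then have "?y \<le> 4 ^ k" using True x4 by linarith
    moreover have "0 \<le> m / ?x" by simp
    ultimately show ?thesis by linarith
  next
    case False
    have "?y * ?x \<le> ?y * ?y" using False y1 by (intro mult_left_mono) auto
    also have "\<dots> * 1 \<le> ?y * ?y * ?y" using y1 by (intro mult_left_mono) auto
    finally have "?y * ?x \<le> real m" using y3 by (simp add: mult.assoc)
    then have "?y \<le> m / ?x" using x1 by (simp add: pos_le_divide_eq)
    then show ?thesis using x4 by (smt (verit) zero_le_power)
  qed
qed

text \<open>This gives the failure probabilities of the infinitely many scales the weights
  \<open>(1 / 2) ^ Suc k\<close>, of total 1.\<close>

lemma exp_neg_power4_le: "exp (- (4 ^ k)) \<le> (1 / 2 :: real) ^ Suc k"
proof -
  have "Suc k \<le> 4 ^ k" by (induction k) auto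
  then have "real (Suc k) \<le> 4 ^ k" by (metis of_nat_le_iff of_nat_numeral of_nat_power)
  then have "exp (- (4 ^ k)) \<le> exp (- real (Suc k))" by simp
  also have "\<dots> = exp (real (Suc k) * (- 1))" by simp
  also have "\<dots> = exp (- 1) ^ Suc k" by (rule exp_of_nat_mult)
  also have "\<dots> \<le> (1 / 2) ^ Suc k"
  proof (rule power_mono)
    show "exp (- 1) \<le> (1 / 2 :: real)" using exp_ge_add_one_self[of 1] by (simp add: exp_minus field_simps)
  qed simp
  finally show ?thesis .
qed

section \<open>Empty volume against the entropy of coarse walks\<close>

text \<open>Per step: \<open>d * ln 3\<close> for the choice of the next cell, and
  \<open>ln 2\<close> for each of the \<open>(2 * d + 3) ^ d\<close> nearby cells, which may or may
  not belong to the set of empty cubes. The summand 1 keeps the constant at least 1.\<close>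

definition entropy_const :: "'a::euclidean_space itself \<Rightarrow> real" where
  "entropy_const _ = 1 + DIM('a) * ln 3 + (2 * DIM('a) + 3) ^ DIM('a) * ln 2"

context poisson_nuclei
begin

text \<open>The least cardinality that violates \<open>sparse_holes\<close>. It never drops below 1,
  so even when the quotient vanishes a violation costs a whole cube of side
  \<open>K * 4 ^ k\<close>; without that the scales could not be summed.\<close>

definition hole_threshold :: "nat \<Rightarrow> nat \<Rightarrow> nat" where
  "hole_threshold k m = m div (4 * fill_const TYPE('a) * 2 ^ k * 4 ^ (k * DIM('a))) + 1"

text \<open>A violating set contains a subset of exactly the threshold size, so the union bound may
  be restricted to sets of one cardinality and every configuration has the same cost.\<close>

definition hole_configs :: "nat \<Rightarrow> nat \<Rightarrow> (('a \<Rightarrow> int) list \<times> ('a \<Rightarrow> int) set) set" where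
  "hole_configs k m = (SIGMA V:walks origin_cell (2 * m div 4 ^ k).
     {T. T \<subseteq> (\<Union>v\<in>set V. nbhd (int DIM('a) + 1) v) \<and> card T = hole_threshold k m})"

definition hole_event :: "real \<Rightarrow> nat \<Rightarrow> nat \<Rightarrow> 'w set" where
  "hole_event K k m = (\<Union>(V, T)\<in>hole_configs k m.
     {\<omega> \<in> space M. \<forall>q\<in>T. cube (K * 4 ^ k) q \<inter> N \<omega> = {}})"

lemma not_sparse_holes_imp:
  assumes "\<omega> \<in> space M" "\<not> sparse_holes (N \<omega>) K m"
  shows "\<exists>k. \<omega> \<in> hole_event K k m"
proof -
  obtain k V T where V: "V \<in> walks origin_cell (2 * m div 4 ^ k)"
    and T: "T \<subseteq> (\<Union>v\<in>set V. nbhd (int DIM('a) + 1) v)" "\<forall>q\<in>T. cube (K * 4 ^ k) q \<inter> N \<omega> = {}"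
    and c: "\<not> 4 * fill_const TYPE('a) * 2 ^ k * 4 ^ (k * DIM('a)) * card T \<le> m"
    using assms(2) unfolding sparse_holes_def by blast
  let ?D = "4 * fill_const TYPE('a) * 2 ^ k * 4 ^ (k * DIM('a))"
  have "m div ?D < card T"
  proof (rule ccontr)
    assume "\<not> m div ?D < card T"
    then have "?D * card T \<le> ?D * (m div ?D)" by (intro mult_left_mono) auto
    also have "\<dots> \<le> m" by simp
    finally show False using c by simp
  qed
  then obtain U where U: "U \<subseteq> T" "card U = hole_threshold k m"
    by (metis Suc_eq_plus1 Suc_leI hole_threshold_def obtain_subset_with_card_n)
  then have "(V, U) \<in> hole_configs k m" using V T by (auto simp: hole_configs_def)
  moreover have "\<forall>q\<in>U. cube (K * 4 ^ k) q \<inter> N \<omega> = {}" using U(1) T(2) by blast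
  ultimately show ?thesis using assms(1) unfolding hole_event_def by blast
qed

lemma hole_configs_finite: "finite (hole_configs k m)"
  and card_hole_configs: "card (hole_configs k m) \<le>
    (3 ^ DIM('a)) ^ (2 * m div 4 ^ k) * 2 ^ (Suc (2 * m div 4 ^ k) * (2 * DIM('a) + 3) ^ DIM('a))"
proof -
  let ?L = "2 * m div 4 ^ k" and ?d = "DIM('a)"
  let ?U = "\<lambda>V. \<Union>v\<in>set V. nbhd (int ?d + 1) (v :: 'a \<Rightarrow> int)"
  let ?T = "\<lambda>V. {T. T \<subseteq> ?U V \<and> card T = hole_threshold k m}"
  have W: "finite (walks origin_cell ?L :: ('a \<Rightarrow> int) list set)"
    "card (walks origin_cell ?L :: ('a \<Rightarrow> int) list set) \<le> (3 ^ ?d) ^ ?L"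
    using card_walks by auto
  have fT: "finite (?T V)" for V by (rule finite_subset[of _ "Pow (?U V)"]) auto
  have cT: "card (?T V) \<le> 2 ^ (Suc ?L * (2 * ?d + 3) ^ ?d)" if "V \<in> walks origin_cell ?L" for V
  proof -
    have "card (?U V) \<le> (\<Sum>v\<in>set V. card (nbhd (int ?d + 1) v))" by (rule card_UN_le) simp
    also have "\<dots> = card (set V) * (2 * ?d + 3) ^ ?d"
      by (simp add: card_nbhd nat_add_distrib nat_mult_distrib algebra_simps)
    also have "\<dots> \<le> Suc ?L * (2 * ?d + 3) ^ ?d"
      using card_length[of V] that by (intro mult_right_mono) (auto simp: walks_def)
    finally have cU: "card (?U V) \<le> Suc ?L * (2 * ?d + 3) ^ ?d" .
    have "card (?T V) \<le> card (Pow (?U V))" by (intro card_mono) auto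
    also have "\<dots> = 2 ^ card (?U V)" by (intro card_Pow) simp
    also have "\<dots> \<le> 2 ^ (Suc ?L * (2 * ?d + 3) ^ ?d)" using cU by (intro power_increasing) auto
    finally show ?thesis .
  qed
  show "finite (hole_configs k m)"
    unfolding hole_configs_def using W fT by (intro finite_SigmaI) auto
  have "card (hole_configs k m) = (\<Sum>V\<in>walks origin_cell ?L. card (?T V))"
    unfolding hole_configs_def using W fT by (intro card_SigmaI) auto
  also have "\<dots> \<le> card (walks origin_cell ?L :: ('a \<Rightarrow> int) list set) * 2 ^ (Suc ?L * (2 * ?d + 3) ^ ?d)"
    using sum_bounded_above[of "walks origin_cell ?L" "\<lambda>V. card (?T V)"] cT by simp
  also have "\<dots> \<le> (3 ^ ?d) ^ ?L * 2 ^ (Suc ?L * (2 * ?d + 3) ^ ?d)"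
    using W by (intro mult_right_mono) auto
  finally show "card (hole_configs k m) \<le> (3 ^ ?d) ^ ?L * 2 ^ (Suc ?L * (2 * ?d + 3) ^ ?d)" .
qed

lemma hole_event_sets:
  assumes "K > 0" shows "hole_event K k m \<in> events"
proof -
  have "finite T" if "(V, T) \<in> hole_configs k m" for V T
    using that by (auto simp: hole_configs_def elim!: finite_subset)
  then show ?thesis
    unfolding hole_event_def using assms
    by (intro sets.finite_UN hole_configs_finite) (auto intro!: empty_cubes_event)
qed



text \<open>A union bound over configurations. The walk has \<open>?L \<le> 2 * m / 4 ^ k\<close>
  steps, while the empty volume, in units of \<open>K ^ d\<close>, is at least
  \<open>m / (4 * ?F * 2 ^ k)\<close>. A large \<open>K\<close> makes the cost per unit of volume
  exceed the entropy at all scales at once.\<close>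

lemma prob_hole_event_le:
  assumes K: "K > 0" and m: "m \<ge> 1"
    and large: "32 * real (fill_const TYPE('a)) * entropy_const TYPE('a) \<le> K ^ DIM('a) / c"
  shows "prob (hole_event K k m) \<le> exp (- (real m powr (1 / 3))) * (1 / 2) ^ Suc k"
proof -
  let ?d = "DIM('a)" and ?L = "2 * m div 4 ^ k"
  let ?F = "real (fill_const TYPE('a))" and ?a = "entropy_const TYPE('a)"
  let ?t = "hole_threshold k m" and ?l = "K ^ ?d / c"
  have s: "K * 4 ^ k > 0" using K by simp
  have a1: "?a \<ge> 1" by (simp add: entropy_const_def)
  have "1 \<le> (18 * ?d + 3) ^ ?d" by (rule one_le_power) simp
  then have F1: "?F \<ge> 1" unfolding fill_const_def by (metis of_nat_1 of_nat_le_iff)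
  define p where "p = exp (- (real ?t * (K * 4 ^ k) ^ ?d / c))"
  have T: "finite T \<and> T \<subseteq> extensional Basis \<and> card T = ?t" if VT: "(V, T) \<in> hole_configs k m" for V T
    using VT by (auto simp: hole_configs_def dest: nbhd_extensional elim!: finite_subset)
  have "prob (hole_event K k m) \<le> (\<Sum>x\<in>hole_configs k m.
      prob (case x of (V, T) \<Rightarrow> {\<omega> \<in> space M. \<forall>q\<in>T. cube (K * 4 ^ k) q \<inter> N \<omega> = {}}))"
    unfolding hole_event_def
    by (intro finite_measure_subadditive_finite hole_configs_finite)
      (use s T in \<open>auto intro!: empty_cubes_event\<close>)
  also have "\<dots> \<le> (\<Sum>x\<in>hole_configs k m. p)"
  proof (intro sum_mono)
    fix x assume x: "x \<in> hole_configs k m"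
    obtain V U where VU: "x = (V, U)" by (cases x)
    then have U: "finite U" "U \<subseteq> extensional Basis" "card U = ?t" using T x by blast+
    show "prob (case x of (V, T) \<Rightarrow> {\<omega> \<in> space M. \<forall>q\<in>T. cube (K * 4 ^ k) q \<inter> N \<omega> = {}}) \<le> p"
      using prob_empty_cubes[OF s U(1,2)] by (simp add: VU U(3) p_def)
  qed
  also have "\<dots> = real (card (hole_configs k m)) * p" by simp
  also have "\<dots> \<le> exp (?a * (?L + 1)) * p"
  proof (rule mult_right_mono)
    have "real (card (hole_configs k m)) \<le> real ((3 ^ ?d) ^ ?L * 2 ^ (Suc ?L * (2 * ?d + 3) ^ ?d))"
      by (simp only: of_nat_le_iff card_hole_configs)
    also have "\<dots> = exp (real ?L * (?d * ln 3)) * exp (real (Suc ?L) * (real ((2 * ?d + 3) ^ ?d) * ln 2))"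
      unfolding exp_of_nat_mult
      by (subst mult.commute[of "Suc ?L"]) (simp add: power_mult del: power_Suc mult_Suc_right)
    also have "\<dots> = exp (real ?L * (?d * ln 3) + real (Suc ?L) * (real ((2 * ?d + 3) ^ ?d) * ln 2))"
      by (simp only: exp_add)
    also have "\<dots> \<le> exp (?a * (?L + 1))"
    proof -
      have "?L * (?d * ln 3) \<le> (?L + 1) * (?d * ln (3::real))" by (intro mult_right_mono) auto
      then show ?thesis by (simp add: entropy_const_def algebra_simps)
    qed
    finally show "real (card (hole_configs k m)) \<le> exp (?a * (?L + 1))" .
  qed (simp add: p_def)
  also have "\<dots> = exp (?a * (?L + 1) - ?l * (real ?t * 4 ^ (k * ?d)))"
    by (simp add: p_def exp_diff exp_minus field_simps power_mult_distrib power_mult)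
  also have "\<dots> \<le> exp (- (real m powr (1 / 3)) - 4 ^ k)"
  proof -
    define y where "y = m / 2 ^ k"
    define u where "u = real ?t * 4 ^ (k * ?d)"
    have y0: "y \<ge> 0" by (simp add: y_def)
    have "real ?L \<le> 2 * m / 4 ^ k" using of_nat_div_le_of_nat[of "2 * m" "4 ^ k", where 'a = real] by simp
    also have "\<dots> \<le> 2 * m / 2 ^ k" by (intro divide_left_mono power_mono) auto
    finally have L: "real ?L \<le> 2 * y" by (simp add: y_def)
    let ?D = "4 * fill_const TYPE('a) * 2 ^ k * 4 ^ (k * ?d)"
    have "?D > 0" using F1 by (simp add: fill_const_def)
    then have "m < ?D * ?t"
      unfolding hole_threshold_def by (metis Suc_eq_plus1 dividend_less_times_div mult_Suc_right add.commute)
    then have "real m \<le> real (?D * ?t)" by (simp only: of_nat_le_iff less_imp_le)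
    then have u1: "y \<le> 4 * ?F * u" by (simp add: y_def u_def field_simps)
    have "(4::real) ^ k \<le> 4 ^ (k * ?d)" by (intro power_increasing) auto
    moreover have "1 * 4 ^ (k * ?d) \<le> u" unfolding u_def
      by (intro mult_right_mono) (auto simp: hole_threshold_def)
    ultimately have u2: "4 ^ k \<le> u" by linarith
    then have u0: "u \<ge> 0" by (smt (verit) zero_le_power)
    \<comment> \<open>Half of \<open>32 * ?F * ?a * u\<close> is at least \<open>4 * ?a * y\<close>,
      the other half at least \<open>16 * ?a * 4 ^ k\<close>. After paying the entropy, at most
      \<open>2 * ?a * y + ?a * 4 ^ k\<close>, there remains more than
      \<open>y + 4 ^ k + 4 ^ k\<close>: the first two terms yield the cube root of \<open>m\<close>,
      the last one the summability in \<open>k\<close>.\<close>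
    have "32 * ?F * ?a * u \<le> ?l * u" using large u0 by (intro mult_right_mono) auto
    moreover have "4 * ?a * y \<le> 4 * ?a * (4 * ?F * u)" using u1 a1 by (intro mult_left_mono) auto
    moreover have "16 * ?a * 4 ^ k \<le> 16 * ?a * (?F * u)"
      using u2 F1 a1 u0 mult_mono[of 1 ?F "4 ^ k" u] by (intro mult_left_mono) auto
    moreover have "?a * (?L + 1) \<le> ?a * (2 * y + 1)" using L a1 by (intro mult_left_mono) auto
    moreover have "?a * 1 \<le> ?a * 4 ^ k" using a1 by (intro mult_left_mono) auto
    moreover have "1 * (y + 4 ^ k + 4 ^ k) \<le> ?a * (y + 4 ^ k + 4 ^ k)"
      using a1 y0 by (intro mult_right_mono) auto
    moreover have "0 \<le> ?a * y" "0 \<le> ?a * 4 ^ k" using a1 y0 by auto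
    ultimately have "?a * (?L + 1) - ?l * u \<le> - (y + 4 ^ k + 4 ^ k)"
      by (simp add: algebra_simps)
    moreover have "real m powr (1 / 3) \<le> y + 4 ^ k" unfolding y_def by (rule cube_root_le[OF m])
    ultimately show ?thesis unfolding u_def by simp
  qed
  also have "\<dots> = exp (- (real m powr (1 / 3))) * exp (- (4 ^ k))" by (simp flip: exp_add)
  also have "\<dots> \<le> exp (- (real m powr (1 / 3))) * (1 / 2) ^ Suc k"
    by (intro mult_left_mono exp_neg_power4_le) auto
  finally show ?thesis .
qed

lemma prob_hole_events_le:
  assumes K: "K > 0" and m: "m \<ge> 1"
    and large: "32 * real (fill_const TYPE('a)) * entropy_const TYPE('a) \<le> K ^ DIM('a) / c"
  shows "prob (\<Union>k. hole_event K k m) \<le> exp (- (real m powr (1 / 3)))"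
proof -
  let ?e = "exp (- (real m powr (1 / 3)))"
  have s: "(\<lambda>k. ?e * (1 / 2) ^ Suc k) sums (?e * 1)"
    by (intro sums_mult power_half_series)
  have "prob (\<Union>k. hole_event K k m) \<le> (\<Sum>k. prob (hole_event K k m))"
    using hole_event_sets[OF K] prob_hole_event_le[OF assms]
    by (intro finite_measure_subadditive_countably)
      (auto intro!: summable_comparison_test'[OF sums_summable[OF s], of 0])
  also have "\<dots> \<le> (\<Sum>k. ?e * (1 / 2) ^ Suc k)"
    using prob_hole_event_le[OF assms] sums_summable[OF s]
    by (intro suminf_le) (auto intro!: summable_comparison_test'[OF sums_summable[OF s], of 0])
  also have "\<dots> = ?e" using sums_unique[OF s] by simp
  finally show ?thesis .
qed

section \<open>Numbers of points along a walk\<close>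

text \<open>The event that some walk has a sum of logarithms of factorials of at least
  \<open>H * m\<close>, written in the form to which Markov's inequality applies; the 1/2 in the
  exponent matches the square root in \<open>root_fact\<close>.\<close>

definition point_event :: "real \<Rightarrow> real \<Rightarrow> nat \<Rightarrow> 'w set" where
  "point_event K H m = (\<Union>V\<in>walks origin_cell (2 * m). {\<omega> \<in> space M.
     1 \<le> ennreal (exp (- (H * m / 2))) * (\<Prod>z\<in>set V. root_fact (num_points (N \<omega>) (cube K z)))})"

lemma point_event_sets:
  assumes "K > 0" shows "point_event K H m \<in> events"
proof -
  have [measurable]: "(\<lambda>\<omega>. num_points (N \<omega>) (cube K z)) \<in> borel_measurable M" for z
    using assms by (intro num_points_measurable) simp
  show ?thesis unfolding point_event_def using card_walks by (intro sets.finite_UN) auto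
qed

lemma not_few_points_imp:
  assumes w: "\<omega> \<in> space M" and fin: "\<And>z. finite (N \<omega> \<inter> cube K z)" and "\<not> few_points (N \<omega>) K H m"
  shows "\<omega> \<in> point_event K H m"
proof -
  obtain V where V: "V \<in> walks origin_cell (2 * m)"
    "(\<Sum>z\<in>set V. ln (fact (card (N \<omega> \<inter> cube K z)))) > H * m"
    using assms by (auto simp: few_points_def not_le)
  let ?X = "\<lambda>z. card (N \<omega> \<inter> cube K z)"
  have "(\<Prod>z\<in>set V. root_fact (num_points (N \<omega>) (cube K z))) = (\<Prod>z\<in>set V. ennreal (sqrt (fact (?X z))))"
    using fin by (simp add: num_points_eq root_fact_of_nat)
  also have "\<dots> = ennreal (\<Prod>z\<in>set V. sqrt (fact (?X z)))" by (rule prod_ennreal) simp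
  also have "(\<Prod>z\<in>set V. sqrt (fact (?X z))) = exp ((\<Sum>z\<in>set V. ln (fact (?X z))) / 2)"
    by (simp add: sum_divide_distrib exp_sum ln_sqrt[symmetric])
  finally have "ennreal (exp (- (H * m / 2))) * (\<Prod>z\<in>set V. root_fact (num_points (N \<omega>) (cube K z))) =
      ennreal (exp ((\<Sum>z\<in>set V. ln (fact (?X z))) / 2 - H * m / 2))"
    by (simp add: exp_add[symmetric] flip: ennreal_mult)
  also have "\<dots> \<ge> ennreal 1" using V(2) by (intro ennreal_leI) simp
  finally show ?thesis using w V(1) by (auto simp: point_event_def)
qed

text \<open>\<open>H\<close> is made of the parts to be paid for: there are at most
  \<open>(3 ^ d) ^ (2 * m)\<close> walks, each visits at most \<open>2 * m + 1 \<le> 3 * m\<close>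
  cells with a mean factor of at most \<open>r\<close>, and a surplus of 1 leaves
  \<open>exp (- m)\<close>. The leading 2 compensates for the square root.\<close>

lemma prob_point_event_le:
  assumes K: "K > 0" and m: "m \<ge> 1" and r: "r = (\<Sum>k. (c * K ^ DIM('a)) ^ k / sqrt (fact k))"
    and H: "H = 2 * (2 * DIM('a) * ln 3 + 3 * ln r + 1)"
  shows "prob (point_event K H m) \<le> exp (- real m)" "r \<ge> 1"
proof -
  let ?W = "walks origin_cell (2 * m) :: ('a \<Rightarrow> int) list set"
  let ?P = "\<lambda>V \<omega>. \<Prod>z\<in>set V. root_fact (num_points (N \<omega>) (cube K z))"
  let ?E = "\<lambda>V. {\<omega> \<in> space M. 1 \<le> ennreal (exp (- (H * m / 2))) * ?P V \<omega>}"
  have [measurable]: "(\<lambda>\<omega>. num_points (N \<omega>) (cube K z)) \<in> borel_measurable M" for z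
    using K by (intro num_points_measurable) simp
  have cK: "c * K ^ DIM('a) \<ge> 0" using K c_pos by simp
  have "(\<Sum>k\<in>{0}. (c * K ^ DIM('a)) ^ k / sqrt (fact k)) \<le> r"
    unfolding r using cK by (intro sum_le_suminf summable_pow_div_root_fact) auto
  then show r1: "r \<ge> 1" by simp
  have "prob (?E V) \<le> exp (- (H * m / 2)) * r ^ (3 * m)" if V: "V \<in> ?W" for V
  proof -
    have "emeasure M (?E V) \<le> ennreal (exp (- (H * m / 2))) * (\<integral>\<^sup>+\<omega>. ?P V \<omega> * indicator (space M) \<omega> \<partial>M)"
      by (rule nn_integral_Markov_inequality) auto
    also have "(\<integral>\<^sup>+\<omega>. ?P V \<omega> * indicator (space M) \<omega> \<partial>M) = (\<integral>\<^sup>+\<omega>. ?P V \<omega> \<partial>M)"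
      by (intro nn_integral_cong) auto
    also have "\<dots> \<le> ennreal r ^ card (set V)"
      unfolding r using walks_extensional[OF _ V] by (intro nn_integral_prod_root_fact_le K) auto
    also have "\<dots> \<le> ennreal r ^ (3 * m)"
    proof (rule power_increasing)
      show "card (set V) \<le> 3 * m" using card_length[of V] V m by (simp add: walks_def)
      show "1 \<le> ennreal r" using r1 by simp
    qed
    finally have "emeasure M (?E V) \<le> ennreal (exp (- (H * m / 2)) * r ^ (3 * m))"
      using r1 by (simp add: mult_left_mono ennreal_mult ennreal_power)
    then show ?thesis using r1 by (simp add: emeasure_eq_measure)
  qed
  then have "(\<Sum>V\<in>?W. prob (?E V)) \<le> (\<Sum>V\<in>?W. exp (- (H * m / 2)) * r ^ (3 * m))" by (rule sum_mono)
  moreover have "prob (point_event K H m) \<le> (\<Sum>V\<in>?W. prob (?E V))"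
    unfolding point_event_def using card_walks by (intro finite_measure_subadditive_finite) auto
  moreover have "(\<Sum>V\<in>?W. exp (- (H * m / 2)) * r ^ (3 * m)) \<le> (3 ^ DIM('a)) ^ (2 * m) * (exp (- (H * m / 2)) * r ^ (3 * m))"
  proof -
    have "real (card ?W) \<le> real ((3 ^ DIM('a)) ^ (2 * m))" by (simp only: of_nat_le_iff card_walks)
    then show ?thesis using r1 by (simp add: mult_right_mono)
  qed
  moreover have "(3 ^ DIM('a)) ^ (2 * m) * (exp (- (H * m / 2)) * r ^ (3 * m)) = exp (- real m)"
  proof -
    have "(3::real) ^ DIM('a) = exp (DIM('a) * ln 3)" by (simp add: exp_of_nat_mult)
    then have "((3::real) ^ DIM('a)) ^ (2 * m) = exp (real (2 * m) * (DIM('a) * ln 3))"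
      by (simp add: exp_of_nat_mult del: of_nat_mult)
    moreover have "r ^ (3 * m) = exp (real (3 * m) * ln r)"
      using r1 by (simp add: exp_of_nat_mult del: of_nat_mult)
    ultimately show ?thesis by (simp add: H algebra_simps flip: exp_add)
  qed
  ultimately show "prob (point_event K H m) \<le> exp (- real m)" by linarith
qed

lemma AE_locally_finite:
  assumes "K > 0" shows "AE \<omega> in M. \<forall>z. finite (N \<omega> \<inter> cube K z)"
proof -
  have "AE \<omega> in M. \<forall>z\<in>extensional Basis. finite (N \<omega> \<inter> cube K z)"
  proof (rule AE_ball_countable'[rotated])
    have "countable (PiE (Basis :: 'a set) (\<lambda>_. UNIV :: int set))" by (intro countable_PiE) auto
    then show "countable (extensional Basis :: ('a \<Rightarrow> int) set)" by (simp add: PiE_def)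
    fix z :: "'a \<Rightarrow> int" assume z: "z \<in> extensional Basis"
    have b: "cube K z \<in> sets borel" using assms by (rule cube_borel)
    have "AE \<omega> in M. num_points (N \<omega>) (cube K z) \<in> range of_nat"
      using AE_num_points_nat[OF b] mu_bounds(1)[OF b emeasure_cube] assms z by simp
    then show "AE \<omega> in M. finite (N \<omega> \<inter> cube K z)"
      by eventually_elim (auto simp: num_points_eq split: if_splits)
  qed
  then show ?thesis
  proof eventually_elim
    case (elim \<omega>)
    have "cube K z = {}" if "z \<notin> extensional Basis" for z :: "'a \<Rightarrow> int"
      using that cell_extensional by blast
    then show ?case using elim by (metis Int_empty_right finite.emptyI)
  qed
qed

text \<open>\<open>K\<close> and \<open>H\<close> serve all \<open>m\<close> at once. The failure
  set need not be an event, so it is enclosed in \<open>B\<close>, which also absorbs the null set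
  where some cube contains infinitely many nuclei.\<close>

lemma good_event:
  "\<exists>K>0. \<exists>H\<ge>0. \<forall>m\<ge>1. \<exists>B\<in>events. prob B \<le> 2 * exp (- (real m powr (1 / 3))) \<and>
    (\<forall>\<omega>\<in>space M - B. sparse_holes (N \<omega>) K m \<and> few_points (N \<omega>) K H m)"
proof -
  \<comment> \<open>The maximum with 1 gives \<open>K \<le> K ^ d\<close>, so that a lower bound on
    \<open>K\<close> is also one on the volume of the cube.\<close>
  define K where "K = max 1 (c * (32 * real (fill_const TYPE('a)) * entropy_const TYPE('a)))"
  define r where "r = (\<Sum>k. (c * K ^ DIM('a)) ^ k / sqrt (fact k))"
  define H where "H = 2 * (2 * DIM('a) * ln 3 + 3 * ln r + 1)"
  have K: "K > 0" by (simp add: K_def)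
  have "K ^ 1 \<le> K ^ DIM('a)" by (intro power_increasing) (auto simp: K_def Suc_le_eq)
  moreover have "c * (32 * real (fill_const TYPE('a)) * entropy_const TYPE('a)) \<le> K" by (simp add: K_def)
  ultimately have large: "32 * real (fill_const TYPE('a)) * entropy_const TYPE('a) \<le> K ^ DIM('a) / c"
    using c_pos by (simp add: pos_le_divide_eq mult.commute)
  have "r \<ge> 1" using prob_point_event_le(2)[OF K _ r_def H_def, of 1] by simp
  then have H: "H \<ge> 0" by (simp add: H_def)
  obtain Z where Z: "Z \<in> null_sets M" "{\<omega> \<in> space M. \<not> (\<forall>z. finite (N \<omega> \<inter> cube K z))} \<subseteq> Z"
    using AE_locally_finite[OF K] by (auto simp: eventually_ae_filter)
  show ?thesis
  proof (rule exI[of _ K], intro conjI K, rule exI[of _ H], intro conjI H allI impI)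
    fix m :: nat assume m: "m \<ge> 1"
    let ?B1 = "\<Union>k. hole_event K k m" and ?B2 = "point_event K H m"
    have sets: "?B1 \<in> events" "?B2 \<in> events" "Z \<in> events"
      using hole_event_sets[OF K] point_event_sets[OF K] Z by auto
    have "prob (?B1 \<union> ?B2 \<union> Z) \<le> prob ?B1 + prob ?B2 + prob Z"
      using sets measure_Un_le[of "?B1 \<union> ?B2" M Z] measure_Un_le[of ?B1 M ?B2] by auto
    moreover have "prob ?B1 \<le> exp (- (real m powr (1 / 3)))" by (rule prob_hole_events_le[OF K m large])
    moreover have "prob ?B2 \<le> exp (- real m)" by (rule prob_point_event_le(1)[OF K m r_def H_def])
    moreover have "exp (- real m) \<le> exp (- (real m powr (1 / 3)))"
      using powr_mono[of "1 / 3" 1 "real m"] m by simp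
    moreover have "prob Z = 0" using Z(1) by (simp add: measure_eq_0_null_sets)
    ultimately have "prob (?B1 \<union> ?B2 \<union> Z) \<le> 2 * exp (- (real m powr (1 / 3)))" by linarith
    moreover have "sparse_holes (N \<omega>) K m \<and> few_points (N \<omega>) K H m" if "\<omega> \<in> space M - (?B1 \<union> ?B2 \<union> Z)" for \<omega>
      using that not_sparse_holes_imp[of \<omega> K m] not_few_points_imp[of \<omega> K H m] Z(2) by blast
    ultimately show "\<exists>B\<in>events. prob B \<le> 2 * exp (- (real m powr (1 / 3))) \<and>
        (\<forall>\<omega>\<in>space M - B. sparse_holes (N \<omega>) K m \<and> few_points (N \<omega>) K H m)"
      using sets by (intro bexI[of _ "?B1 \<union> ?B2 \<union> Z"]) auto
  qed
qed

end

section \<open>Geometry of Voronoi tiles\<close>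

definition locally_finite :: "'a::euclidean_space set \<Rightarrow> bool" where
  "locally_finite N \<longleftrightarrow> (\<forall>r. finite (N \<inter> cball 0 r))"

lemma dist_le_iff_inner:
  fixes x u w :: "'a::euclidean_space"
  shows "dist x u \<le> dist x w \<longleftrightarrow> (w - u) \<bullet> x \<le> (w \<bullet> w - u \<bullet> u) / 2"
proof -
  have "dist x u \<le> dist x w \<longleftrightarrow> (dist x u)\<^sup>2 \<le> (dist x w)\<^sup>2" by (simp add: abs_le_square_iff[symmetric])
  also have "\<dots> \<longleftrightarrow> (w - u) \<bullet> x \<le> (w \<bullet> w - u \<bullet> u) / 2"
    by (simp add: dist_norm power2_norm_eq_inner inner_diff inner_commute algebra_simps)
  finally show ?thesis .
qed

lemma dist_eq_iff_inner:
  fixes x u w :: "'a::euclidean_space"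
  shows "dist x u = dist x w \<longleftrightarrow> (w - u) \<bullet> x = (w \<bullet> w - u \<bullet> u) / 2"
  using dist_le_iff_inner[of x u w] dist_le_iff_inner[of x w u]
  by (auto simp: inner_diff algebra_simps)

lemma voronoi_tile_eq:
  "voronoi_tile N u = (\<Inter>w\<in>N. {x. (w - u) \<bullet> x \<le> (w \<bullet> w - u \<bullet> u) / 2})"
  by (auto simp: voronoi_tile_def dist_le_iff_inner)

lemma convex_voronoi_tile: "convex (voronoi_tile N u)"
  unfolding voronoi_tile_eq by (intro convex_INT convex_halfspace_le)

lemma closed_voronoi_tile: "closed (voronoi_tile N u)"
  unfolding voronoi_tile_eq by (intro closed_INT ballI closed_halfspace_le)

lemma voronoi_tile_Int:
  assumes "u \<in> N" "v \<in> N"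
  shows "voronoi_tile N u \<inter> voronoi_tile N v = voronoi_tile N u \<inter> {x. (v - u) \<bullet> x = (v \<bullet> v - u \<bullet> u) / 2}"
  unfolding dist_eq_iff_inner[symmetric]
  using assms by (auto simp: voronoi_tile_def intro: antisym)

lemma voronoi_tile_Int_face:
  assumes "u \<in> N" "v \<in> N"
  shows "(voronoi_tile N u \<inter> voronoi_tile N v) face_of voronoi_tile N u"
  unfolding voronoi_tile_Int[OF assms]
  by (rule face_of_Int_supporting_hyperplane_le[OF convex_voronoi_tile])
    (use assms in \<open>auto simp: voronoi_tile_eq\<close>)

lemma aff_dim_bisector:
  fixes u v :: "'a::euclidean_space"
  assumes "u \<noteq> v" shows "aff_dim {x. (v - u) \<bullet> x = r} = int (DIM('a)) - 1"
  using assms by (simp add: aff_dim_hyperplane)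

text \<open>The intersection of two tiles is cut out of each by their bisector, a supporting
  hyperplane, so it is a face of both and contains every other common face. The bisector also caps
  its dimension at \<open>d - 1\<close>, so only the lower bound has to be tested.\<close>

lemma delaunay_adj_iff_aff_dim:
  fixes N :: "'a::euclidean_space set"
  assumes uv: "u \<in> N" "v \<in> N" "u \<noteq> v"
  shows "delaunay_adj N u v \<longleftrightarrow> aff_dim (voronoi_tile N u \<inter> voronoi_tile N v) \<ge> int (DIM('a)) - 1"
proof
  assume "delaunay_adj N u v"
  then obtain F where F: "F face_of voronoi_tile N u" "F face_of voronoi_tile N v"
    "aff_dim F = int (DIM('a)) - 1" by (auto simp: delaunay_adj_def)
  have "F \<subseteq> voronoi_tile N u \<inter> voronoi_tile N v" using F face_of_imp_subset by blast
  from aff_dim_subset[OF this] show "aff_dim (voronoi_tile N u \<inter> voronoi_tile N v) \<ge> int (DIM('a)) - 1"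
    using F by simp
next
  let ?F = "voronoi_tile N u \<inter> voronoi_tile N v"
  assume ge: "aff_dim ?F \<ge> int (DIM('a)) - 1"
  have "aff_dim ?F \<le> aff_dim {x. (v - u) \<bullet> x = (v \<bullet> v - u \<bullet> u) / 2}"
    unfolding voronoi_tile_Int[OF uv(1,2)] by (intro aff_dim_subset) auto
  then have "aff_dim ?F = int (DIM('a)) - 1" using ge aff_dim_bisector[OF uv(3)] by (metis antisym)
  moreover have "?F face_of voronoi_tile N u" by (rule voronoi_tile_Int_face[OF uv(1,2)])
  moreover have "?F face_of voronoi_tile N v"
    using voronoi_tile_Int_face[OF uv(2,1)] by (simp add: Int_commute)
  ultimately show "delaunay_adj N u v" using uv by (auto simp: delaunay_adj_def)
qed

text \<open>Nuclei of norm above \<open>2 * norm x + norm w\<close> are farther from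
  \<open>x\<close> than \<open>w\<close> is, which leaves a finite minimisation. The norm bound
  shows that finitely many tiles cover a bounded set.\<close>

lemma nearest_point_exists:
  assumes "locally_finite N" "w \<in> N"
  shows "\<exists>v\<in>N. x \<in> voronoi_tile N v \<and> norm v \<le> 2 * norm x + norm w"
proof -
  let ?A = "N \<inter> cball 0 (2 * norm x + norm w)"
  have fin: "finite ?A" using assms(1) by (simp add: locally_finite_def)
  have w: "w \<in> ?A" using assms(2) by simp
  then have "\<exists>v. is_arg_min (dist x) (\<lambda>v. v \<in> ?A) v" using ex_is_arg_min_if_finite[OF fin] by blast
  then obtain v where v: "v \<in> ?A" "\<And>y. y \<in> ?A \<Longrightarrow> dist x v \<le> dist x y"
    unfolding is_arg_min_linorder by blast
  have "dist x v \<le> dist x y" if "y \<in> N" for y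
  proof (cases "y \<in> ?A")
    case False
    then have "norm y > 2 * norm x + norm w" using that by auto
    moreover have "norm y \<le> dist x y + norm x"
      using norm_triangle_sub[of y x] by (simp add: dist_norm norm_minus_commute)
    moreover have "dist x w \<le> norm x + norm w" by (simp add: dist_norm norm_triangle_ineq4)
    ultimately show ?thesis using v(2)[OF w] by linarith
  qed (use v in auto)
  then show ?thesis using v(1) by (auto simp: voronoi_tile_def)
qed

text \<open>A generic segment from \<open>u0\<close> avoids all intersections of tiles of dimension below \<open>d - 1\<close>,
  because the cones over them with apex \<open>u0\<close> are null sets.\<close>

lemma delaunay_cut:
  fixes N :: "'a::euclidean_space set"
  assumes lf: "locally_finite N" and S: "S \<subseteq> N" "finite S" "S \<noteq> {}" and ne: "N - S \<noteq> {}"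
  shows "\<exists>u\<in>S. \<exists>w\<in>N - S. delaunay_adj N u w"
proof (rule ccontr)
  assume no: "\<not> ?thesis"
  obtain u0 w0 where u0: "u0 \<in> S" and w0: "w0 \<in> N - S" using S ne by blast
  let ?T = "\<lambda>p. voronoi_tile N (fst p) \<inter> voronoi_tile N (snd p)"
  let ?C = "\<lambda>p. affine hull (insert u0 (?T p))"
  have "N = (\<Union>n::nat. N \<inter> cball 0 n)" using real_arch_simple by fastforce
  then have "countable N"
    using lf by (metis countable_UN countable_finite locally_finite_def countableI_type)
  then have cnt: "countable (S \<times> (N - S))" using S by (intro countable_SIGMA) (auto intro: countable_finite)
  have "negligible (?C p)" if p: "p \<in> S \<times> (N - S)" for p
  proof -
    have "\<not> delaunay_adj N (fst p) (snd p)" using p no by auto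
    then have "aff_dim (?T p) < int (DIM('a)) - 1"
      using p S delaunay_adj_iff_aff_dim[of "fst p" N "snd p"] by fastforce
    then have "aff_dim (?C p) < int DIM('a)" by (simp add: aff_dim_insert)
    then obtain a b where "a \<noteq> 0" "?C p \<subseteq> {x. a \<bullet> x = b}" by (rule aff_lowdim_subset_hyperplane)
    then show ?thesis using negligible_hyperplane negligible_subset by blast
  qed
  then have neg: "negligible (\<Union>p\<in>S \<times> (N - S). ?C p)" using cnt by (intro negligible_countable_Union) auto
  \<comment> \<open>Points of \<open>G\<close> are nearer to \<open>w0\<close> than to all of
    \<open>S\<close>, hence in no tile of \<open>S\<close>. As a nonempty open set, \<open>G\<close>
    is not covered by the null cones, so the far end \<open>q\<close> of the segment can be taken in
    it and generic.\<close>
  define G where "G = (\<Inter>u\<in>S. {q. dist q w0 < dist q u})"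
  have "open G" unfolding G_def using S by (intro open_INT ballI open_Collect_less) (auto intro: continuous_intros)
  moreover have "w0 \<in> G" using w0 by (auto simp: G_def)
  ultimately have "\<not> negligible G" using open_not_negligible by blast
  then obtain q where q: "q \<in> G" "q \<notin> (\<Union>p\<in>S \<times> (N - S). ?C p)" using neg negligible_subset by blast
  define L where "L = closed_segment u0 q"
  obtain B where B: "\<And>x. x \<in> L \<Longrightarrow> norm x \<le> B"
    using compact_imp_bounded[of L] by (auto simp: L_def bounded_iff)
  define U where "U = (\<Union>u\<in>S. voronoi_tile N u)"
  \<comment> \<open>Only nuclei of bounded norm are used, so that the union is finite and therefore
    closed; they still suffice for all points of the segment.\<close>
  define V where "V = (\<Union>w\<in>(N - S) \<inter> cball 0 (2 * B + norm u0). voronoi_tile N w)"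
  have u0N: "u0 \<in> N" using u0 S by blast
  have fin: "finite ((N - S) \<inter> cball 0 (2 * B + norm u0))"
    using lf by (auto simp: locally_finite_def intro: finite_subset[of _ "N \<inter> cball 0 (2 * B + norm u0)"])
  have "closed U" "closed V" unfolding U_def V_def using S fin by (auto intro!: closed_UN closed_voronoi_tile)
  moreover have "L \<subseteq> U \<union> V"
  proof
    fix x assume x: "x \<in> L"
    obtain v where v: "v \<in> N" "x \<in> voronoi_tile N v" "norm v \<le> 2 * norm x + norm u0"
      using nearest_point_exists[OF lf u0N] by blast
    then have "norm v \<le> 2 * B + norm u0" using B[OF x] by linarith
    then show "x \<in> U \<union> V" using v by (auto simp: U_def V_def)
  qed
  moreover have "U \<inter> V \<inter> L = {}"
  proof (rule ccontr)
    assume "U \<inter> V \<inter> L \<noteq> {}"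
    then obtain x u w where x: "x \<in> L" "u \<in> S" "w \<in> N - S" "x \<in> voronoi_tile N u" "x \<in> voronoi_tile N w"
      by (auto simp: U_def V_def)
    obtain t where t: "x = (1 - t) *\<^sub>R u0 + t *\<^sub>R q" using x(1) by (auto simp: L_def in_segment)
    have "x \<noteq> u0"
    proof
      assume "x = u0"
      then have "dist u0 w \<le> dist u0 u0" using x(5) u0N unfolding voronoi_tile_def by blast
      then show False using x(3) u0 by auto
    qed
    then have t0: "t \<noteq> 0" using t by auto
    \<comment> \<open>Solving for \<open>q\<close> puts it on the line through \<open>u0\<close> and
      \<open>x\<close>, hence in the affine hull that it was chosen to avoid.\<close>
    have "q = (1 - 1 / t) *\<^sub>R u0 + (1 / t) *\<^sub>R x" using t0 by (simp add: t algebra_simps)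
    moreover have "u0 \<in> ?C (u, w)" "x \<in> ?C (u, w)" using x by (auto intro: hull_inc)
    ultimately have "q \<in> ?C (u, w)"
      using affine_affine_hull[of "insert u0 (?T (u, w))"] by (auto simp: affine_alt)
    then show False using q(2) x by blast
  qed
  moreover have "connected L" by (simp add: L_def)
  ultimately have "U \<inter> L = {} \<or> V \<inter> L = {}" using connected_closedD by blast
  moreover have "u0 \<in> voronoi_tile N u0" by (simp add: voronoi_tile_def)
  then have "u0 \<in> U \<inter> L" using u0 by (auto simp: U_def L_def)
  moreover have "q \<in> V \<inter> L"
  proof -
    have "q \<in> L" by (simp add: L_def)
    moreover have "q \<notin> U"
      using q(1) w0 by (force simp: U_def G_def voronoi_tile_def)
    ultimately show ?thesis using \<open>L \<subseteq> U \<union> V\<close> by blast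
  qed
  ultimately show False by blast
qed

section \<open>Existence of self-avoiding paths of every length\<close>

definition origin_unique :: "'a::euclidean_space set \<Rightarrow> bool" where
  "origin_unique N \<longleftrightarrow> (\<exists>!v. v \<in> N \<and> 0 \<in> voronoi_tile N v)"

lemma origin_nucleusI:
  assumes "origin_unique N"
  shows "origin_nucleus N \<in> N" "0 \<in> voronoi_tile N (origin_nucleus N)"
  using theI'[OF assms[unfolded origin_unique_def]] by (auto simp: origin_nucleus_def)

lemma origin_nucleus_eq:
  assumes "origin_unique N" "v \<in> N" "0 \<in> voronoi_tile N v"
  shows "origin_nucleus N = v"
  using assms origin_nucleusI[OF assms(1)] by (auto simp: origin_unique_def)

lemma origin_unique_if_inj:
  assumes "locally_finite N" "N \<noteq> {}" "inj_on norm N"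
  shows "origin_unique N"
proof -
  obtain w where "w \<in> N" using assms by blast
  then obtain v where v: "v \<in> N" "0 \<in> voronoi_tile N v" using nearest_point_exists[OF assms(1)] by blast
  moreover have "v' = v" if "v' \<in> N" "0 \<in> voronoi_tile N v'" for v'
    using v that assms(3) by (intro inj_onD[OF assms(3)] antisym) (auto simp: voronoi_tile_def)
  ultimately show ?thesis by (auto simp: origin_unique_def)
qed

text \<open>Let \<open>R\<close> be the set of endpoints of paths with fewer than \<open>n\<close>
  steps. It is finite, and it contains all vertices of such paths because prefixes are again paths.
  An edge leaving \<open>R\<close> extends one of them to a new vertex that it has not visited; the
  extended path cannot have fewer than \<open>n\<close> steps, so it has exactly
  \<open>n\<close>.\<close>

lemma delaunay_saws_nonempty:
  fixes N :: "'a::euclidean_space set"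
  assumes lf: "locally_finite N" and inf: "infinite N" and o: "origin_unique N"
    and fin: "\<And>j. finite (delaunay_saws N j)"
  shows "delaunay_saws N n \<noteq> {}"
proof
  assume empty: "delaunay_saws N n = {}"
  let ?o = "origin_nucleus N"
  have 0: "[?o] \<in> delaunay_saws N 0" using origin_nucleusI[OF o] by (simp add: delaunay_saws_def)
  then have n0: "n > 0" using empty by (cases n) auto
  define R where "R = (\<Union>j<n. last ` delaunay_saws N j)"
  have "finite R" using fin by (simp add: R_def)
  have "R \<subseteq> N" by (auto simp: R_def delaunay_saws_def intro!: subsetD[OF _ last_in_set])
  have "?o \<in> R" using 0 n0 by (force simp: R_def)
  moreover have "N - R \<noteq> {}" using \<open>finite R\<close> inf finite_subset by auto
  ultimately obtain u w where u: "u \<in> R" "w \<in> N - R" "delaunay_adj N u w"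
    using delaunay_cut[OF lf \<open>R \<subseteq> N\<close> \<open>finite R\<close>] by blast
  then obtain j xs where xs: "j < n" "xs \<in> delaunay_saws N j" "u = last xs" by (auto simp: R_def)
  have len: "length xs = Suc j" using xs by (simp add: delaunay_saws_def)
  have "set xs \<subseteq> R"
  proof
    fix x assume "x \<in> set xs"
    then obtain i where i: "i < length xs" "xs ! i = x" by (auto simp: in_set_conv_nth)
    have "take (Suc i) xs \<in> delaunay_saws N i"
    proof -
      have "xs = take (Suc i) xs @ drop (Suc i) xs" by simp
      then have "successively (delaunay_adj N) (take (Suc i) xs)"
        using xs(2) unfolding delaunay_saws_def
        by (metis (mono_tags, lifting) mem_Collect_eq successively_append_iff)
      then show ?thesis using xs(2) i len
        by (auto simp: delaunay_saws_def hd_take dest: in_set_takeD)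
    qed
    moreover have "last (take (Suc i) xs) = x" using i by (simp add: take_Suc_conv_app_nth)
    ultimately show "x \<in> R" using i len xs(1) by (force simp: R_def)
  qed
  then have "xs @ [w] \<in> delaunay_saws N (Suc j)"
    using xs u len by (auto simp: delaunay_saws_def successively_append_iff hd_append)
  moreover from this have "w \<in> R" if "Suc j < n" using that by (force simp: R_def)
  ultimately show False using u xs(1) empty by (metis DiffD2 Suc_lessI empty_iff)
qed

section \<open>Delaunay adjacency as an open condition\<close>

text \<open>For \<open>y\<close> in the unit ball about \<open>p\<close>, a nucleus of norm above
  \<open>2 * (norm p + 1) + norm u\<close> is farther from \<open>y\<close> than \<open>u\<close> by
  the triangle inequality. Finitely many strict, hence open, conditions remain.\<close>

lemma open_strictly_nearest:
  fixes N :: "'a::euclidean_space set"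
  assumes lf: "locally_finite N" and p: "\<And>w. w \<in> N - W \<Longrightarrow> dist p u < dist p w"
  shows "\<exists>T. open T \<and> p \<in> T \<and> (\<forall>y\<in>T. \<forall>w\<in>N - W. dist y u < dist y w)"
proof -
  define r where "r = 2 * (norm p + 1) + norm u"
  define A where "A = (N - W) \<inter> cball 0 r"
  define T where "T = ball p 1 \<inter> (\<Inter>w\<in>A. {y. dist y u < dist y w})"
  have "finite A" using lf unfolding A_def locally_finite_def
    by (metis Diff_subset finite_subset inf_mono order_refl)
  then have "open T" unfolding T_def
    by (intro open_Int open_INT ballI open_Collect_less) (auto intro: continuous_intros)
  moreover have "p \<in> T" using p by (auto simp: T_def A_def)
  moreover have "dist y u < dist y w" if y: "y \<in> T" and w: "w \<in> N - W" for y w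
  proof (cases "w \<in> A")
    case False
    then have "norm w > r" using w by (auto simp: A_def)
    moreover have "norm y < norm p + 1"
      using y norm_triangle_sub[of y p] by (simp add: T_def dist_norm norm_minus_commute)
    moreover have "norm w \<le> dist y w + norm y"
      using norm_triangle_sub[of w y] by (simp add: dist_norm norm_minus_commute)
    moreover have "dist y u \<le> norm y + norm u" by (simp add: dist_norm norm_triangle_ineq4)
    ultimately show ?thesis unfolding r_def by (smt (verit))
  qed (use y in \<open>auto simp: T_def\<close>)
  ultimately show ?thesis by blast
qed

text \<open>Orthogonal projection of \<open>q\<close> onto the bisector of \<open>u\<close> and
  \<open>v\<close>, given by a formula so that it depends measurably on \<open>u\<close> and
  \<open>v\<close>. For \<open>u = v\<close> it returns \<open>q\<close>.\<close>

definition bisector_proj :: "'a::euclidean_space \<Rightarrow> 'a \<Rightarrow> 'a \<Rightarrow> 'a" where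
  "bisector_proj u v q = q - ((((v - u) \<bullet> q) - (v \<bullet> v - u \<bullet> u) / 2) / ((v - u) \<bullet> (v - u))) *\<^sub>R (v - u)"

lemma bisector_proj_on:
  assumes "u \<noteq> v" shows "(v - u) \<bullet> bisector_proj u v q = (v \<bullet> v - u \<bullet> u) / 2"
proof -
  have "a \<bullet> (q - ((a \<bullet> q - r) / (a \<bullet> a)) *\<^sub>R a) = r" if "a \<noteq> 0" for a :: 'a and r
    using that by (simp add: inner_diff_right)
  from this[of "v - u"] show ?thesis using assms by (simp add: bisector_proj_def)
qed

lemma bisector_proj_id:
  "(v - u) \<bullet> q = (v \<bullet> v - u \<bullet> u) / 2 \<Longrightarrow> bisector_proj u v q = q"
  by (simp add: bisector_proj_def)

text \<open>In the relative interior of a facet the two nuclei are strictly nearest: an affine function that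
  is nonnegative near a zero in the bisector of \<open>u\<close> and \<open>v\<close> vanishes on it, and distinct nuclei
  have distinct bisectors with \<open>u\<close>.\<close>

lemma strictly_nearest_in_facet:
  fixes N :: "'a::euclidean_space set"
  assumes uv: "u \<in> N" "v \<in> N" "u \<noteq> v" and w: "w \<in> N - {u, v}" and e: "e > 0"
    and p: "(v - u) \<bullet> p = (v \<bullet> v - u \<bullet> u) / 2"
    and sub: "\<And>y. y \<in> ball p e \<Longrightarrow> (v - u) \<bullet> y = (v \<bullet> v - u \<bullet> u) / 2 \<Longrightarrow> y \<in> voronoi_tile N u"
  shows "dist p u < dist p w"
proof (rule ccontr)
  assume n: "\<not> dist p u < dist p w"
  have "p \<in> voronoi_tile N u" using sub[of p] e p by simp
  then have "dist p u \<le> dist p w" using w by (simp add: voronoi_tile_def)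
  then have "dist p u = dist p w" using n by simp
  then have pw: "(w - u) \<bullet> p = (w \<bullet> w - u \<bullet> u) / 2" by (simp add: dist_eq_iff_inner)
  let ?a = "v - u"
  \<comment> \<open>\<open>h\<close> is the part of \<open>w - u\<close> orthogonal to
    \<open>v - u\<close>. Moving from \<open>p\<close> along \<open>h\<close> remains on the
    bisector of \<open>u\<close> and \<open>v\<close> but gets closer to \<open>w\<close> than to
    \<open>u\<close>, unless \<open>h = 0\<close>.\<close>
  define c where "c = ((w - u) \<bullet> ?a) / (?a \<bullet> ?a)"
  define h where "h = (w - u) - c *\<^sub>R ?a"
  have a0: "?a \<bullet> ?a \<noteq> 0" using uv by simp
  have ha: "?a \<bullet> h = 0" using a0 by (simp add: h_def c_def inner_diff_right inner_commute)
  have hw: "(w - u) \<bullet> h = h \<bullet> h"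
  proof -
    have "(w - u) \<bullet> h = (h + c *\<^sub>R ?a) \<bullet> h" by (simp add: h_def)
    then show ?thesis by (simp only: inner_add_left inner_scaleR_left ha)
  qed
  have "h = 0"
  proof (rule ccontr)
    assume h0: "h \<noteq> 0"
    define t where "t = e / (2 * norm h)"
    have t: "t > 0" using e h0 by (simp add: t_def)
    let ?y = "p + t *\<^sub>R h"
    have "?y \<in> ball p e" using h0 e by (simp add: t_def dist_norm)
    moreover have "?a \<bullet> ?y = (v \<bullet> v - u \<bullet> u) / 2"
      using p ha by (simp add: inner_add_right)
    ultimately have "?y \<in> voronoi_tile N u" by (rule sub)
    then have "dist ?y u \<le> dist ?y w" using w by (simp add: voronoi_tile_def)
    then have "(w - u) \<bullet> ?y \<le> (w \<bullet> w - u \<bullet> u) / 2" by (simp only: dist_le_iff_inner)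
    then have "t * (h \<bullet> h) \<le> 0" using pw hw by (simp only: inner_add_right inner_scaleR_right)
    moreover have "h \<bullet> h > 0" using h0 by simp
    ultimately show False using t by (simp add: mult_le_0_iff)
  qed
  then have wc: "w = u + c *\<^sub>R ?a" by (simp add: h_def algebra_simps)
  \<comment> \<open>Now \<open>w\<close> lies on the line through \<open>u\<close> and
    \<open>v\<close> with parameter \<open>c\<close>. That \<open>p\<close> is on the bisectors of
    \<open>u\<close> with \<open>v\<close> and of \<open>u\<close> with \<open>w\<close> amounts to
    \<open>c = c * c\<close>.\<close>
  have "w \<bullet> w - u \<bullet> u = 2 * c * (?a \<bullet> u) + c * c * (?a \<bullet> ?a)"
    unfolding wc by (simp add: inner_add inner_commute algebra_simps)
  moreover have "v \<bullet> v - u \<bullet> u = 2 * (?a \<bullet> u) + ?a \<bullet> ?a" by (simp add: inner_diff inner_commute)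
  moreover have "(w - u) \<bullet> p = c * (?a \<bullet> p)" by (simp add: wc)
  ultimately have "c * (?a \<bullet> ?a) = c * c * (?a \<bullet> ?a)" using p pw by (simp add: field_simps)
  then have "c = 0 \<or> c = 1" using a0 by simp
  then have "w = u \<or> w = v" using wc by auto
  then show False using w by simp
qed

text \<open>A facet exists exactly when some point of the bisector has \<open>u\<close> and
  \<open>v\<close> as its strictly nearest nuclei. This is stable under small moves within the
  bisector, so projections of a countable dense set detect it; adjacency thereby becomes a countable
  combination of measurable conditions.\<close>

lemma delaunay_adj_iff_dense:
  fixes N :: "'a::euclidean_space set"
  assumes lf: "locally_finite N" and uv: "u \<in> N" "v \<in> N"
    and D: "\<And>X. open X \<Longrightarrow> X \<noteq> {} \<Longrightarrow> \<exists>d\<in>D. d \<in> X"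
  shows "delaunay_adj N u v \<longleftrightarrow> u \<noteq> v \<and>
    (\<exists>q\<in>D. \<forall>w\<in>N - {u, v}. dist (bisector_proj u v q) u < dist (bisector_proj u v q) w)"
proof (cases "u = v")
  case True then show ?thesis by (simp add: delaunay_adj_def)
next
  case ne: False
  let ?F = "voronoi_tile N u \<inter> voronoi_tile N v"
  let ?H = "{x. (v - u) \<bullet> x = (v \<bullet> v - u \<bullet> u) / 2}"
  have FH: "?F \<subseteq> ?H" unfolding voronoi_tile_Int[OF uv] by auto
  have dH: "aff_dim ?H = int DIM('a) - 1" by (rule aff_dim_bisector[OF ne])
  show ?thesis
  proof
    assume "delaunay_adj N u v"
    then have ge: "aff_dim ?F \<ge> int DIM('a) - 1" using delaunay_adj_iff_aff_dim[OF uv ne] by simp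
    then have "aff_dim ?F = aff_dim ?H" using aff_dim_subset[OF FH] dH by linarith
    \<comment> \<open>The dimensions agree, so the affine hull of the common face is the whole
      bisector, and a relative interior point has a full neighbourhood within the bisector.\<close>
    then have hull: "affine hull ?F = ?H"
      using aff_dim_eq_full_gen[OF FH] hull_same[of affine, OF affine_hyperplane[of "v - u"]] by metis
    show "u \<noteq> v \<and> (\<exists>q\<in>D. \<forall>w\<in>N - {u, v}. dist (bisector_proj u v q) u < dist (bisector_proj u v q) w)"
    proof (intro conjI ne)
      have "DIM('a) \<ge> 1" by (simp add: Suc_le_eq)
      then have "?F \<noteq> {}" using ge by auto
      moreover have cF: "convex ?F" by (intro convex_Int convex_voronoi_tile)
      ultimately obtain p where "p \<in> rel_interior ?F" using rel_interior_eq_empty by blast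
      then obtain e where e: "p \<in> ?F" "e > 0" "ball p e \<inter> ?H \<subseteq> ?F"
        unfolding mem_rel_interior_ball hull by blast
      have pH: "p \<in> ?H" using e FH by blast
      have "dist p u < dist p w" if "w \<in> N - {u, v}" for w
        by (rule strictly_nearest_in_facet[OF uv ne that e(2)]) (use pH e in auto)
      then obtain T where T: "open T" "p \<in> T" "\<forall>y\<in>T. \<forall>w\<in>N - {u, v}. dist y u < dist y w"
        using open_strictly_nearest[OF lf, of "{u, v}" p u] by blast
      have "open (bisector_proj u v -` T)"
        unfolding bisector_proj_def[abs_def] using ne by (intro open_vimage T continuous_intros) auto
      moreover have "p \<in> bisector_proj u v -` T" using T(2) bisector_proj_id[of v u p] pH by simp
      ultimately obtain q where "q \<in> D" "bisector_proj u v q \<in> T" using D by blast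
      then show "\<exists>q\<in>D. \<forall>w\<in>N - {u, v}. dist (bisector_proj u v q) u < dist (bisector_proj u v q) w"
        using T(3) by blast
    qed
  next
    assume "u \<noteq> v \<and> (\<exists>q\<in>D. \<forall>w\<in>N - {u, v}. dist (bisector_proj u v q) u < dist (bisector_proj u v q) w)"
    then obtain q where q: "\<And>w. w \<in> N - {u, v} \<Longrightarrow> dist (bisector_proj u v q) u < dist (bisector_proj u v q) w"
      by blast
    let ?p = "bisector_proj u v q"
    obtain T where T: "open T" "?p \<in> T" "\<forall>y\<in>T. \<forall>w\<in>N - {u, v}. dist y u < dist y w"
      using open_strictly_nearest[OF lf q] by blast
    have "?H \<inter> T \<subseteq> ?F"
    proof
      fix y assume y: "y \<in> ?H \<inter> T"
      then have eq: "dist y u = dist y v" by (simp add: dist_eq_iff_inner)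
      have "dist y u \<le> dist y w" if "w \<in> N" for w
      proof (cases "w \<in> {u, v}")
        case False
        then have "w \<in> N - {u, v}" using that by blast
        then have "dist y u < dist y w" using T(3) y by blast
        then show ?thesis by simp
      qed (use eq in auto)
      then show "y \<in> ?F" using eq by (auto simp: voronoi_tile_def)
    qed
    moreover have "aff_dim (?H \<inter> T) = aff_dim ?H"
      using T bisector_proj_on[OF ne, of q] by (intro aff_dim_convex_Int_open convex_hyperplane) auto
    ultimately have "aff_dim ?F \<ge> int DIM('a) - 1" using aff_dim_subset dH by metis
    then show "delaunay_adj N u v" using delaunay_adj_iff_aff_dim[OF uv ne] by simp
  qed
qed

section \<open>Almost sure properties\<close>

text \<open>The set where \<open>P\<close> fails need not be an event; it is contained in the
  intersection of the exceptional events, which is null.\<close>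

lemma (in prob_space) AE_if_small_exceptions:
  assumes "\<And>e. e > 0 \<Longrightarrow> \<exists>B\<in>events. prob B \<le> e \<and> (\<forall>\<omega>\<in>space M - B. P \<omega>)"
  shows "AE \<omega> in M. P \<omega>"
proof -
  have "\<forall>n. \<exists>B. B \<in> events \<and> prob B \<le> 1 / real (Suc n) \<and> (\<forall>\<omega>\<in>space M - B. P \<omega>)"
    using assms[of "1 / real (Suc n)" for n] by fastforce
  then obtain B where B: "\<And>n. B n \<in> events" "\<And>n. prob (B n) \<le> 1 / real (Suc n)"
    "\<And>n \<omega>. \<omega> \<in> space M - B n \<Longrightarrow> P \<omega>" by metis
  have Z: "(\<Inter>n. B n) \<in> events" using B by auto
  have "prob (\<Inter>n. B n) \<le> 1 / real (Suc n)" for n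
    using finite_measure_mono[of "\<Inter>n. B n" "B n"] B(1,2)[of n] by (auto intro: order_trans)
  then have "prob (\<Inter>n. B n) \<le> 0"
    by (intro LIMSEQ_le_const[OF LIMSEQ_inverse_real_of_nat]) (auto simp: inverse_eq_divide)
  then have "(\<Inter>n. B n) \<in> null_sets M"
    using Z by (simp add: null_sets_def emeasure_eq_measure measure_le_0_iff)
  then show ?thesis by (rule AE_I') (use B(3) in blast)
qed

lemma power_diff_le:
  fixes a b B :: real
  assumes "0 \<le> a" "a \<le> b" "b \<le> B" "1 \<le> B"
  shows "b ^ n - a ^ n \<le> n * (b - a) * B ^ n"
proof (induction n)
  case (Suc n)
  have "b ^ Suc n - a ^ Suc n = b * (b ^ n - a ^ n) + a ^ n * (b - a)" by (simp add: algebra_simps)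
  also have "\<dots> \<le> B * (n * (b - a) * B ^ n) + B ^ Suc n * (b - a)"
  proof (intro add_mono mult_mono[OF _ Suc] mult_right_mono)
    have "a ^ n \<le> B ^ n" using assms by (intro power_mono) auto
    also have "\<dots> \<le> B ^ Suc n" using assms by (intro power_increasing) auto
    finally show "a ^ n \<le> B ^ Suc n" .
    show "0 \<le> b ^ n - a ^ n" using assms by (simp add: power_mono)
  qed (use assms in auto)
  also have "\<dots> = Suc n * (b - a) * B ^ Suc n" by (simp add: algebra_simps)
  finally show ?case .
qed simp

context poisson_nuclei
begin

lemma prob_two_points_le:
  assumes A: "A \<in> sets borel" "emeasure \<mu> A < \<infinity>"
  shows "prob {\<omega> \<in> space M. num_points (N \<omega>) A \<noteq> 0 \<and> num_points (N \<omega>) A \<noteq> 1} \<le> (measure \<mu> A)\<^sup>2"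
proof -
  let ?l = "measure \<mu> A"
  let ?E = "\<lambda>k::nat. {\<omega> \<in> space M. num_points (N \<omega>) A = of_nat k}"
  have E: "?E k \<in> events" for k by (rule num_points_event[OF A(1)])
  have "{\<omega> \<in> space M. num_points (N \<omega>) A \<noteq> 0 \<and> num_points (N \<omega>) A \<noteq> 1} = space M - (?E 0 \<union> ?E 1)" by auto
  also have "prob \<dots> = 1 - prob (?E 0 \<union> ?E 1)" using E[of 0] E[of 1] by (intro prob_compl sets.Un)
  also have "prob (?E 0 \<union> ?E 1) = prob (?E 0) + prob (?E 1)"
    using E[of 0] E[of 1] by (intro finite_measure_Union) auto
  also have "\<dots> = exp (- ?l) * (1 + ?l)" unfolding prob_num_points[OF A] by (simp add: algebra_simps)
  also have "1 - \<dots> \<le> 1 - (1 - ?l) * (1 + ?l)"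
    using exp_ge_add_one_self[of "- ?l"] by (intro diff_left_mono mult_right_mono) auto
  also have "\<dots> = ?l\<^sup>2" by (simp add: algebra_simps power2_eq_square)
  finally show ?thesis .
qed

text \<open>A ball is cut into shells of width \<open>1 / l\<close>. There are of order
  \<open>l\<close> of them, each with intensity of order \<open>1 / l\<close>, and two points share
  a given shell with probability of order \<open>1 / l\<^sup>2\<close>. The total is of order
  \<open>1 / l\<close>, hence arbitrarily small.\<close>

lemma AE_inj_norm: "AE \<omega> in M. inj_on norm (N \<omega>)"
proof -
  have "AE \<omega> in M. \<forall>x\<in>N \<omega>. \<forall>y\<in>N \<omega>. norm x = norm y \<and> norm x < real R \<longrightarrow> x = y" for R
  proof (rule AE_if_small_exceptions)
    fix e :: real assume e: "e > 0"
    let ?d = "DIM('a)"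
    \<comment> \<open>The successor keeps the outer radius at least 1, as the bound on differences
      of powers requires.\<close>
    let ?R = "real (Suc R)"
    define C where "C = c * (unit_ball_vol ?d * (?d * ?R ^ ?d))"
    define l where "l = Suc (nat \<lceil>?R * C\<^sup>2 / e\<rceil>)"
    have l0: "real l > 0" by (simp add: l_def)
    have "?R * C\<^sup>2 / e \<le> real l" unfolding l_def by linarith
    then have le: "?R * C\<^sup>2 / l \<le> e" using e l0 by (simp add: field_simps)
    define A where "A j = ball (0::'a) (Suc j / l) - ball 0 (j / l)" for j
    have Ab: "A j \<in> sets borel" for j by (simp add: A_def)
    have A: "emeasure \<mu> (A j) < \<infinity>" "measure \<mu> (A j) \<le> C / l" if j: "j < Suc R * l" for j
    proof -
      let ?v = "unit_ball_vol ?d * (Suc j / l) ^ ?d - unit_ball_vol ?d * (j / l) ^ ?d"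
      have jl: "j / l \<le> Suc j / l" by (simp add: divide_right_mono)
      have "emeasure lborel (A j) = emeasure lborel (ball (0::'a) (Suc j / l)) - emeasure lborel (ball (0::'a) (j / l))"
        unfolding A_def using jl by (intro emeasure_Diff) (auto simp: emeasure_ball)
      also have "\<dots> = ennreal ?v" by (simp add: emeasure_ball ennreal_minus)
      finally have e: "emeasure lborel (A j) = ennreal ?v" .
      have "(j / l) ^ ?d \<le> (Suc j / l) ^ ?d" using jl by (intro power_mono) auto
      then have v0: "?v \<ge> 0" by (simp add: mult_left_mono)
      have "real (Suc j) \<le> ?R * l" using j by (metis Suc_leI of_nat_le_iff of_nat_mult)
      then have "(Suc j / l) ^ ?d - (j / l) ^ ?d \<le> ?d * (Suc j / l - j / l) * ?R ^ ?d"
        using jl l0 by (intro power_diff_le) (auto simp: field_simps)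
      also have "Suc j / l - j / l = 1 / l" by (simp flip: diff_divide_distrib)
      finally have "c * (unit_ball_vol ?d * ((Suc j / l) ^ ?d - (j / l) ^ ?d)) \<le> c * (unit_ball_vol ?d * (?d * (1 / l) * ?R ^ ?d))"
        using c_pos by (intro mult_left_mono) auto
      also have "\<dots> = C / l" by (simp add: C_def)
      finally have "c * ?v \<le> C / l" by (simp add: right_diff_distrib)
      then show "emeasure \<mu> (A j) < \<infinity>" "measure \<mu> (A j) \<le> C / l"
        using mu_bounds[OF Ab e v0] by auto
    qed
    let ?E = "\<lambda>j. {\<omega> \<in> space M. num_points (N \<omega>) (A j) \<noteq> 0 \<and> num_points (N \<omega>) (A j) \<noteq> 1}"
    have E: "?E j \<in> events" for j
    proof -
      have [measurable]: "(\<lambda>\<omega>. num_points (N \<omega>) (A j)) \<in> borel_measurable M" by (rule num_points_measurable[OF Ab])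
      show ?thesis by measurable
    qed
    show "\<exists>B\<in>events. prob B \<le> e \<and> (\<forall>\<omega>\<in>space M - B. \<forall>x\<in>N \<omega>. \<forall>y\<in>N \<omega>. norm x = norm y \<and> norm x < real R \<longrightarrow> x = y)"
    proof (intro bexI[of _ "\<Union>j<Suc R * l. ?E j"] conjI ballI impI)
      have "prob (\<Union>j<Suc R * l. ?E j) \<le> (\<Sum>j<Suc R * l. prob (?E j))"
        using E by (intro finite_measure_subadditive_finite) auto
      also have "\<dots> \<le> (\<Sum>j<Suc R * l. (C / l)\<^sup>2)"
      proof (rule sum_mono)
        fix j assume "j \<in> {..<Suc R * l}"
        then have j: "j < Suc R * l" by simp
        have "prob (?E j) \<le> (measure \<mu> (A j))\<^sup>2" by (rule prob_two_points_le[OF Ab A(1)[OF j]])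
        also have "\<dots> \<le> (C / l)\<^sup>2" using A(2)[OF j] by (intro power_mono) auto
        finally show "prob (?E j) \<le> (C / l)\<^sup>2" .
      qed
      also have "\<dots> = ?R * C\<^sup>2 / l" using l0 by (simp add: power2_eq_square field_simps)
      finally show "prob (\<Union>j<Suc R * l. ?E j) \<le> e" using le by linarith
      show "(\<Union>j<Suc R * l. ?E j) \<in> events" using E by (intro sets.finite_UN) auto
      fix \<omega> x y
      assume w: "\<omega> \<in> space M - (\<Union>j<Suc R * l. ?E j)" and xy: "x \<in> N \<omega>" "y \<in> N \<omega>" "norm x = norm y \<and> norm x < real R"
      define j where "j = nat \<lfloor>norm x * l\<rfloor>"
      have j: "real j \<le> norm x * l" "norm x * l < Suc j" unfolding j_def by (simp_all add: of_nat_nat) linarith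
      have "norm x * l < ?R * l" using xy l0 by (intro mult_strict_right_mono) auto
      then have "real j < real (Suc R * l)" using j(1) unfolding of_nat_mult by linarith
      then have "j < Suc R * l" by (simp only: of_nat_less_iff)
      then have "num_points (N \<omega>) (A j) = 0 \<or> num_points (N \<omega>) (A j) = 1" using w by blast
      moreover have "x \<in> N \<omega> \<inter> A j" "y \<in> N \<omega> \<inter> A j"
        using xy j l0 by (auto simp: A_def field_simps)
      ultimately have "finite (N \<omega> \<inter> A j) \<and> card (N \<omega> \<inter> A j) = 1"
        by (auto simp: num_points_eq split: if_splits)
      then show "x = y" using \<open>x \<in> N \<omega> \<inter> A j\<close> \<open>y \<in> N \<omega> \<inter> A j\<close> by (metis card_1_singletonE singletonD)
    qed
  qed
  then have "AE \<omega> in M. \<forall>R::nat. \<forall>x\<in>N \<omega>. \<forall>y\<in>N \<omega>. norm x = norm y \<and> norm x < real R \<longrightarrow> x = y"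
    by (simp add: AE_all_countable)
  then show ?thesis
  proof eventually_elim
    case (elim \<omega>)
    show ?case
    proof (rule inj_onI)
      fix x y assume "x \<in> N \<omega>" "y \<in> N \<omega>" "norm x = norm y"
      moreover obtain R :: nat where "norm x < real R" using reals_Archimedean2 by blast
      ultimately show "x = y" using elim by blast
    qed
  qed
qed

lemma AE_infinite: "AE \<omega> in M. infinite (N \<omega>)"
proof -
  have "ennreal (1 / c) * emeasure lebesgue (UNIV :: 'a set) \<le> emeasure \<mu> UNIV" by (rule mu_ge) simp
  then have "emeasure \<mu> UNIV = \<infinity>" using c_pos by (simp add: ennreal_mult_top top_unique)
  then have "AE \<omega> in M. num_points (N \<omega>) UNIV = \<infinity>"
    using poisson by (auto simp: poisson_random_set_def)
  then show ?thesis by eventually_elim (auto simp: num_points_eq split: if_splits)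
qed

lemma AE_nice: "AE \<omega> in M. locally_finite (N \<omega>) \<and> infinite (N \<omega>) \<and> origin_unique (N \<omega>)"
  using AE_locally_finite[OF zero_less_one] AE_infinite AE_inj_norm
proof (eventually_elim, goal_cases)
  case (1 \<omega>)
  have "finite (N \<omega> \<inter> cball 0 r)" for r
  proof -
    have "N \<omega> \<inter> cball 0 r \<subseteq> (\<Union>z\<in>nbhd \<lceil>r\<rceil> origin_cell. N \<omega> \<inter> cube 1 z)"
    proof
      fix x assume x: "x \<in> N \<omega> \<inter> cball 0 r"
      then have "dist 0 x \<le> of_int \<lceil>r\<rceil> * 1" by (auto intro: order_trans)
      then have "cell 1 x \<in> nbhd \<lceil>r\<rceil> (cell 1 0)" by (intro cell_dist) auto
      then show "x \<in> (\<Union>z\<in>nbhd \<lceil>r\<rceil> origin_cell. N \<omega> \<inter> cube 1 z)" using x by (auto simp: cell_zero)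
    qed
    moreover have "finite (\<Union>z\<in>nbhd \<lceil>r\<rceil> origin_cell. N \<omega> \<inter> cube 1 z)"
      using 1 by (intro finite_UN_I) auto
    ultimately show ?thesis by (rule finite_subset)
  qed
  then have "locally_finite (N \<omega>)" by (simp add: locally_finite_def)
  moreover have "N \<omega> \<noteq> {}" using 1 by auto
  ultimately show ?case using 1 origin_unique_if_inj by blast
qed

section \<open>Path counts outside a rare event\<close>

definition size_const :: nat where
  "size_const = 2 * (16 * DIM('a) + 1) ^ DIM('a)"

lemma good_event_saws:
  assumes dim: "DIM('a) \<ge> 2"
  shows "\<exists>C::real\<ge>1. \<forall>n m. size_const * (n + 2) \<le> m \<longrightarrow>
    (\<exists>B\<in>events. prob B \<le> 2 * exp (- (real m powr (1 / 3))) \<and>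
      (\<forall>\<omega>\<in>space M - B. origin_unique (N \<omega>) \<longrightarrow>
        finite (delaunay_saws (N \<omega>) n) \<and> log_num_saws (N \<omega>) n \<le> C * m))"
proof -
  obtain K H where K: "K > 0" and H: "H \<ge> 0" and
    good: "\<And>m. m \<ge> 1 \<Longrightarrow> \<exists>B\<in>events. prob B \<le> 2 * exp (- (real m powr (1 / 3))) \<and>
      (\<forall>\<omega>\<in>space M - B. sparse_holes (N \<omega>) K m \<and> few_points (N \<omega>) K H m)"
    using good_event by blast
  let ?C = "max 1 (count_const TYPE('a) H)"
  have bound: "finite (delaunay_saws (N \<omega>) n) \<and> log_num_saws (N \<omega>) n \<le> ?C * m"
    if sp: "sparse_holes (N \<omega>) K m" and few: "few_points (N \<omega>) K H m" and m: "size_const * (n + 2) \<le> m"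
      and o: "origin_unique (N \<omega>)" for \<omega> n m
  proof -
    let ?o = "origin_nucleus (N \<omega>)" and ?S = "delaunay_saws (N \<omega>) n"
    \<comment> \<open>The empty ball about 0 with \<open>v(0)\<close> on its boundary makes the
      starting nucleus the target of a hop from 0, which anchors the path at the origin
      cell.\<close>
    have "ball 0 (dist 0 ?o) \<inter> N \<omega> = {}"
      using origin_nucleusI(2)[OF o] by (auto simp: voronoi_tile_def not_less)
    then have hop: "hop (N \<omega>) 0 ?o"
      unfolding hop_def hole_def by (intro exI[of _ "dist 0 ?o"] conjI exI[of _ 0]) auto
    have S: "length xs = Suc n \<and> hd xs = ?o \<and> set xs \<subseteq> N \<omega> \<and> distinct xs \<and> successively (hop (N \<omega>)) xs"
      if "xs \<in> ?S" for xs
      using that delaunay_adj_imp_hop[OF dim] by (auto simp: delaunay_saws_def intro: successively_mono)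
    note c = card_hop_paths[OF K H sp few m[unfolded size_const_def] hop S]
    have fin: "finite ?S" by (rule c(1))
    have "real (card ?S) \<le> exp (count_const TYPE('a) H * m)" by (rule c(2))
    also have "\<dots> \<le> exp (?C * m)" by (simp add: mult_right_mono)
    finally have card: "real (card ?S) \<le> exp (?C * m)" .
    have "ln (real (card ?S)) \<le> ?C * m"
    proof (cases "card ?S = 0")
      case False
      then show ?thesis using card ln_le_cancel_iff[of "real (card ?S)" "exp (?C * m)"] by simp
    qed simp
    then show ?thesis using fin by (simp add: log_num_saws_def)
  qed
  show ?thesis
  proof (intro exI[of _ ?C] conjI allI impI)
    fix n m assume m: "size_const * (n + 2) \<le> m"
    have "1 \<le> size_const" unfolding size_const_def using one_le_power[of "16 * DIM('a) + 1" "DIM('a)"] by linarith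
    then have "1 * 2 \<le> size_const * (n + 2)" by (intro mult_mono) auto
    then have "m \<ge> 1" using m by linarith
    from good[OF this] obtain B where B: "B \<in> events" "prob B \<le> 2 * exp (- (real m powr (1 / 3)))"
      "\<And>\<omega>. \<omega> \<in> space M - B \<Longrightarrow> sparse_holes (N \<omega>) K m \<and> few_points (N \<omega>) K H m" by blast
    then show "\<exists>B\<in>events. prob B \<le> 2 * exp (- (real m powr (1 / 3))) \<and>
      (\<forall>\<omega>\<in>space M - B. origin_unique (N \<omega>) \<longrightarrow>
        finite (delaunay_saws (N \<omega>) n) \<and> log_num_saws (N \<omega>) n \<le> ?C * m)"
      using bound m by blast
  qed simp
qed

text \<open>For fixed \<open>n\<close> the size \<open>m\<close> is a free parameter. Letting it
  grow makes the exceptional probability arbitrarily small, while finiteness of the set of paths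
  does not depend on \<open>m\<close>.\<close>

lemma AE_saws:
  assumes dim: "DIM('a) \<ge> 2"
  shows "AE \<omega> in M. \<forall>n. finite (delaunay_saws (N \<omega>) n) \<and> delaunay_saws (N \<omega>) n \<noteq> {}"
proof -
  obtain C :: real where C: "C \<ge> 1" "\<And>n m. size_const * (n + 2) \<le> m \<Longrightarrow>
    (\<exists>B\<in>events. prob B \<le> 2 * exp (- (real m powr (1 / 3))) \<and>
      (\<forall>\<omega>\<in>space M - B. origin_unique (N \<omega>) \<longrightarrow>
        finite (delaunay_saws (N \<omega>) n) \<and> log_num_saws (N \<omega>) n \<le> C * m))"
    using good_event_saws[OF dim] by blast
  have "AE \<omega> in M. origin_unique (N \<omega>) \<longrightarrow> finite (delaunay_saws (N \<omega>) n)" for n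
  proof (rule AE_if_small_exceptions)
    fix e :: real assume e: "e > 0"
    \<comment> \<open>With \<open>m = k ^ 3\<close> the cube root is exactly \<open>k\<close>. The
      first summand makes the exceptional probability at most \<open>e\<close>, the second one
      secures the size condition because \<open>k \<le> m\<close>.\<close>
    define k where "k = nat \<lceil>ln (2 / e)\<rceil> + size_const * (n + 2)"
    define m where "m = k ^ 3"
    have k0: "k > 0" by (simp add: k_def size_const_def)
    then have "real m powr (1 / 3) = real k"
      using powr_powr[of "real k" 3 "1 / 3"] by (simp add: m_def)
    moreover have "ln (2 / e) \<le> real k" unfolding k_def by linarith
    then have "exp (- real k) \<le> exp (- ln (2 / e))" by simp
    moreover have "exp (- ln (2 / e)) = e / 2" using e by (simp add: exp_minus)
    ultimately have m1: "2 * exp (- (real m powr (1 / 3))) \<le> e" by simp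
    have "size_const * (n + 2) \<le> k" by (simp add: k_def)
    also have "k \<le> m" using k0 by (simp add: m_def self_le_power)
    finally have m2: "size_const * (n + 2) \<le> m" .
    show "\<exists>B\<in>events. prob B \<le> e \<and> (\<forall>\<omega>\<in>space M - B. origin_unique (N \<omega>) \<longrightarrow> finite (delaunay_saws (N \<omega>) n))"
      using C(2)[OF m2] m1 by (meson order_trans)
  qed
  then have "AE \<omega> in M. \<forall>n. origin_unique (N \<omega>) \<longrightarrow> finite (delaunay_saws (N \<omega>) n)"
    unfolding AE_all_countable by blast
  with AE_nice show ?thesis
    by eventually_elim (auto dest: delaunay_saws_nonempty)
qed

end

section \<open>Measurability\<close>

lemma open_enumeration:
  "\<exists>U :: nat \<Rightarrow> 'a::euclidean_space set. (\<forall>i. open (U i)) \<and>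
    (\<forall>G x. open G \<longrightarrow> x \<in> G \<longrightarrow> (\<exists>i. x \<in> U i \<and> U i \<subseteq> G))"
proof -
  obtain \<B> :: "'a set set" where B: "countable \<B>" "topological_basis \<B>"
    using ex_countable_basis by blast
  have ne: "\<B> \<noteq> {}" using topological_basisE[OF B(2) open_UNIV UNIV_I] by blast
  show ?thesis
  proof (intro exI[of _ "from_nat_into \<B>"] conjI allI impI)
    show "open (from_nat_into \<B> i)" for i
      using topological_basis_open[OF B(2)] from_nat_into[OF ne] by blast
    fix G x assume "open G" "x \<in> (G :: 'a set)"
    then obtain V where V: "V \<in> \<B>" "x \<in> V" "V \<subseteq> G" by (rule topological_basisE[OF B(2)])
    then obtain i where "from_nat_into \<B> i = V" using from_nat_into_surj[OF B(1)] by blast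
    then show "\<exists>i. x \<in> from_nat_into \<B> i \<and> from_nat_into \<B> i \<subseteq> G" using V by blast
  qed
qed

lemma dense_enumeration:
  "\<exists>D :: nat \<Rightarrow> 'a::euclidean_space. \<forall>X. open X \<longrightarrow> X \<noteq> {} \<longrightarrow> (\<exists>i. D i \<in> X)"
proof -
  obtain E :: "'a set" where E: "countable E" "\<And>X. open X \<Longrightarrow> X \<noteq> {} \<Longrightarrow> \<exists>d\<in>E. d \<in> X"
    using countable_dense_exists by blast
  have "E \<noteq> {}" using E(2)[of UNIV] by auto
  then have "range (from_nat_into E) = E" using E(1) by (simp add: range_from_nat_into)
  then show ?thesis using E(2) by (intro exI[of _ "from_nat_into E"]) (metis imageE)
qed

lemma isolating_open:
  assumes "locally_finite N" "v \<in> N" shows "\<exists>G. open G \<and> v \<in> G \<and> N \<inter> G = {v}"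
proof -
  let ?A = "N \<inter> cball 0 (norm v + 1) - {v}"
  have "finite ?A" using assms(1) by (simp add: locally_finite_def)
  then have op: "open (ball v 1 - ?A)" by (intro open_Diff finite_imp_closed) auto
  have "norm x \<le> norm v + 1" if "x \<in> ball v 1" for x
    using that norm_triangle_sub[of x v] by (simp add: dist_norm norm_minus_commute)
  then have "N \<inter> (ball v 1 - ?A) = {v}" using assms(2) by auto
  moreover have "v \<in> ball v 1 - ?A" by simp
  ultimately show ?thesis using op by blast
qed

text \<open>The points of a locally finite set are enumerated through a countable base \<open>U\<close>: a base set
  containing exactly one point names it, and the least index among the names is kept.\<close>

definition isolates :: "(nat \<Rightarrow> 'a set) \<Rightarrow> 'a::euclidean_space set \<Rightarrow> nat \<Rightarrow> bool" where
  "isolates U N i \<longleftrightarrow> num_points N (U i) = 1"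

definition named :: "(nat \<Rightarrow> 'a set) \<Rightarrow> 'a::euclidean_space set \<Rightarrow> nat \<Rightarrow> 'a" where
  "named U N i = (if isolates U N i then THE y. y \<in> N \<inter> U i else 0)"

text \<open>Coincidence of named points is written as vanishing distance, a condition on a
  real-valued measurable function.\<close>

definition canonical :: "(nat \<Rightarrow> 'a set) \<Rightarrow> 'a::euclidean_space set \<Rightarrow> nat \<Rightarrow> bool" where
  "canonical U N i \<longleftrightarrow> isolates U N i \<and>
     (\<forall>j. j < i \<longrightarrow> \<not> (isolates U N j \<and> dist (named U N j) (named U N i) = 0))"

lemma num_points_eq_1_iff: "num_points N A = 1 \<longleftrightarrow> (\<exists>y. N \<inter> A = {y})"
  by (auto simp: num_points_eq card_1_singleton_iff split: if_splits)

lemma named_eq: "N \<inter> U i = {y} \<Longrightarrow> isolates U N i \<and> named U N i = y"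
  by (auto simp: named_def isolates_def num_points_eq_1_iff)

lemma isolatesD:
  assumes "isolates U N i" shows "N \<inter> U i = {named U N i}"
proof -
  obtain y where y: "N \<inter> U i = {y}" using assms unfolding isolates_def num_points_eq_1_iff by blast
  then have "named U N i = y" using named_eq[of N U i y] by blast
  then show ?thesis using y by simp
qed

lemma bij_betw_named:
  assumes lf: "locally_finite N"
    and U: "\<And>G x. open G \<Longrightarrow> x \<in> G \<Longrightarrow> \<exists>i. x \<in> U i \<and> U i \<subseteq> G"
  shows "bij_betw (named U N) {i. canonical U N i} N"
  unfolding bij_betw_def
proof (intro conjI equalityI subsetI)
  show "inj_on (named U N) {i. canonical U N i}"
  proof (rule inj_onI)
    fix i j assume "i \<in> {i. canonical U N i}" "j \<in> {i. canonical U N i}" "named U N i = named U N j"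
    then show "i = j" by (cases i j rule: linorder_cases) (auto simp: canonical_def)
  qed
next
  fix x assume "x \<in> named U N ` {i. canonical U N i}"
  then show "x \<in> N" using isolatesD[of U N] by (auto simp: canonical_def)
next
  fix v assume v: "v \<in> N"
  then obtain G where G: "open G" "v \<in> G" "N \<inter> G = {v}" using isolating_open[OF lf] by blast
  then obtain i where "v \<in> U i" "U i \<subseteq> G" using U by blast
  then have "N \<inter> U i = {v}" using G v by blast
  then have ex: "\<exists>i. isolates U N i \<and> named U N i = v" using named_eq by blast
  define k where "k = (LEAST i. isolates U N i \<and> named U N i = v)"
  have k: "isolates U N k \<and> named U N k = v" unfolding k_def by (rule LeastI_ex[OF ex])
  have "\<not> (isolates U N j \<and> named U N j = v)" if "j < k" for j
    using that not_less_Least unfolding k_def by blast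
  then have "canonical U N k" using k by (auto simp: canonical_def)
  then show "v \<in> named U N ` {i. canonical U N i}" using k by force
qed

text \<open>The criterion of \<open>delaunay_adj_iff_dense\<close> with nuclei and dense points
  replaced by their indices: every quantifier ranges over the naturals.\<close>

definition named_adj :: "(nat \<Rightarrow> 'a set) \<Rightarrow> (nat \<Rightarrow> 'a) \<Rightarrow> 'a::euclidean_space set \<Rightarrow> nat \<Rightarrow> nat \<Rightarrow> bool" where
  "named_adj U D N i j \<longleftrightarrow> dist (named U N i) (named U N j) \<noteq> 0 \<and>
     (\<exists>q. \<forall>k. canonical U N k \<longrightarrow> dist (named U N k) (named U N i) = 0 \<or> dist (named U N k) (named U N j) = 0 \<or>
        dist (bisector_proj (named U N i) (named U N j) (D q)) (named U N i)
        < dist (bisector_proj (named U N i) (named U N j) (D q)) (named U N k))"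

definition named_saw :: "(nat \<Rightarrow> 'a set) \<Rightarrow> (nat \<Rightarrow> 'a) \<Rightarrow> 'a::euclidean_space set \<Rightarrow> nat \<Rightarrow> nat list \<Rightarrow> bool" where
  "named_saw U D N n is \<longleftrightarrow> length is = n + 1 \<and> distinct is \<and> (\<forall>i. i \<in> set is \<longrightarrow> canonical U N i) \<and>
     (\<forall>k. canonical U N k \<longrightarrow> dist 0 (named U N (hd is)) \<le> dist 0 (named U N k)) \<and>
     (\<forall>l. Suc l < length is \<longrightarrow> named_adj U D N (is ! l) (is ! Suc l))"

text \<open>The paths, which are lists over a random set, are exchanged for lists of indices from
  one fixed countable set, so that membership can be tested list by list.\<close>

lemma bij_betw_named_saws:
  fixes N :: "'a::euclidean_space set"
  assumes lf: "locally_finite N" and o: "origin_unique N"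
    and U: "\<And>G x. open G \<Longrightarrow> x \<in> G \<Longrightarrow> \<exists>i. x \<in> U i \<and> U i \<subseteq> G"
    and D: "\<And>X. open X \<Longrightarrow> X \<noteq> {} \<Longrightarrow> \<exists>i. D i \<in> X"
  shows "bij_betw (map (named U N)) {is. named_saw U D N n is} (delaunay_saws N n)"
proof -
  let ?Y = "named U N" and ?C = "{i. canonical U N i}"
  have bij: "bij_betw ?Y ?C N" using bij_betw_named[OF lf U] .
  then have inj: "inj_on ?Y ?C" and img: "?Y ` ?C = N" by (auto simp: bij_betw_def)
  have D': "\<exists>d\<in>range D. d \<in> X" if "open X" "X \<noteq> {}" for X using D[OF that] by blast
  have "(\<forall>w\<in>?Y ` ?C. P w) \<longleftrightarrow> (\<forall>k. canonical U N k \<longrightarrow> P (?Y k))" for P by blast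
  then have allN: "(\<forall>w\<in>N. P w) \<longleftrightarrow> (\<forall>k. canonical U N k \<longrightarrow> P (?Y k))" for P by (simp only: img)
  have adj: "named_adj U D N i j \<longleftrightarrow> delaunay_adj N (?Y i) (?Y j)" if "i \<in> ?C" "j \<in> ?C" for i j
  proof -
    have mem: "?Y i \<in> N" "?Y j \<in> N" using that img by blast+
    let ?Q = "\<lambda>q w. dist (bisector_proj (?Y i) (?Y j) q) (?Y i) < dist (bisector_proj (?Y i) (?Y j) q) w"
    have "(\<forall>w\<in>N - {?Y i, ?Y j}. ?Q q w) \<longleftrightarrow> (\<forall>w\<in>N. w = ?Y i \<or> w = ?Y j \<or> ?Q q w)" for q by blast
    then have "(\<forall>w\<in>N - {?Y i, ?Y j}. ?Q q w) \<longleftrightarrow>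
        (\<forall>k. canonical U N k \<longrightarrow> ?Y k = ?Y i \<or> ?Y k = ?Y j \<or> ?Q q (?Y k))" for q
      by (simp only: allN)
    moreover have "delaunay_adj N (?Y i) (?Y j) \<longleftrightarrow> ?Y i \<noteq> ?Y j \<and> (\<exists>q\<in>range D. \<forall>w\<in>N - {?Y i, ?Y j}. ?Q q w)"
      by (rule delaunay_adj_iff_dense[OF lf mem D'])
    ultimately show ?thesis by (simp add: named_adj_def)
  qed
  have org: "(\<forall>k. canonical U N k \<longrightarrow> dist 0 (?Y i) \<le> dist 0 (?Y k)) \<longleftrightarrow> ?Y i = origin_nucleus N"
    if i: "i \<in> ?C" for i
  proof -
    have "(\<forall>k. canonical U N k \<longrightarrow> dist 0 (?Y i) \<le> dist 0 (?Y k)) \<longleftrightarrow> 0 \<in> voronoi_tile N (?Y i)"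
      unfolding voronoi_tile_def by (simp add: allN)
    moreover have "?Y i \<in> N" using i img by blast
    ultimately show ?thesis using origin_nucleus_eq[OF o] origin_nucleusI[OF o] by metis
  qed
  have saw: "named_saw U D N n is \<longleftrightarrow> map ?Y is \<in> delaunay_saws N n" if "set is \<subseteq> ?C" for "is"
  proof (cases "length is = n + 1")
    case True
    then have "is \<noteq> []" by auto
    then have hd: "hd is \<in> ?C" "hd (map ?Y is) = ?Y (hd is)" using that hd_in_set by (blast, simp add: hd_map)
    have "distinct (map ?Y is) \<longleftrightarrow> distinct is"
      using inj_on_subset[OF inj that] by (simp add: distinct_map)
    moreover have "set (map ?Y is) \<subseteq> N" using that img by auto
    moreover have "successively (delaunay_adj N) (map ?Y is) \<longleftrightarrow>
        (\<forall>l. Suc l < length is \<longrightarrow> named_adj U D N (is ! l) (is ! Suc l))"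
    proof -
      have mem: "is ! l \<in> ?C" if "l < length is" for l using that \<open>set is \<subseteq> ?C\<close> nth_mem by blast
      have "named_adj U D N (is ! l) (is ! Suc l) \<longleftrightarrow> delaunay_adj N (?Y (is ! l)) (?Y (is ! Suc l))"
        if "Suc l < length is" for l using that by (intro adj mem) auto
      then show ?thesis by (auto simp: successively_conv_nth)
    qed
    ultimately show ?thesis
      using True that hd org[OF hd(1)] by (auto simp: named_saw_def delaunay_saws_def)
  qed (auto simp: named_saw_def delaunay_saws_def)
  have sub: "named_saw U D N n is \<Longrightarrow> set is \<subseteq> ?C" for "is" by (auto simp: named_saw_def)
  show ?thesis
    unfolding bij_betw_def
  proof (intro conjI equalityI subsetI)
    show "inj_on (map ?Y) {is. named_saw U D N n is}"
    proof (rule inj_onI)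
      fix "is" js assume "is \<in> {is. named_saw U D N n is}" "js \<in> {is. named_saw U D N n is}"
        "map ?Y is = map ?Y js"
      then show "is = js" using sub by (auto intro!: map_inj_on[of ?Y "is" js] inj_on_subset[OF inj])
    qed
  next
    fix xs assume "xs \<in> map ?Y ` {is. named_saw U D N n is}"
    then show "xs \<in> delaunay_saws N n" using saw sub by auto
  next
    fix xs assume xs: "xs \<in> delaunay_saws N n"
    then have "set xs \<subseteq> ?Y ` ?C" using img by (auto simp: delaunay_saws_def)
    then have "\<forall>x\<in>set xs. \<exists>i. i \<in> ?C \<and> ?Y i = x" by blast
    then obtain g where g: "\<And>x. x \<in> set xs \<Longrightarrow> g x \<in> ?C \<and> ?Y (g x) = x" by metis
    have "map ?Y (map g xs) = xs" using g by (simp add: map_idI)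
    moreover have "set (map g xs) \<subseteq> ?C" using g by auto
    ultimately show "xs \<in> map ?Y ` {is. named_saw U D N n is}"
      using saw[of "map g xs"] xs by (metis imageI mem_Collect_eq)
  qed
qed

text \<open>Applied to sets of lists of naturals, both existential quantifiers are countable, so the
  cardinality of a random set is measurable as soon as membership is. The second disjunct is the
  convention that an infinite set has cardinality 0.\<close>

lemma card_eq_iff_list:
  "card L = k \<longleftrightarrow> (\<exists>ls. length ls = k \<and> distinct ls \<and> (\<forall>x. x \<in> set ls \<longleftrightarrow> x \<in> L)) \<or>
    (k = 0 \<and> \<not> (\<exists>ls. \<forall>x. x \<in> set ls \<longleftrightarrow> x \<in> L))"
proof (cases "finite L")
  case True
  then obtain ls where "set ls = L" "distinct ls" using finite_distinct_list by blast
  then show ?thesis using distinct_card by (metis set_eqI)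
next
  case False
  then have "\<not> (\<forall>x. x \<in> set ls \<longleftrightarrow> x \<in> L)" for ls by (metis List.finite_set set_eqI)
  then show ?thesis using False by auto
qed

context poisson_nuclei
begin

text \<open>If \<open>U i\<close> contains exactly one nucleus, that nucleus lies in an open
  half-space exactly when the intersection of \<open>U i\<close> with the half-space also has count
  1. Coordinates of the named point are thus governed by counts of Borel sets.\<close>

lemma named_measurable:
  assumes U: "\<And>i. open (U i)"
  shows "(\<lambda>\<omega>. named U (N \<omega>) i) \<in> borel_measurable M"
    and "Measurable.pred M (\<lambda>\<omega>. isolates U (N \<omega>) i)"
proof -
  have [measurable]: "(\<lambda>\<omega>. num_points (N \<omega>) (U j)) \<in> borel_measurable M" for j
    using U by (intro num_points_measurable) auto
  show iso: "Measurable.pred M (\<lambda>\<omega>. isolates U (N \<omega>) i)" unfolding isolates_def by measurable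
  show "(\<lambda>\<omega>. named U (N \<omega>) i) \<in> borel_measurable M"
  proof (subst borel_measurable_euclidean_space, intro ballI borel_measurableI_less)
    fix b :: 'a and a :: real
    let ?V = "U i \<inter> {x. x \<bullet> b < a}"
    have [measurable]: "(\<lambda>\<omega>. num_points (N \<omega>) ?V) \<in> borel_measurable M"
      using U by (intro num_points_measurable sets.Int) auto
    have "named U (N \<omega>) i \<bullet> b < a \<longleftrightarrow>
        (isolates U (N \<omega>) i \<and> num_points (N \<omega>) ?V = 1) \<or> (\<not> isolates U (N \<omega>) i \<and> 0 < a)" for \<omega>
    proof (cases "isolates U (N \<omega>) i")
      case True
      let ?y = "named U (N \<omega>) i"
      have "N \<omega> \<inter> ?V = {?y} \<inter> {x. x \<bullet> b < a}" using isolatesD[OF True] by blast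
      then have "num_points (N \<omega>) ?V = 1 \<longleftrightarrow> ?y \<bullet> b < a"
        unfolding num_points_eq_1_iff by auto
      then show ?thesis using True by simp
    qed (simp add: named_def)
    moreover have "{\<omega> \<in> space M. (isolates U (N \<omega>) i \<and> num_points (N \<omega>) ?V = 1) \<or> (\<not> isolates U (N \<omega>) i \<and> 0 < a)} \<in> events"
      using iso by measurable
    ultimately show "{\<omega> \<in> space M. named U (N \<omega>) i \<bullet> b < a} \<in> events" by simp
  qed
qed

lemma named_saw_measurable:
  assumes U: "\<And>i. open (U i)"
  shows "Measurable.pred M (\<lambda>\<omega>. named_saw U D (N \<omega>) n is)"
proof -
  note [measurable] = named_measurable[OF U]
  have [measurable]: "Measurable.pred M (\<lambda>\<omega>. canonical U (N \<omega>) i)" for i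
    unfolding canonical_def by measurable
  have [measurable]: "Measurable.pred M (\<lambda>\<omega>. named_adj U D (N \<omega>) i j)" for i j
    unfolding named_adj_def bisector_proj_def by measurable
  show ?thesis unfolding named_saw_def by measurable
qed

text \<open>Only almost surely does the number of paths agree with the measurable count of index
  lists. On the remaining null set nothing is known about it, hence the completion, in which every
  subset of a null set is measurable.\<close>

lemma log_num_saws_measurable:
  "(\<lambda>\<omega>. log_num_saws (N \<omega>) n) \<in> borel_measurable (completion M)"
proof -
  obtain U :: "nat \<Rightarrow> 'a set" where U: "\<And>i. open (U i)"
    "\<And>G x. open G \<Longrightarrow> x \<in> G \<Longrightarrow> \<exists>i. x \<in> U i \<and> U i \<subseteq> G" using open_enumeration by blast
  obtain D :: "nat \<Rightarrow> 'a" where D: "\<And>X. open X \<Longrightarrow> X \<noteq> {} \<Longrightarrow> \<exists>i. D i \<in> X"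
    using dense_enumeration by blast
  define L where "L \<omega> = {is. named_saw U D (N \<omega>) n is}" for \<omega>
  have [measurable]: "Measurable.pred M (\<lambda>\<omega>. is \<in> L \<omega>)" for "is"
    unfolding L_def mem_Collect_eq by (rule named_saw_measurable[OF U(1)])
  have "Measurable.pred M (\<lambda>\<omega>. card (L \<omega>) = k)" for k
    unfolding card_eq_iff_list by measurable
  then have "(\<lambda>\<omega>. card (L \<omega>)) \<in> measurable M (count_space UNIV)"
    by (intro measurable_count_space_eq2_countable[THEN iffD2])
      (auto simp: pred_def vimage_def Int_def conj_commute)
  then have "(\<lambda>\<omega>. ln (real (card (L \<omega>)))) \<in> borel_measurable M" by measurable
  then have g: "(\<lambda>\<omega>. ln (real (card (L \<omega>)))) \<in> borel_measurable (completion M)"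
    by (rule measurable_completion)
  have "AE \<omega> in M. log_num_saws (N \<omega>) n = ln (real (card (L \<omega>)))"
    using AE_nice
  proof eventually_elim
    case (elim \<omega>)
    then have "bij_betw (map (named U (N \<omega>))) (L \<omega>) (delaunay_saws (N \<omega>) n)"
      unfolding L_def using bij_betw_named_saws[OF _ _ U(2) D] by blast
    from bij_betw_same_card[OF this] show ?case by (simp add: log_num_saws_def)
  qed
  then obtain Z where Z: "Z \<in> null_sets M"
    "{\<omega> \<in> space M. log_num_saws (N \<omega>) n \<noteq> ln (real (card (L \<omega>)))} \<subseteq> Z"
    by (auto simp: eventually_ae_filter)
  show ?thesis
  proof (rule borel_measurableI)
    fix S :: "real set" assume "open S"
    let ?f = "\<lambda>\<omega>. log_num_saws (N \<omega>) n" and ?g = "\<lambda>\<omega>. ln (real (card (L \<omega>)))"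
    have 1: "?g -` S \<inter> space (completion M) \<in> sets (completion M)"
      using g \<open>open S\<close> by (intro measurable_sets) auto
    have 2: "?f -` S \<inter> space M \<inter> Z \<in> sets (completion M)"
      using Z(1) by (intro sets_completionI_sub[of Z]) auto
    have 3: "Z \<in> sets (completion M)" using Z(1) by auto
    have eq: "?f -` S \<inter> space (completion M) =
        (?g -` S \<inter> space (completion M) - Z) \<union> (?f -` S \<inter> space M \<inter> Z)"
      using Z(2) by auto
    show "?f -` S \<inter> space (completion M) \<in> sets (completion M)"
      unfolding eq using 1 2 3 by (intro sets.Un sets.Diff)
  qed
qed

end

section \<open>The tail estimate and the expectation\<close>

text \<open>With \<open>y\<close> for the cube root of \<open>j\<close>, the sixth power of
  \<open>1 + x \<le> exp x\<close> at \<open>x = a * y / 6\<close> gives the decay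
  \<open>y ^ 6 = j ^ 2\<close>, which is summable.\<close>

lemma summable_stretched_exp:
  assumes "a > 0" shows "summable (\<lambda>j::nat. exp (- a * real j powr (1 / 3)))"
proof (rule summable_comparison_test)
  have "norm (exp (- a * real j powr (1 / 3))) \<le> (6 / a) ^ 6 * inverse (real j ^ 2)" if j: "j \<ge> 1" for j
  proof -
    let ?y = "real j powr (1 / 3)"
    have y0: "?y > 0" using j by simp
    have y6: "?y ^ 6 = real j ^ 2" using j by (simp add: powr_power)
    have "(a * ?y / 6) ^ 6 \<le> exp (a * ?y / 6) ^ 6"
      using exp_ge_add_one_self[of "a * ?y / 6"] assms y0 by (intro power_mono) (linarith, simp)
    also have "\<dots> = exp (real 6 * (a * ?y / 6))" by (rule exp_of_nat_mult[symmetric])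
    also have "\<dots> = exp (a * ?y)" by simp
    finally have "(a * ?y / 6) ^ 6 \<le> exp (a * ?y)" .
    then have "inverse (exp (a * ?y)) \<le> inverse ((a * ?y / 6) ^ 6)"
      using assms y0 by (intro le_imp_inverse_le) auto
    also have "\<dots> = (6 / a) ^ 6 * inverse (?y ^ 6)"
      by (simp add: power_divide power_mult_distrib field_simps)
    finally show ?thesis by (simp add: y6 exp_minus)
  qed
  then show "\<exists>N. \<forall>n\<ge>N. norm (exp (- a * real n powr (1 / 3))) \<le> (6 / a) ^ 6 * inverse (real n ^ 2)" by blast
  show "summable (\<lambda>n. (6 / a) ^ 6 * inverse (real n ^ 2))"
    by (intro summable_mult inverse_power_summable) simp
qed

text \<open>A discrete layer-cake bound: the number of \<open>j\<close> with
  \<open>a + j \<le> x\<close> is at least \<open>x - a\<close>.\<close>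

lemma le_suminf_indicators:
  fixes x a :: real
  assumes "a \<ge> 0"
  shows "ennreal x \<le> ennreal a + (\<Sum>j. indicator {y. y \<ge> a + real j} x)"
proof (cases "x \<le> a")
  case True
  then have "ennreal x \<le> ennreal a" by (rule ennreal_leI)
  then show ?thesis by (simp add: add_increasing2)
next
  case False
  define k where "k = nat \<lceil>x - a\<rceil>"
  have k: "x - a \<le> real k" "\<And>j. j < k \<Longrightarrow> a + real j \<le> x" unfolding k_def by linarith+
  have "ennreal x \<le> ennreal (a + real k)" using k by (intro ennreal_leI) simp
  also have "\<dots> = ennreal a + (\<Sum>j<k. 1)" using assms by (simp add: ennreal_of_nat_eq_real_of_nat)
  also have "(\<Sum>j<k. 1 :: ennreal) = (\<Sum>j<k. indicator {y. y \<ge> a + real j} x)"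
    using k(2) by (intro sum.cong) auto
  also have "\<dots> \<le> (\<Sum>j. indicator {y. y \<ge> a + real j} x)" by (intro sum_le_suminf summableI) auto
  finally show ?thesis by simp
qed

lemma log_num_saws_nonneg: "log_num_saws N n \<ge> 0"
  by (cases "card (delaunay_saws N n) = 0") (auto simp: log_num_saws_def)

context poisson_nuclei
begin

lemma tail_estimate:
  assumes dim: "DIM('a) \<ge> 2"
  shows "\<exists>z>0. \<exists>c2>0. \<forall>n. \<forall>u\<ge>z * real (n + 1).
    emeasure (completion M) {\<omega> \<in> space M. log_num_saws (N \<omega>) n \<ge> u} \<le> ennreal (exp (- c2 * u powr (1 / 3)))"
proof -
  obtain C :: real where C: "C \<ge> 1" and good: "\<And>n m. size_const * (n + 2) \<le> m \<Longrightarrow>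
    (\<exists>B\<in>events. prob B \<le> 2 * exp (- (real m powr (1 / 3))) \<and>
      (\<forall>\<omega>\<in>space M - B. origin_unique (N \<omega>) \<longrightarrow>
        finite (delaunay_saws (N \<omega>) n) \<and> log_num_saws (N \<omega>) n \<le> C * m))"
    using good_event_saws[OF dim] by blast
  define s where "s = real size_const"
  have "(16 * DIM('a) + 1) ^ 1 \<le> (16 * DIM('a) + 1) ^ DIM('a)" by (intro power_increasing) (auto simp: Suc_le_eq)
  then have "size_const \<ge> 4" unfolding size_const_def using dim by simp
  then have s4: "s \<ge> 4" by (simp add: s_def)
  obtain Z where Z: "Z \<in> null_sets M" "{\<omega> \<in> space M. \<not> origin_unique (N \<omega>)} \<subseteq> Z"
    using AE_nice by (auto simp: eventually_ae_filter)
  \<comment> \<open>Writing \<open>t = u / (4 * C)\<close>, this gives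
    \<open>t \<ge> 2 * s * (n + 1) \<ge> 8\<close>. The size used below is the integer part of
    \<open>2 * t\<close>, so that \<open>C * m \<le> u / 2\<close> while
    \<open>m \<ge> t \<ge> s * (n + 2)\<close>. The factor \<open>n + 1\<close> instead of
    \<open>n\<close> includes \<open>n = 0\<close>, for which integrability is claimed as
    well.\<close>
  define z where "z = 8 * C * s"
  \<comment> \<open>Then \<open>c2 * u powr (1 / 3)\<close> is half of
    \<open>t powr (1 / 3)\<close>. The other half is at least 1 because \<open>t \<ge> 8\<close>,
    and so absorbs the factor 2 in the failure probability.\<close>
  define c2 where "c2 = (1 / (4 * C)) powr (1 / 3) / 2"
  have z0: "z > 0" and c20: "c2 > 0" using C s4 by (auto simp: z_def c2_def)
  have "emeasure (completion M) {\<omega> \<in> space M. log_num_saws (N \<omega>) n \<ge> u} \<le> ennreal (exp (- c2 * u powr (1 / 3)))"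
    if u: "u \<ge> z * real (n + 1)" for n u
  proof -
    define t where "t = u / (4 * C)"
    have "8 * C * s * (n + 1) \<le> u" using u by (simp add: z_def)
    then have t: "2 * s * (n + 1) \<le> t" using C by (simp add: t_def field_simps)
    have "2 * 4 * 1 \<le> 2 * s * real (n + 1)" using s4 by (intro mult_mono) auto
    then have t8: "t \<ge> 8" using t by linarith
    have u0: "u > 0" using t8 C by (simp add: t_def zero_less_divide_iff) (smt (verit) divide_nonpos_pos)
    define m where "m = nat \<lfloor>2 * t\<rfloor>"
    have m: "real m \<le> 2 * t" "2 * t - 1 \<le> real m" using t8 unfolding m_def by linarith+
    have "s * (n + 2) \<le> 2 * s * (n + 1)" using s4 by (simp add: algebra_simps)
    then have "s * real (n + 2) \<le> real m" using t m(2) t8 by linarith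
    then have "real (size_const * (n + 2)) \<le> real m" by (simp only: of_nat_mult s_def)
    then have "size_const * (n + 2) \<le> m" by (simp only: of_nat_le_iff)
    from good[OF this] obtain B where B: "B \<in> events" "prob B \<le> 2 * exp (- (real m powr (1 / 3)))"
      "\<And>\<omega>. \<omega> \<in> space M - B \<Longrightarrow> origin_unique (N \<omega>) \<Longrightarrow> log_num_saws (N \<omega>) n \<le> C * m" by blast
    have Cm: "C * m < u"
    proof -
      have "C * m \<le> C * (2 * t)" using m C by (intro mult_left_mono) auto
      also have "\<dots> = u / 2" using C by (simp add: t_def)
      also have "\<dots> < u" using u0 by simp
      finally show ?thesis .
    qed
    have "{\<omega> \<in> space M. log_num_saws (N \<omega>) n \<ge> u} \<subseteq> B \<union> Z"
    proof
      fix \<omega> assume w: "\<omega> \<in> {\<omega> \<in> space M. log_num_saws (N \<omega>) n \<ge> u}"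
      show "\<omega> \<in> B \<union> Z"
      proof (rule ccontr)
        assume n: "\<omega> \<notin> B \<union> Z"
        then have "origin_unique (N \<omega>)" using w Z(2) by blast
        then have "log_num_saws (N \<omega>) n \<le> C * m" using B(3) w n by blast
        then show False using w Cm by simp
      qed
    qed
    moreover have BZ: "B \<union> Z \<in> events" using B Z by auto
    ultimately have "emeasure (completion M) {\<omega> \<in> space M. log_num_saws (N \<omega>) n \<ge> u} \<le> emeasure (completion M) (B \<union> Z)"
      by (intro emeasure_mono) auto
    also have "\<dots> = emeasure M B" using BZ B Z by (simp add: emeasure_Un_null_set)
    also have "\<dots> \<le> ennreal (2 * exp (- (real m powr (1 / 3))))" using B(2) by (simp add: emeasure_eq_measure ennreal_leI)
    also have "\<dots> \<le> ennreal (exp (- c2 * u powr (1 / 3)))"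
    proof (rule ennreal_leI)
      have "t powr (1 / 3) \<le> real m powr (1 / 3)" using m t8 by (intro powr_mono2) auto
      moreover have "2 \<le> t powr (1 / 3)"
      proof -
        have "2 = (8::real) powr (1 / 3)" using powr_powr[of 2 3 "1 / 3"] by simp
        also have "\<dots> \<le> t powr (1 / 3)" using t8 by (intro powr_mono2) auto
        finally show ?thesis .
      qed
      moreover have "2 * c2 * u powr (1 / 3) = t powr (1 / 3)"
      proof -
        have "t = (1 / (4 * C)) * u" by (simp add: t_def)
        then show ?thesis using C u0 by (simp only: c2_def powr_mult)
      qed
      ultimately have "1 - real m powr (1 / 3) \<le> - c2 * u powr (1 / 3)" by linarith
      have "2 * exp (- (real m powr (1 / 3))) \<le> exp 1 * exp (- (real m powr (1 / 3)))"
        using exp_ge_add_one_self[of 1] by (intro mult_right_mono) auto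
      also have "\<dots> = exp (1 - real m powr (1 / 3))" by (simp flip: exp_add)
      also have "\<dots> \<le> exp (- c2 * u powr (1 / 3))"
        using \<open>1 - real m powr (1 / 3) \<le> - c2 * u powr (1 / 3)\<close> by simp
      finally show "2 * exp (- (real m powr (1 / 3))) \<le> exp (- c2 * u powr (1 / 3))" .
    qed
    finally show ?thesis .
  qed
  then show ?thesis using z0 c20 by blast
qed

text \<open>Beyond the linear level \<open>z * (n + 1)\<close> the tail bounds are dominated by
  \<open>exp (- c2 * j powr (1 / 3))\<close>, whose sum \<open>E\<close> does not depend on
  \<open>n\<close>; hence the expectation is linear up to an additive constant.\<close>

lemma expectation_bound:
  assumes z: "z > 0" and c2: "c2 > 0"
    and tail: "\<And>n u. u \<ge> z * real (n + 1) \<Longrightarrow>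
      emeasure (completion M) {\<omega> \<in> space M. log_num_saws (N \<omega>) n \<ge> u} \<le> ennreal (exp (- c2 * u powr (1 / 3)))"
  defines "E \<equiv> (\<Sum>j. exp (- c2 * real j powr (1 / 3)))"
  shows "integrable (completion M) (\<lambda>\<omega>. log_num_saws (N \<omega>) n)"
    and "(\<integral>\<omega>. log_num_saws (N \<omega>) n \<partial>completion M) \<le> z * real (n + 1) + E"
proof -
  let ?X = "\<lambda>\<omega>. log_num_saws (N \<omega>) n" and ?M = "completion M"
  let ?a = "z * real (n + 1)"
  note [measurable] = log_num_saws_measurable
  have a0: "?a \<ge> 0" using z by simp
  note sm = summable_stretched_exp[OF c2]
  have E0: "E \<ge> 0" unfolding E_def by (intro suminf_nonneg sm) simp
  have ev: "{\<omega> \<in> space M. ?X \<omega> \<ge> u} \<in> sets ?M" for u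
    using measurable_sets[OF log_num_saws_measurable[of n], of "{u..}"]
    by (simp add: vimage_def Int_def conj_commute)
  have "(\<integral>\<^sup>+\<omega>. ennreal (?X \<omega>) \<partial>?M) \<le>
      (\<integral>\<^sup>+\<omega>. ennreal ?a + (\<Sum>j. indicator {\<omega> \<in> space M. ?X \<omega> \<ge> ?a + real j} \<omega>) \<partial>?M)"
  proof (rule nn_integral_mono)
    fix \<omega> assume "\<omega> \<in> space ?M"
    then have "indicator {\<omega> \<in> space M. ?X \<omega> \<ge> ?a + real j} \<omega> = (indicator {y. y \<ge> ?a + real j} (?X \<omega>) :: ennreal)" for j
      by (simp add: indicator_def)
    then show "ennreal (?X \<omega>) \<le> ennreal ?a + (\<Sum>j. indicator {\<omega> \<in> space M. ?X \<omega> \<ge> ?a + real j} \<omega>)"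
      using le_suminf_indicators[OF a0, of "?X \<omega>"] by simp
  qed
  also have "\<dots> = ennreal ?a * emeasure ?M (space ?M) + (\<Sum>j. emeasure ?M {\<omega> \<in> space M. ?X \<omega> \<ge> ?a + real j})"
    using ev by (subst nn_integral_add) (auto simp: nn_integral_suminf)
  also have "\<dots> \<le> ennreal ?a + (\<Sum>j. ennreal (exp (- c2 * real j powr (1 / 3))))"
  proof (intro add_mono suminf_le summableI)
    show "ennreal ?a * emeasure ?M (space ?M) \<le> ennreal ?a" by (simp add: emeasure_space_1)
    fix j
    have "emeasure ?M {\<omega> \<in> space M. ?X \<omega> \<ge> ?a + real j} \<le> ennreal (exp (- c2 * (?a + real j) powr (1 / 3)))"
      by (rule tail) simp
    also have "\<dots> \<le> ennreal (exp (- c2 * real j powr (1 / 3)))"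
      using a0 c2 by (intro ennreal_leI) (simp add: powr_mono2)
    finally show "emeasure ?M {\<omega> \<in> space M. ?X \<omega> \<ge> ?a + real j} \<le> ennreal (exp (- c2 * real j powr (1 / 3)))" .
  qed
  also have "\<dots> = ennreal ?a + ennreal E" unfolding E_def by (subst suminf_ennreal2[OF _ sm]) auto
  also have "\<dots> = ennreal (?a + E)" using a0 E0 by simp
  finally have bound: "(\<integral>\<^sup>+\<omega>. ennreal (?X \<omega>) \<partial>?M) \<le> ennreal (?a + E)" .
  then show "integrable ?M ?X"
    by (intro integrableI_nonneg) (auto simp: log_num_saws_nonneg intro: le_less_trans)
  show "(\<integral>\<omega>. ?X \<omega> \<partial>?M) \<le> ?a + E"
    using bound a0 E0 by (intro integral_real_bounded) auto
qed

end

theorem proposition4p1: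
  fixes M :: "'w measure"
    and \<mu> :: "'a::euclidean_space measure"
    and N :: "'w \<Rightarrow> 'a set"
  assumes "DIM('a) \<ge> 2"
    and "prob_space M"
    and "comparable_to_lebesgue \<mu>"
    and "poisson_random_set M \<mu> N"
  shows "(\<forall>n. AE \<omega> in M. finite (delaunay_saws (N \<omega>) n) \<and> delaunay_saws (N \<omega>) n \<noteq> {}) \<and>
    (\<forall>n. integrable (completion M) (\<lambda>\<omega>. log_num_saws (N \<omega>) n)) \<and>
    (\<exists>z3>0. \<exists>c2>0. \<forall>n\<ge>1. \<forall>u\<ge>real n * z3.
       measure (completion M) {\<omega> \<in> space M. log_num_saws (N \<omega>) n \<ge> u}
         \<le> exp (- c2 * u powr (1/3))) \<and>
    (\<lambda>n. \<integral>\<omega>. log_num_saws (N \<omega>) n \<partial>(completion M)) \<in> O(\<lambda>n. real n)"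
proof -
  obtain c where c: "c > 0" "sets \<mu> = sets lebesgue" "\<forall>A\<in>sets lebesgue.
      ennreal (1 / c) * emeasure lebesgue A \<le> emeasure \<mu> A \<and> emeasure \<mu> A \<le> ennreal c * emeasure lebesgue A"
    using assms(3) by (auto simp: comparable_to_lebesgue_def)
  interpret prob_space M by (rule assms(2))
  interpret poisson_nuclei M \<mu> N c
    by unfold_locales (use assms(4) c in auto)
  obtain z c2 where z: "z > 0" and c2: "c2 > 0" and tail: "\<And>n u. u \<ge> z * real (n + 1) \<Longrightarrow>
      emeasure (completion M) {\<omega> \<in> space M. log_num_saws (N \<omega>) n \<ge> u} \<le> ennreal (exp (- c2 * u powr (1 / 3)))"
    using tail_estimate[OF assms(1)] by blast
  note E = expectation_bound[OF z c2 tail]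
  have "AE \<omega> in M. finite (delaunay_saws (N \<omega>) n) \<and> delaunay_saws (N \<omega>) n \<noteq> {}" for n
    using AE_saws[OF assms(1)] by eventually_elim blast
  moreover have "\<exists>z3>0. \<exists>c2>0. \<forall>n\<ge>1. \<forall>u\<ge>real n * z3.
      measure (completion M) {\<omega> \<in> space M. log_num_saws (N \<omega>) n \<ge> u} \<le> exp (- c2 * u powr (1 / 3))"
  \<comment> \<open>The factor 2 passes from \<open>n + 1\<close> to \<open>n\<close>, since
    \<open>n + 1 \<le> 2 * n\<close> for \<open>n \<ge> 1\<close>.\<close>
  proof (rule exI[of _ "2 * z"], intro conjI, goal_cases)
    case 2
    show ?case
    proof (rule exI[of _ c2], intro conjI c2 allI impI)
      fix n :: nat and u :: real assume n: "n \<ge> 1" and u: "u \<ge> real n * (2 * z)"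
      have "z * real (n + 1) \<le> z * (2 * real n)" using n z by (intro mult_left_mono) auto
      then have "u \<ge> z * real (n + 1)" using u by (simp add: algebra_simps)
      from tail[OF this] show "measure (completion M) {\<omega> \<in> space M. log_num_saws (N \<omega>) n \<ge> u} \<le> exp (- c2 * u powr (1 / 3))"
        by (simp add: measure_def enn2real_leI)
    qed
  qed (use z in simp)
  moreover have "(\<lambda>n. \<integral>\<omega>. log_num_saws (N \<omega>) n \<partial>(completion M)) \<in> O(\<lambda>n. real n)"
  proof (rule bigoI)
    let ?E = "\<Sum>j. exp (- c2 * real j powr (1 / 3))"
    show "\<forall>\<^sub>F n in sequentially. norm (\<integral>\<omega>. log_num_saws (N \<omega>) n \<partial>(completion M)) \<le> (2 * z + ?E) * norm (real n)"
      using eventually_ge_at_top[of 1]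
    proof eventually_elim
      case (elim n)
      have E0: "?E \<ge> 0" by (intro suminf_nonneg summable_stretched_exp c2) simp
      have "(\<integral>\<omega>. log_num_saws (N \<omega>) n \<partial>(completion M)) \<ge> 0" by (simp add: log_num_saws_nonneg)
      moreover have "z * real (n + 1) \<le> z * (2 * real n)" using elim z by (intro mult_left_mono) auto
      moreover have "?E * 1 \<le> ?E * real n" using elim E0 by (intro mult_left_mono) auto
      ultimately show ?case using E(2)[of n] by (simp add: algebra_simps)
    qed
  qed
  ultimately show ?thesis using E(1) by blast
qed

end
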